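(* Let $T\ge 2$, $\delta_0>0$ and $M>0$. There exists a constant $C_{\mathrm{obs}}>0$ such that for every $\gamma\in\mathcal G_{\mathrm{ad}}$, $$\|(\varphi_0,\varphi_1)\|_{\mathbf W}^2\le C_{\mathrm{obs}}\,\|\varphi\|_{L^2(q_\gamma)}^2\qquad\text{for all }(\varphi_0,\varphi_1)\in\mathbf W=L^2(0,1)\times H^{-1}(0,1),$$ where $\varphi$ is the solution of the homogeneous wave equation $\varphi_{tt}-\varphi_{xx}=0$ in $Q_T$, $\varphi=0$ on $\{0,1\}\times(0,T)$, $(\varphi,\varphi_t)(\cdot,0)=(\varphi_0,\varphi_1)$ in $(0,1)$.
   Context: $\Omega=(0,1)$, $Q_T=\Omega\times(0,T)$. The norm on $\mathbf W=L^2(\Omega)\times H^{-1}(\Omega)$ is $\|(\varphi_0,\varphi_1)\|_{\mathbf W}^2=\|\varphi_0\|_{L^2(\Omega)}^2+\|\varphi_1\|_{H^{-1}(\Omega)}^2$, with $H^{-1}(\Omega)$ the dual of $H^1_0(\Omega)$. For $(\varphi_0,\varphi_1)\in\mathbf W$ the wave equation has a unique solution, in the sense of transposition, $\varphi\in C([0,T];L^2(\Omega))\cap C^1([0,T];H^{-1}(\Omega))$. The set of admissible curves is $$\mathcal G_{\mathrm{ad}}=\{\gamma\in W^{1,\infty}(0,T):\ \|\gamma'\|_{L^\infty(0,T)}\le M,\ \delta_0\le\gamma\le 1-\delta_0\},$$ and for $\gamma\in\mathcal G_{\mathrm{ad}}$ the associated observation domain is $q_\gamma=\{(x,t)\in Q_T:\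 |x-\gamma(t)|<\delta_0\}$. *)

theory Defs
  imports "HOL-Analysis.Analysis" "HOL-Probability.Essential_Supremum"
begin

text \<open>Elements of Lebesgue and Sobolev spaces are represented by functions, without passing to
  classes modulo null sets; values outside the set under consideration are irrelevant.\<close>

definition L2_on :: "'a::euclidean_space set \<Rightarrow> ('a \<Rightarrow> real) set" where
  "L2_on S = {f. set_borel_measurable lebesgue S f \<and> set_integrable lebesgue S (\<lambda>x. (f x)\<^sup>2)}"

definition L2_norm_on :: "'a::euclidean_space set \<Rightarrow> ('a \<Rightarrow> real) \<Rightarrow> real" where
  "L2_norm_on S f = sqrt (set_lebesgue_integral lebesgue S (\<lambda>x. (f x)\<^sup>2))"

definition Linf_norm_on :: "'a::euclidean_space set \<Rightarrow> ('a \<Rightarrow> real) \<Rightarrow> ereal" where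
  "Linf_norm_on S f = esssup (lebesgue_on S) (\<lambda>x. ereal \<bar>f x\<bar>)"

definition Linf_on :: "'a::euclidean_space set \<Rightarrow> ('a \<Rightarrow> real) set" where
  "Linf_on S = {f. set_borel_measurable lebesgue S f \<and> Linf_norm_on S f < \<infinity>}"

definition locally_integrable_on :: "real set \<Rightarrow> (real \<Rightarrow> real) \<Rightarrow> bool" where
  "locally_integrable_on S f \<longleftrightarrow> (\<forall>K. compact K \<and> K \<subseteq> S \<longrightarrow> set_integrable lebesgue K f)"

definition test_functions :: "real set \<Rightarrow> (real \<Rightarrow> real) set" where
  "test_functions S = {\<eta>. (\<forall>n x. (deriv ^^ n) \<eta> field_differentiable at x) \<and>
     (\<exists>K. compact K \<and> K \<subseteq> S \<and> (\<forall>x. x \<notin> K \<longrightarrow> \<eta> x = 0))}"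

definition has_weak_deriv_on :: "real set \<Rightarrow> (real \<Rightarrow> real) \<Rightarrow> (real \<Rightarrow> real) \<Rightarrow> bool" where
  "has_weak_deriv_on S f g \<longleftrightarrow> locally_integrable_on S f \<and> locally_integrable_on S g \<and>
     (\<forall>\<eta>\<in>test_functions S.
        set_lebesgue_integral lebesgue S (\<lambda>x. f x * deriv \<eta> x) =
        - set_lebesgue_integral lebesgue S (\<lambda>x. g x * \<eta> x))"

text \<open>For open \<open>S\<close> the weak derivative is unique up to null sets of \<open>S\<close>, so that the choice made
  here affects neither norms nor membership in \<open>L2_on S\<close> and \<open>Linf_on S\<close>.\<close>

definition weak_deriv_on :: "real set \<Rightarrow> (real \<Rightarrow> real) \<Rightarrow> real \<Rightarrow> real" where
  "weak_deriv_on S f = (SOME g. has_weak_deriv_on S f g)"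

definition W1inf_on :: "real set \<Rightarrow> (real \<Rightarrow> real) set" where
  "W1inf_on S = {f \<in> Linf_on S. \<exists>g\<in>Linf_on S. has_weak_deriv_on S f g}"

definition H1_on :: "real set \<Rightarrow> (real \<Rightarrow> real) set" where
  "H1_on S = {f \<in> L2_on S. \<exists>g\<in>L2_on S. has_weak_deriv_on S f g}"

definition H1_norm_on :: "real set \<Rightarrow> (real \<Rightarrow> real) \<Rightarrow> real" where
  "H1_norm_on S f = sqrt ((L2_norm_on S f)\<^sup>2 + (L2_norm_on S (weak_deriv_on S f))\<^sup>2)"

definition Omega :: "real set" where
  "Omega = {0<..<1}"

text \<open>The space \<open>H\<^sup>1\<^sub>0(0,1)\<close> is the closure of the test functions in \<open>H\<^sup>1(0,1)\<close>. It carries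
  the norm of the gradient, equivalent to the full norm by the Poincare inequality.\<close>

definition H10 :: "(real \<Rightarrow> real) set" where
  "H10 = {v \<in> H1_on Omega. \<exists>\<eta>. (\<forall>n. \<eta> n \<in> test_functions Omega) \<and>
     (\<lambda>n::nat. H1_norm_on Omega (\<lambda>x. \<eta> n x - v x)) \<longlonglongrightarrow> 0}"

definition H10_norm :: "(real \<Rightarrow> real) \<Rightarrow> real" where
  "H10_norm v = L2_norm_on Omega (weak_deriv_on Omega v)"

text \<open>Bounded linear functionals on \<open>H\<^sup>1\<^sub>0(0,1)\<close>. Linearity and boundedness force them to be
  invariant under changes of the argument on null sets.\<close>

definition Hm1 :: "((real \<Rightarrow> real) \<Rightarrow> real) set" where
  "Hm1 = {l. (\<forall>v\<in>H10. \<forall>w\<in>H10. l (\<lambda>x. v x + w x) = l v + l w) \<and>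
     (\<forall>v\<in>H10. \<forall>a. l (\<lambda>x. a * v x) = a * l v) \<and>
     (\<exists>C. \<forall>v\<in>H10. \<bar>l v\<bar> \<le> C * H10_norm v)}"

definition Hm1_norm :: "((real \<Rightarrow> real) \<Rightarrow> real) \<Rightarrow> real" where
  "Hm1_norm l = (SUP v\<in>{v \<in> H10. H10_norm v \<le> 1}. \<bar>l v\<bar>)"

text \<open>The embedding of \<open>L\<^sup>2(0,1)\<close> into \<open>H\<^sup>-\<^sup>1(0,1)\<close>, with \<open>L\<^sup>2(0,1)\<close> as pivot space.\<close>

definition L2_embed :: "(real \<Rightarrow> real) \<Rightarrow> (real \<Rightarrow> real) \<Rightarrow> real" where
  "L2_embed u = (\<lambda>v. set_lebesgue_integral lebesgue Omega (\<lambda>x. u x * v x))"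

definition W_norm :: "(real \<Rightarrow> real) \<Rightarrow> ((real \<Rightarrow> real) \<Rightarrow> real) \<Rightarrow> real" where
  "W_norm \<phi>0 \<phi>1 = sqrt ((L2_norm_on Omega \<phi>0)\<^sup>2 + (Hm1_norm \<phi>1)\<^sup>2)"

definition Q :: "real \<Rightarrow> (real \<times> real) set" where
  "Q T = Omega \<times> {0<..<T}"

text \<open>A function \<open>u\<close> of time and space is written \<open>u t x\<close>, so that \<open>u t\<close> is its profile at time
  \<open>t\<close>, whereas the points of \<open>Q T\<close> are pairs \<open>(x, t)\<close>.\<close>

definition C1_rect ::
  "real \<Rightarrow> (real \<Rightarrow> real \<Rightarrow> real) \<Rightarrow> (real \<Rightarrow> real \<Rightarrow> real) \<Rightarrow> (real \<Rightarrow> real \<Rightarrow> real) \<Rightarrow> bool" where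
  "C1_rect T u ux ut \<longleftrightarrow>
     (\<forall>x\<in>{0..1}. \<forall>t\<in>{0..T}.
        ((\<lambda>y. u t y) has_real_derivative ux t x) (at x within {0..1}) \<and>
        ((\<lambda>s. u s x) has_real_derivative ut t x) (at t within {0..T})) \<and>
     continuous_on ({0..1} \<times> {0..T}) (\<lambda>(x, t). ux t x) \<and>
     continuous_on ({0..1} \<times> {0..T}) (\<lambda>(x, t). ut t x)"

text \<open>\<open>\<theta>\<close>, with time derivative \<open>\<theta>t\<close>, is a classical solution, of class \<open>C\<^sup>2\<close> up to the
  boundary, of the backward problem \<open>\<theta>\<^sub>t\<^sub>t - \<theta>\<^sub>x\<^sub>x = f\<close> with zero boundary and final data.\<close>

definition adjoint_solution ::
  "real \<Rightarrow> (real \<Rightarrow> real \<Rightarrow> real) \<Rightarrow> (real \<Rightarrow> real \<Rightarrow> real) \<Rightarrow> (real \<Rightarrow> real \<Rightarrow> real) \<Rightarrow> bool" where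
  "adjoint_solution T f \<theta> \<theta>t \<longleftrightarrow>
     (\<exists>\<theta>x \<theta>xx \<theta>xt \<theta>tx \<theta>tt.
        C1_rect T \<theta> \<theta>x \<theta>t \<and> C1_rect T \<theta>x \<theta>xx \<theta>xt \<and> C1_rect T \<theta>t \<theta>tx \<theta>tt \<and>
        (\<forall>x\<in>{0..1}. \<forall>t\<in>{0..T}. \<theta>tt t x - \<theta>xx t x = f t x)) \<and>
     (\<forall>t\<in>{0..T}. \<theta> t 0 = 0 \<and> \<theta> t 1 = 0) \<and>
     (\<forall>x\<in>{0..1}. \<theta> T x = 0 \<and> \<theta>t T x = 0)"

text \<open>The transposition identity is what integration by parts against \<open>\<theta>\<close> gives for a smooth
  solution; it encodes the equation, the boundary condition and both initial conditions.\<close>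

definition transposition_solution ::
  "real \<Rightarrow> (real \<Rightarrow> real) \<Rightarrow> ((real \<Rightarrow> real) \<Rightarrow> real) \<Rightarrow> (real \<Rightarrow> real \<Rightarrow> real) \<Rightarrow> bool" where
  "transposition_solution T \<phi>0 \<phi>1 \<phi> \<longleftrightarrow>
     (\<lambda>(x, t). \<phi> t x) \<in> L2_on (Q T) \<and>
     (\<forall>f \<theta> \<theta>t. adjoint_solution T f \<theta> \<theta>t \<longrightarrow>
        set_lebesgue_integral lebesgue (Q T) (\<lambda>(x, t). \<phi> t x * f t x) =
        \<phi>1 (\<theta> 0) - set_lebesgue_integral lebesgue Omega (\<lambda>x. \<phi>0 x * \<theta>t 0 x))"

definition cont_L2 :: "real \<Rightarrow> (real \<Rightarrow> real \<Rightarrow> real) \<Rightarrow> bool" where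
  "cont_L2 T \<phi> \<longleftrightarrow> (\<forall>t\<in>{0..T}. \<phi> t \<in> L2_on Omega \<and>
     ((\<lambda>s. L2_norm_on Omega (\<lambda>x. \<phi> s x - \<phi> t x)) \<longlongrightarrow> 0) (at t within {0..T}))"

definition C1_Hm1 :: "real \<Rightarrow> (real \<Rightarrow> real \<Rightarrow> real) \<Rightarrow> bool" where
  "C1_Hm1 T \<phi> \<longleftrightarrow> (\<exists>\<psi>. \<forall>t\<in>{0..T}. \<psi> t \<in> Hm1 \<and>
     ((\<lambda>s. Hm1_norm (\<lambda>v. (L2_embed (\<phi> s) v - L2_embed (\<phi> t) v) / (s - t) - \<psi> t v)) \<longlongrightarrow> 0)
       (at t within {0..T}) \<and>
     ((\<lambda>s. Hm1_norm (\<lambda>v. \<psi> s v - \<psi> t v)) \<longlongrightarrow> 0) (at t within {0..T}))"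

definition wave_solution ::
  "real \<Rightarrow> (real \<Rightarrow> real) \<Rightarrow> ((real \<Rightarrow> real) \<Rightarrow> real) \<Rightarrow> (real \<Rightarrow> real \<Rightarrow> real) \<Rightarrow> bool" where
  "wave_solution T \<phi>0 \<phi>1 \<phi> \<longleftrightarrow>
     transposition_solution T \<phi>0 \<phi>1 \<phi> \<and> cont_L2 T \<phi> \<and> C1_Hm1 T \<phi>"

text \<open>Since \<open>\<gamma>\<close> stands for its class modulo null sets, the pointwise bounds are imposed almost
  everywhere; changing \<open>\<gamma>\<close> on a null set changes \<open>q \<delta>0 T \<gamma>\<close> only by a null set.\<close>

definition G_ad :: "real \<Rightarrow> real \<Rightarrow> real \<Rightarrow> (real \<Rightarrow> real) set" where
  "G_ad \<delta>0 M T = {\<gamma> \<in> W1inf_on {0<..<T}.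
     Linf_norm_on {0<..<T} (weak_deriv_on {0<..<T} \<gamma>) \<le> ereal M \<and>
     (AE t in lebesgue_on {0<..<T}. \<delta>0 \<le> \<gamma> t \<and> \<gamma> t \<le> 1 - \<delta>0)}"

definition q :: "real \<Rightarrow> real \<Rightarrow> (real \<Rightarrow> real) \<Rightarrow> (real \<times> real) set" where
  "q \<delta>0 T \<gamma> = {(x, t) \<in> Q T. \<bar>x - \<gamma> t\<bar> < \<delta>0}"

end

theory Submission
  imports Defs
begin

text \<open>By duality the estimate says that smooth initial data of the adjoint problem can be steered to
  rest at time 2 by a source supported in \<open>q \<delta>0 T \<gamma>\<close> whose \<open>L\<^sup>2\<close> norm is bounded by the energy of
  the data. Such a source is explicit. The free wave is \<open>G (t + x) - G (t - x)\<close> with \<open>G\<close> of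
  period 2. Replace \<open>\<gamma>\<close> by a nearby \<open>C\<^sup>2\<close> curve \<open>k\<close>, and assume, reflecting \<open>x\<close> if necessary,
  that \<open>k 0 < k 2\<close>. During \<open>[0, 2]\<close> the left-going characteristics hitting the curve then cover a
  whole period, so that every pulse of \<open>G\<close> can be extinguished by a cutoff in \<open>x - k t\<close> while it
  travels to the left. The source this needs involves only \<open>G\<close>, \<open>G'\<close> and the first two derivatives
  of \<open>k\<close>, which are bounded in terms of \<open>\<delta>0\<close> and \<open>M\<close>.\<close>

text \<open>Time 2 is exactly critical: the left-going characteristics that meet a curve
  \<open>k\<close> during [0, 2] cover \<open>t + x\<close> from \<open>k 0\<close> to
  \<open>k 2 + 2\<close>, which is one period of \<open>G\<close> with nothing to spare if
  \<open>k 0 = k 2\<close>. A smooth cutoff needs an excess, with a lower bound independent of the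
  curve. The width of \<open>q \<delta>0 T \<gamma>\<close> supplies it: once the smoothed curve
  does not end to the left of its start, tilting it inside the observed strip makes
  \<open>k 2 - k 0\<close> at least \<open>\<delta>0\<close>. The source is explicit, so uniformity
  in \<gamma> requires no compactness argument. Cutting off a travelling wave leaves no second
  derivative of the profile in the source, because the profile itself solves the wave equation;
  hence the energy of the data suffices to bound the source in L2. The transposition identity admits
  only classical adjoint solutions, so duality yields estimates for smooth data only. Both
  components of the norm must therefore be recovered from test functions: data (\<eta>, 0) give the
  estimate for \<phi>1, data (0, \<eta>) the one for \<phi>0.\<close>

section \<open>Smooth functions and bumps\<close>

text \<open>Asking for some derivative at each level, instead of iterating \<open>deriv\<close> as
  \<open>test_functions\<close> does, makes closure under sums, products and affine substitutions a
  plain induction. \<open>smooth_iff\<close> relates the two forms.\<close>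

primrec ndiff :: "nat \<Rightarrow> (real \<Rightarrow> real) \<Rightarrow> bool" where
  "ndiff 0 f = True"
| "ndiff (Suc n) f = (\<exists>f'. (\<forall>x. (f has_real_derivative f' x) (at x)) \<and> ndiff n f')"

definition smooth :: "(real \<Rightarrow> real) \<Rightarrow> bool" where
  "smooth f \<longleftrightarrow> (\<forall>n. ndiff n f)"

lemma ndiff_SucI:
  "(\<And>x. (f has_real_derivative f' x) (at x)) \<Longrightarrow> ndiff n f' \<Longrightarrow> ndiff (Suc n) f"
  by auto

lemma ndiff_SucD: "ndiff (Suc n) f \<Longrightarrow> ndiff n f"
  by (induction n arbitrary: f) auto

lemma ndiff_iff_deriv:
  "ndiff (Suc n) f \<longleftrightarrow> (\<forall>x. f field_differentiable at x) \<and> ndiff n (deriv f)"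
proof
  assume "ndiff (Suc n) f"
  then obtain f' where f': "\<And>x. (f has_real_derivative f' x) (at x)" "ndiff n f'"
    by auto
  then have "deriv f = f'"
    by (auto intro: DERIV_imp_deriv)
  with f' show "(\<forall>x. f field_differentiable at x) \<and> ndiff n (deriv f)"
    by (auto simp: field_differentiable_def)
next
  assume "(\<forall>x. f field_differentiable at x) \<and> ndiff n (deriv f)"
  then show "ndiff (Suc n) f"
    by (intro ndiff_SucI[of f "deriv f"] field_differentiable_derivI) auto
qed

lemma smooth_deriv: "smooth f \<Longrightarrow> smooth (deriv f)"
  using ndiff_iff_deriv smooth_def by blast

lemma smooth_DERIV: "smooth f \<Longrightarrow> (f has_real_derivative deriv f x) (at x)"
  using ndiff_iff_deriv smooth_def field_differentiable_derivI by blast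

lemma smooth_isCont: "smooth f \<Longrightarrow> isCont f x"
  using smooth_DERIV DERIV_isCont by blast

lemma smooth_continuous: "smooth f \<Longrightarrow> continuous_on S f"
  by (simp add: continuous_at_imp_continuous_on smooth_isCont)

lemma smooth_antideriv:
  assumes "\<And>x. (F has_real_derivative f x) (at x)" "smooth f"
  shows "smooth F"
  unfolding smooth_def
proof
  show "ndiff n F" for n
    using ndiff_SucI[OF assms(1)] assms(2) ndiff_SucD smooth_def by blast
qed

lemma smooth_iff: "smooth f \<longleftrightarrow> (\<forall>n x. (deriv ^^ n) f field_differentiable at x)"
proof
  assume f: "smooth f"
  have "smooth ((deriv ^^ n) f)" for n
    by (induction n) (auto simp: f smooth_deriv)
  then show "\<forall>n x. (deriv ^^ n) f field_differentiable at x"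
    using smooth_DERIV field_differentiable_def by blast
next
  have "\<forall>n x. (deriv ^^ n) f field_differentiable at x \<Longrightarrow> ndiff m f" for m
  proof (induction m arbitrary: f)
    case (Suc m)
    then have "\<forall>n x. (deriv ^^ n) (deriv f) field_differentiable at x"
      by (metis comp_apply funpow_Suc_right)
    with Suc have "ndiff m (deriv f)" "\<forall>x. f field_differentiable at x"
      by (auto dest: spec[of _ 0])
    then show ?case
      using ndiff_iff_deriv by blast
  qed auto
  then show "\<forall>n x. (deriv ^^ n) f field_differentiable at x \<Longrightarrow> smooth f"
    by (simp add: smooth_def)
qed

lemma ndiff_const: "ndiff n (\<lambda>x. c)"
proof (induction n arbitrary: c)
  case (Suc n)
  have "((\<lambda>x. c) has_real_derivative 0) (at x)" for x :: real
    by simp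
  then show ?case
    by (rule ndiff_SucI) (rule Suc)
qed simp

lemma ndiff_add: "ndiff n f \<Longrightarrow> ndiff n g \<Longrightarrow> ndiff n (\<lambda>x. f x + g x)"
proof (induction n arbitrary: f g)
  case (Suc n)
  then obtain f' g' where "\<And>x. (f has_real_derivative f' x) (at x)" "ndiff n f'"
    "\<And>x. (g has_real_derivative g' x) (at x)" "ndiff n g'"
    by auto
  then have "ndiff n (\<lambda>x. f' x + g' x)"
    "\<And>x. ((\<lambda>x. f x + g x) has_real_derivative (f' x + g' x)) (at x)"
    using Suc.IH by (auto intro: DERIV_add)
  then show ?case
    by (intro ndiff_SucI[where f' = "\<lambda>x. f' x + g' x"])
qed simp

lemma ndiff_mult: "ndiff n f \<Longrightarrow> ndiff n g \<Longrightarrow> ndiff n (\<lambda>x. f x * g x)"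
proof (induction n arbitrary: f g)
  case (Suc n)
  then obtain f' g' where "\<And>x. (f has_real_derivative f' x) (at x)" "ndiff n f'"
    "\<And>x. (g has_real_derivative g' x) (at x)" "ndiff n g'"
    by auto
  then have "ndiff n (\<lambda>x. f' x * g x + f x * g' x)"
    "\<And>x. ((\<lambda>x. f x * g x) has_real_derivative (f' x * g x + f x * g' x)) (at x)"
    using Suc.IH Suc.prems[THEN ndiff_SucD]
    by (auto intro!: ndiff_add derivative_eq_intros)
  then show ?case
    by (intro ndiff_SucI[where f' = "\<lambda>x. f' x * g x + f x * g' x"])
qed simp

lemma smooth_const [simp]: "smooth (\<lambda>x. c)"
  by (simp add: smooth_def ndiff_const)

lemma smooth_add: "smooth f \<Longrightarrow> smooth g \<Longrightarrow> smooth (\<lambda>x. f x + g x)"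
  by (simp add: smooth_def ndiff_add)

lemma smooth_mult: "smooth f \<Longrightarrow> smooth g \<Longrightarrow> smooth (\<lambda>x. f x * g x)"
  by (simp add: smooth_def ndiff_mult)

lemma smooth_cmult: "smooth f \<Longrightarrow> smooth (\<lambda>x. c * f x)"
  by (simp add: smooth_mult)

lemma smooth_diff: "smooth f \<Longrightarrow> smooth g \<Longrightarrow> smooth (\<lambda>x. f x - g x)"
  using smooth_add[OF _ smooth_cmult[of g "-1"], of f] by simp

lemma smooth_affine:
  assumes "smooth f"
  shows "smooth (\<lambda>x. f (a * x + b))"
proof -
  have "ndiff n f \<Longrightarrow> ndiff n (\<lambda>x. f (a * x + b))" for n
  proof (induction n arbitrary: f)
    case (Suc n)
    then obtain f' where f': "\<And>x. (f has_real_derivative f' x) (at x)" "ndiff n f'"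
      by auto
    then have "((\<lambda>x. f (a * x + b)) has_real_derivative (a * f' (a * x + b))) (at x)" for x
    proof -
      have "((\<lambda>x. a * x + b) has_real_derivative a) (at x)"
        by (auto intro!: derivative_eq_intros)
      from DERIV_chain2[OF f'(1) this] show ?thesis
        by (simp only: mult.commute)
    qed
    moreover have "ndiff n (\<lambda>x. a * f' (a * x + b))"
      using Suc.IH f' by (intro ndiff_mult ndiff_const)
    ultimately show ?case
      by (intro ndiff_SucI[where f' = "\<lambda>x. a * f' (a * x + b)"])
  qed simp
  with assms show ?thesis
    by (simp add: smooth_def)
qed

lemma smooth_real_polynomial_function:
  fixes p :: "real \<Rightarrow> real"
  assumes "real_polynomial_function p"
  shows "smooth p"
  using assms
proof induction
  case (linear f)
  then obtain c where f: "f = (\<lambda>x. x * c)"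
    using real_bounded_linear by blast
  have "(f has_real_derivative c) (at x)" for x
    unfolding f by (auto intro!: derivative_eq_intros)
  then show ?case
    by (rule smooth_antideriv) simp
qed (auto intro: smooth_add smooth_mult)

text \<open>The functions \<open>x \<mapsto> x\<^sup>-\<^sup>k exp (-1/x)\<close> on \<open>x > 0\<close>, extended by 0, form a family whose
  linear span is closed under differentiation.\<close>

definition flat :: "nat \<Rightarrow> real \<Rightarrow> real" where
  "flat k x = (if 0 < x then (1/x)^k * exp (- (1/x)) else 0)"

lemma flat_tendsto_0: "((flat k) \<longlongrightarrow> 0) (at_right 0)"
proof -
  have "((\<lambda>x::real. x^k / exp x) \<longlongrightarrow> 0) at_top"
    by (rule tendsto_power_div_exp_0)
  then have "((\<lambda>x::real. (inverse x)^k / exp (inverse x)) \<longlongrightarrow> 0) (at_right 0)"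
    by (rule filterlim_compose) (rule filterlim_inverse_at_top_right)
  then show ?thesis
    by (rule Lim_transform_eventually)
      (rule eventually_mono[OF eventually_at_right_less[of 0]], simp add: flat_def exp_minus divide_inverse)
qed

lemma flat_DERIV:
  "(flat k has_real_derivative (- real k * flat (Suc k) x + flat (Suc (Suc k)) x)) (at x)"
proof -
  consider "x > 0" | "x < 0" | "x = 0"
    by linarith
  then show ?thesis
  proof cases
    case 1
    define y where "y = 1 / x"
    have D: "((\<lambda>x. 1 / x) has_real_derivative - (y * y)) (at x)"
      using 1 by (auto intro!: derivative_eq_intros simp: y_def)
    have E: "((\<lambda>x. exp (- (1 / x))) has_real_derivative exp (- y) * - (- (y * y))) (at x)"
      using DERIV_chain2[OF DERIV_exp DERIV_minus[OF D]] by (simp add: y_def)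
    have "((\<lambda>x. (1/x)^k * exp (- (1/x))) has_real_derivative
        (real k * (- (y * y) * (1/x) ^ (k - Suc 0))) * exp (- (1/x)) + (exp (- y) * - (- (y * y))) * (1/x) ^ k) (at x)"
      by (intro DERIV_mult DERIV_power D E)
    also have "(real k * (- (y * y) * (1/x) ^ (k - Suc 0))) * exp (- (1/x)) + (exp (- y) * - (- (y * y))) * (1/x) ^ k =
        - real k * flat (Suc k) x + flat (Suc (Suc k)) x"
      unfolding y_def[symmetric] using 1 by (cases k) (simp_all add: flat_def y_def[symmetric] algebra_simps)
    finally have "((\<lambda>x. (1/x)^k * exp (- (1/x))) has_real_derivative
      (- real k * flat (Suc k) x + flat (Suc (Suc k)) x)) (at x)" .
    moreover have ev: "eventually (\<lambda>x. (1/x)^k * exp (- (1/x)) = flat k x) (nhds x)"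
      using eventually_nhds_in_open[of "{0<..}" x] 1
      by (auto elim!: eventually_mono simp: flat_def)
    ultimately show ?thesis
      by (simp add: DERIV_cong_ev[OF refl ev refl])
  next
    case 2
    have ev: "eventually (\<lambda>x. 0 = flat k x) (nhds x)"
      using eventually_nhds_in_open[of "{..<0}" x] 2
      by (auto elim!: eventually_mono simp: flat_def)
    moreover have "((\<lambda>x. 0) has_real_derivative 0) (at x)"
      by simp
    ultimately have "(flat k has_real_derivative 0) (at x)"
      by (simp add: DERIV_cong_ev[OF refl ev refl])
    with 2 show ?thesis
      by (simp add: flat_def)
  next
    case 3
    \<comment> \<open>At 0 the right difference quotient of a member of the family is the next
      member.\<close>
    have "((\<lambda>h. flat (Suc k) h) \<longlongrightarrow> 0) (at_right 0)"
      by (rule flat_tendsto_0)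
    then have "((\<lambda>h. (flat k h - flat k 0) / h) \<longlongrightarrow> 0) (at_right 0)"
      by (rule Lim_transform_eventually)
        (rule eventually_mono[OF eventually_at_right_less[of 0]], simp add: flat_def)
    moreover have "((\<lambda>h. (flat k h - flat k 0) / h) \<longlongrightarrow> 0) (at_left 0)"
      by (rule Lim_transform_eventually[OF tendsto_const])
        (auto simp: flat_def eventually_at_left[of "-1"] intro!: exI[of _ "-1 :: real"])
    ultimately have "((\<lambda>h. (flat k h - flat k 0) / h) \<longlongrightarrow> 0) (at 0)"
      by (rule filterlim_split_at[rotated])
    then show ?thesis
      using 3 by (simp add: DERIV_def flat_def)
  qed
qed

lemma smooth_flat: "smooth (flat k)"
proof -
  have "ndiff n (flat k)" for n
  proof (induction n arbitrary: k)
    case (Suc n)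
    have "ndiff n (\<lambda>x. - real k * flat (Suc k) x + flat (Suc (Suc k)) x)"
      by (intro ndiff_add ndiff_mult ndiff_const Suc)
    with flat_DERIV show ?case
      by (rule ndiff_SucI)
  qed simp
  then show ?thesis
    by (simp add: smooth_def)
qed

text \<open>\<open>einterval_antiderivative\<close> between infinite endpoints gives a primitive on
  the whole line, which can later be shifted, reflected and differentiated without regard to
  endpoints.\<close>

lemma ex_antiderivative:
  fixes f :: "real \<Rightarrow> real"
  assumes "continuous_on UNIV f"
  obtains F where "\<And>x. (F has_real_derivative f x) (at x)"
proof -
  have "isCont f x" for x
    using assms by (simp add: continuous_on_eq_continuous_at)
  then have "\<exists>F. \<forall>x::real. - \<infinity> < ereal x \<longrightarrow> ereal x < \<infinity> \<longrightarrow> (F has_vector_derivative f x) (at x)"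
    by (intro einterval_antiderivative) simp_all
  then obtain F where "\<forall>x. (F has_vector_derivative f x) (at x)"
    by auto
  then show ?thesis
    by (intro that[of F]) (simp add: has_real_derivative_iff_has_vector_derivative)
qed

lemma ex_smooth_step:
  obtains \<sigma> where "smooth \<sigma>" "\<And>x. x \<le> 0 \<Longrightarrow> \<sigma> x = 0" "\<And>x. x \<ge> 1 \<Longrightarrow> \<sigma> x = 1"
    "\<And>x. 0 \<le> \<sigma> x" "\<And>x. \<sigma> x \<le> 1"
proof -
  \<comment> \<open>A bump that is positive exactly on (0, 1); its primitive, normalised by the
    total mass \<open>F 1 - F 0\<close>, is the step.\<close>
  define b where "b = (\<lambda>x. flat 0 x * flat 0 ((-1) * x + 1))"
  have sb: "smooth b"
    unfolding b_def by (rule smooth_mult[OF smooth_flat smooth_affine[OF smooth_flat]])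
  obtain F where F: "\<And>x. (F has_real_derivative b x) (at x)"
    using ex_antiderivative[OF smooth_continuous[OF sb]] by blast
  have b_nonneg: "b x \<ge> 0" for x
    by (simp add: b_def flat_def)
  have mono: "F x \<le> F y" if "x \<le> y" for x y
    using DERIV_nonneg_imp_nondecreasing[OF that] F b_nonneg by blast
  have "F 0 < F 1"
  proof (rule DERIV_pos_imp_increasing_open[of 0 1])
    show "\<exists>y. (F has_real_derivative y) (at x) \<and> 0 < y" if "0 < x" "x < 1" for x
      using F[of x] that by (intro exI[of _ "b x"]) (auto simp: b_def flat_def)
    show "continuous_on {0..1} F"
      using DERIV_isCont[OF F] by (simp add: continuous_at_imp_continuous_on)
  qed simp
  have left: "F x = F 0" if "x \<le> 0" for x
  proof (cases "x = 0")
    case False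
    with that have "x < 0" by simp
    from MVT2[OF this F] obtain z where "z < 0" "F 0 - F x = (0 - x) * b z"
      by auto
    then show ?thesis
      by (simp add: b_def flat_def)
  qed simp
  have right: "F x = F 1" if "x \<ge> 1" for x
  proof (cases "x = 1")
    case False
    with that have "1 < x" by simp
    from MVT2[OF this F] obtain z where "z > 1" "F x - F 1 = (x - 1) * b z"
      by auto
    then show ?thesis
      by (simp add: b_def flat_def)
  qed simp
  have bd: "F 0 \<le> F x" "F x \<le> F 1" for x
    using mono[of 0 x] left[of x] mono[of x 1] right[of x] mono[of 0 1]
    by (cases "x \<le> 0"; cases "x \<le> 1"; simp)+
  define \<sigma> where "\<sigma> = (\<lambda>x. (1 / (F 1 - F 0)) * (F x - F 0))"
  have "smooth \<sigma>"
    unfolding \<sigma>_def by (rule smooth_cmult[OF smooth_diff[OF smooth_antideriv[OF F sb] smooth_const]])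
  moreover have "\<sigma> x = 0" if "x \<le> 0" for x
    using left[OF that] by (simp add: \<sigma>_def)
  moreover have "\<sigma> x = 1" if "x \<ge> 1" for x
    using right[OF that] \<open>F 0 < F 1\<close> by (simp add: \<sigma>_def)
  moreover have "0 \<le> \<sigma> x" "\<sigma> x \<le> 1" for x
    using bd[of x] \<open>F 0 < F 1\<close> by (simp_all add: \<sigma>_def)
  ultimately show ?thesis
    by (rule that)
qed

section \<open>Test functions and the fundamental lemma\<close>

lemma test_functions_iff:
  "\<eta> \<in> test_functions S \<longleftrightarrow>
    smooth \<eta> \<and> (\<exists>K. compact K \<and> K \<subseteq> S \<and> (\<forall>x. x \<notin> K \<longrightarrow> \<eta> x = 0))"
  by (simp add: test_functions_def smooth_iff)

lemma test_functions_mult_smooth: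
  "\<eta> \<in> test_functions S \<Longrightarrow> smooth f \<Longrightarrow> (\<lambda>x. \<eta> x * f x) \<in> test_functions S"
  by (auto simp: test_functions_iff intro!: smooth_mult)

lemma test_functions_add:
  assumes "\<eta> \<in> test_functions S" "\<zeta> \<in> test_functions S"
  shows "(\<lambda>x. \<eta> x + \<zeta> x) \<in> test_functions S"
proof -
  obtain K L where "compact K" "K \<subseteq> S" "\<forall>x. x \<notin> K \<longrightarrow> \<eta> x = 0"
    "compact L" "L \<subseteq> S" "\<forall>x. x \<notin> L \<longrightarrow> \<zeta> x = 0"
    using assms by (auto simp: test_functions_iff)
  then show ?thesis
    using assms by (auto simp: test_functions_iff intro!: smooth_add exI[of _ "K \<union> L"])
qed

lemma test_functions_cmult:
  "\<eta> \<in> test_functions S \<Longrightarrow> (\<lambda>x. c * \<eta> x) \<in> test_functions S"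
  using test_functions_mult_smooth[of \<eta> S "\<lambda>_. c"] by (simp add: mult.commute)

lemma test_functions_deriv:
  assumes "\<eta> \<in> test_functions S"
  shows "deriv \<eta> \<in> test_functions S"
proof -
  obtain K where K: "smooth \<eta>" "compact K" "K \<subseteq> S" "\<And>x. x \<notin> K \<Longrightarrow> \<eta> x = 0"
    using assms by (auto simp: test_functions_iff)
  have "deriv \<eta> x = 0" if "x \<notin> K" for x
  proof -
    have "open (- K)"
      using K compact_imp_closed by blast
    then have "eventually (\<lambda>y. y \<in> - K) (nhds x)"
      using that eventually_nhds_in_open by blast
    then have "eventually (\<lambda>y. \<eta> y = 0) (nhds x)"
      by eventually_elim (use K in auto)
    then show ?thesis
      using deriv_cong_ev[of \<eta> "\<lambda>_. 0" x x] by simp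
  qed
  then show ?thesis
    using K by (auto simp: test_functions_iff smooth_deriv)
qed

text \<open>The cutoffs turn smooth functions into test functions and confine integrals to compact
  sets, where local integrability applies; at each point of the interval they are eventually without
  effect.\<close>

lemma ex_cutoffs:
  fixes a b :: real
  obtains \<kappa> K where "\<And>n. \<kappa> n \<in> test_functions {a<..<b}"
    "\<And>n. compact (K n)" "\<And>n. K n \<subseteq> {a<..<b}" "\<And>n x. x \<notin> K n \<Longrightarrow> \<kappa> n x = 0"
    "\<And>n x. 0 \<le> \<kappa> n x" "\<And>n x. \<kappa> n x \<le> 1"
    "\<And>x. x \<in> {a<..<b} \<Longrightarrow> eventually (\<lambda>n::nat. \<kappa> n x = 1) sequentially"
proof -
  obtain \<sigma> where \<sigma>: "smooth \<sigma>" "\<And>x. x \<le> 0 \<Longrightarrow> \<sigma> x = 0" "\<And>x. x \<ge> 1 \<Longrightarrow> \<sigma> x = 1"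
    "\<And>x. 0 \<le> \<sigma> x" "\<And>x. \<sigma> x \<le> 1"
    using ex_smooth_step by blast
  \<comment> \<open>The first factor vanishes up to distance \<open>1 / Suc n\<close> from
    \<open>a\<close> and is 1 from distance \<open>2 / Suc n\<close> on; the second does the same at
    \<open>b\<close>.\<close>
  define \<kappa> where "\<kappa> n x = \<sigma> (real (Suc n) * x + (- real (Suc n) * a - 1)) *
    \<sigma> ((- real (Suc n)) * x + (real (Suc n) * b - 1))" for n :: nat and x
  define K where "K n = {a + 1 / real (Suc n) .. b - 1 / real (Suc n)}" for n
  have K: "compact (K n)" "K n \<subseteq> {a<..<b}" for n
  proof -
    have "0 < 1 / real (Suc n)"
      by simp
    then have "x \<in> K n \<Longrightarrow> a < x \<and> x < b" for x
      unfolding K_def atLeastAtMost_iff by linarith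
    then show "compact (K n)" "K n \<subseteq> {a<..<b}"
      by (auto simp: K_def)
  qed
  have out: "\<kappa> n x = 0" if "x \<notin> K n" for n x
  proof -
    have "x < a + 1 / real (Suc n) \<or> b - 1 / real (Suc n) < x"
      using that by (auto simp: K_def)
    then have "real (Suc n) * x + (- real (Suc n) * a - 1) \<le> 0 \<or>
      (- real (Suc n)) * x + (real (Suc n) * b - 1) \<le> 0"
      by (auto simp: field_simps simp del: of_nat_Suc)
    then show ?thesis
      using \<sigma>(2) by (auto simp: \<kappa>_def)
  qed
  have one: "eventually (\<lambda>n. \<kappa> n x = 1) sequentially" if "x \<in> {a<..<b}" for x
  proof -
    have *: "eventually (\<lambda>n. real (Suc n) * d - 1 \<ge> 1) sequentially" if "d > 0" for d :: real
    proof -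
      have "eventually (\<lambda>n. n \<ge> nat \<lceil>2 / d\<rceil>) sequentially"
        by (rule eventually_ge_at_top)
      then show ?thesis
      proof eventually_elim
        case (elim n)
        then have "2 / d \<le> real (Suc n)"
          by linarith
        then show ?case
          using that by (simp add: field_simps)
      qed
    qed
    have "eventually (\<lambda>n. real (Suc n) * (x - a) - 1 \<ge> 1) sequentially"
      "eventually (\<lambda>n. real (Suc n) * (b - x) - 1 \<ge> 1) sequentially"
      using that *[of "x - a"] *[of "b - x"] by simp_all
    then show ?thesis
    proof eventually_elim
      case (elim n)
      have "\<sigma> (real (Suc n) * x + (- real (Suc n) * a - 1)) = 1"
        "\<sigma> ((- real (Suc n)) * x + (real (Suc n) * b - 1)) = 1"
        using elim by (auto intro!: \<sigma> simp: algebra_simps)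
      then show ?case
        by (simp add: \<kappa>_def)
    qed
  qed
  have "smooth (\<kappa> n)" for n
    unfolding \<kappa>_def by (rule smooth_mult[OF smooth_affine[OF \<sigma>(1)] smooth_affine[OF \<sigma>(1)]])
  then have test: "\<kappa> n \<in> test_functions {a<..<b}" for n
    unfolding test_functions_iff using K[of n] out[of _ n] by blast
  have "0 \<le> \<kappa> n x" "\<kappa> n x \<le> 1" for n x
    using \<sigma> by (auto simp: \<kappa>_def mult_le_one)
  then show ?thesis
    using test K out one by (intro that[of \<kappa> K])
qed

text \<open>This takes the place of mollification. A measurable function is an almost everywhere
  limit of continuous ones, and these are replaced by polynomials on \<open>{a..b}\<close> with
  error \<open>1 / Suc n\<close>. The error turns the bound \<open>B\<close> into
  \<open>B + 1\<close>, which serves dominated convergence just as well.\<close>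

lemma bounded_measurable_limit_of_smooth:
  fixes h :: "real \<Rightarrow> real"
  assumes "h \<in> borel_measurable lebesgue" "\<And>x. \<bar>h x\<bar> \<le> B"
  obtains p where "\<And>n. smooth (p n)" "\<And>n x. x \<in> {a..b} \<Longrightarrow> \<bar>p n x\<bar> \<le> B + 1"
    "AE x in lebesgue. x \<in> {a..b} \<longrightarrow> (\<lambda>n::nat. p n x) \<longlonglongrightarrow> h x"
proof -
  have "h measurable_on UNIV"
    using assms(1) by (intro lebesgue_measurable_imp_measurable_on) auto
  then obtain N g where N: "negligible N" and g: "\<And>n. continuous_on UNIV (g n)"
    and lim: "\<And>x. x \<notin> N \<Longrightarrow> (\<lambda>n. g n x) \<longlonglongrightarrow> h x"
    unfolding measurable_on_def by auto
  have "B \<ge> 0"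
    using assms(2)[of 0] by linarith
  \<comment> \<open>Clamping makes the bound uniform in \<open>n\<close> and does not disturb the
    limit, which lies in \<open>[-B, B]\<close> already.\<close>
  define c where "c n x = max (- B) (min B (g n x))" for n x
  have c: "continuous_on {a..b} (c n)" for n
    unfolding c_def by (intro continuous_intros continuous_on_subset[OF g]) auto
  have "\<exists>p. real_polynomial_function p \<and> (\<forall>x\<in>{a..b}. \<bar>c n x - p x\<bar> < 1 / real (Suc n))" for n
  proof -
    obtain p where "real_polynomial_function p" "\<And>x. x \<in> {a..b} \<Longrightarrow> \<bar>c n x - p x\<bar> < 1 / real (Suc n)"
      by (rule Stone_Weierstrass_real_polynomial_function[OF _ c[of n], of "1 / real (Suc n)"]) auto
    then show ?thesis
      by blast
  qed
  then obtain p where p: "\<And>n. real_polynomial_function (p n)"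
    "\<And>n x. x \<in> {a..b} \<Longrightarrow> \<bar>c n x - p n x\<bar> < 1 / real (Suc n)"
    by metis
  have "\<bar>p n x\<bar> \<le> B + 1" if "x \<in> {a..b}" for n x
  proof -
    have "1 / real (Suc n) \<le> 1"
      by simp
    moreover have "\<bar>c n x\<bar> \<le> B"
      using \<open>B \<ge> 0\<close> by (auto simp: c_def)
    ultimately show ?thesis
      using p(2)[OF that, of n] by linarith
  qed
  moreover have "(\<lambda>n. p n x) \<longlonglongrightarrow> h x" if "x \<notin> N" "x \<in> {a..b}" for x
  proof -
    have "(\<lambda>n. c n x) \<longlonglongrightarrow> max (- B) (min B (h x))"
      unfolding c_def by (intro tendsto_intros lim that)
    moreover have "max (- B) (min B (h x)) = h x"
      using assms(2)[of x] by (auto simp: abs_le_iff max_def min_def)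
    moreover have "(\<lambda>n. c n x - p n x) \<longlonglongrightarrow> 0"
    proof (rule Lim_null_comparison)
      show "eventually (\<lambda>n. norm (c n x - p n x) \<le> 1 / real (Suc n)) sequentially"
        using p(2)[OF that(2)] by (auto intro!: always_eventually less_imp_le)
      show "(\<lambda>n. 1 / real (Suc n)) \<longlonglongrightarrow> 0"
        using LIMSEQ_inverse_real_of_nat by (simp add: inverse_eq_divide)
    qed
    ultimately show ?thesis
      using tendsto_diff[of "\<lambda>n. c n x" "h x" sequentially "\<lambda>n. c n x - p n x" 0] by simp
  qed
  moreover have "AE x in lebesgue. x \<notin> N"
    using N by (auto simp: negligible_iff_null_sets intro: AE_not_in)
  ultimately show ?thesis
    by (intro that[of p]) (auto intro: smooth_real_polynomial_function p)
qed

lemma set_lebesgue_integral_real: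
  "set_lebesgue_integral M S f = (LINT x|M. indicator S x * (f x :: real))"
  by (simp add: set_lebesgue_integral_def)

text \<open>Test functions \<open>\<kappa> n * p m\<close>, with \<open>p m\<close> tending to the
  sign of \<open>g\<close> on the support of \<open>\<kappa> n\<close>, give in the limit that the
  integral of \<open>\<kappa> n * \<bar>g\<bar>\<close> is 0. Since \<open>\<kappa> n x\<close> is
  eventually 1, this determines \<open>g\<close> almost everywhere.\<close>

lemma fundamental_lemma:
  fixes g :: "real \<Rightarrow> real"
  assumes g: "locally_integrable_on {a<..<b} g"
    and 0: "\<And>\<eta>. \<eta> \<in> test_functions {a<..<b} \<Longrightarrow>
      set_lebesgue_integral lebesgue {a<..<b} (\<lambda>x. g x * \<eta> x) = 0"
  shows "AE x in lebesgue. x \<in> {a<..<b} \<longrightarrow> g x = 0"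
proof -
  obtain \<kappa> K where \<kappa>: "\<And>n. \<kappa> n \<in> test_functions {a<..<b}"
    "\<And>n. compact (K n)" "\<And>n. K n \<subseteq> {a<..<b}" "\<And>n x. x \<notin> K n \<Longrightarrow> \<kappa> n x = 0"
    "\<And>n x. 0 \<le> \<kappa> n x" "\<And>n x. \<kappa> n x \<le> 1"
    "\<And>x. x \<in> {a<..<b} \<Longrightarrow> eventually (\<lambda>n::nat. \<kappa> n x = 1) sequentially"
    using ex_cutoffs by blast
  have "AE x in lebesgue. x \<in> {a<..<b} \<longrightarrow> \<kappa> n x * \<bar>g x\<bar> = 0" for n
  proof -
    define gK where "gK x = indicator (K n) x * g x" for x
    have gK: "integrable lebesgue gK"
      using g \<kappa>(2,3)[of n] by (auto simp: locally_integrable_on_def set_integrable_def gK_def[abs_def])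
    define h where "h x = sgn (gK x)" for x
    have h: "h \<in> borel_measurable lebesgue" "\<And>x. \<bar>h x\<bar> \<le> 1"
      using gK by (auto simp: h_def[abs_def] abs_sgn_eq)
    obtain p where p: "\<And>m. smooth (p m)" "\<And>m x. x \<in> {a..b} \<Longrightarrow> \<bar>p m x\<bar> \<le> 1 + 1"
      "AE x in lebesgue. x \<in> {a..b} \<longrightarrow> (\<lambda>m::nat. p m x) \<longlonglongrightarrow> h x"
      using bounded_measurable_limit_of_smooth[OF h] by blast
    have sm: "smooth (\<kappa> n)"
      using \<kappa>(1)[of n] by (simp add: test_functions_iff)
    have meas: "(\<lambda>x. f x) \<in> borel_measurable lebesgue" if "smooth f" for f
      using that by (intro measurable_completion)
        (simp add: borel_measurable_continuous_onI smooth_continuous)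
    have [measurable]: "\<kappa> n \<in> borel_measurable lebesgue" "p m \<in> borel_measurable lebesgue"
      "gK \<in> borel_measurable lebesgue" for m
      using meas[OF sm] meas[OF p(1)] gK by auto
    have eq: "indicator {a<..<b} x * (g x * (\<kappa> n x * f x)) = gK x * (\<kappa> n x * f x)" for x f
      using \<kappa>(3)[of n] \<kappa>(4)[of x n] by (auto simp: gK_def indicator_def)
    have "(\<lambda>m. LINT x|lebesgue. gK x * (\<kappa> n x * p m x)) \<longlonglongrightarrow> (LINT x|lebesgue. gK x * (\<kappa> n x * h x))"
    proof (rule integral_dominated_convergence)
      show "integrable lebesgue (\<lambda>x. 2 * \<bar>gK x\<bar>)"
        using gK by simp
      show "AE x in lebesgue. (\<lambda>m. gK x * (\<kappa> n x * p m x)) \<longlonglongrightarrow> gK x * (\<kappa> n x * h x)"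
        using p(3)
      proof eventually_elim
        case (elim x)
        show ?case
        proof (cases "x \<in> K n")
          case True
          with elim \<kappa>(3)[of n] show ?thesis
            by (intro tendsto_intros) (auto dest!: subsetD)
        qed (simp add: \<kappa>)
      qed
      show "AE x in lebesgue. norm (gK x * (\<kappa> n x * p m x)) \<le> 2 * \<bar>gK x\<bar>" for m
      proof (rule AE_I2)
        fix x
        show "norm (gK x * (\<kappa> n x * p m x)) \<le> 2 * \<bar>gK x\<bar>"
        proof (cases "x \<in> K n")
          case True
          then have "x \<in> {a..b}"
            using \<kappa>(3)[of n] by (auto dest!: subsetD)
          then have "\<bar>\<kappa> n x\<bar> * \<bar>p m x\<bar> \<le> 1 * 2"
            using \<kappa>(5)[of n x] \<kappa>(6)[of n x] p(2)[of x m] by (intro mult_mono) auto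
          then have "\<bar>gK x\<bar> * (\<bar>\<kappa> n x\<bar> * \<bar>p m x\<bar>) \<le> \<bar>gK x\<bar> * 2"
            by (intro mult_left_mono) auto
          then show ?thesis
            by (simp add: abs_mult mult.commute)
        qed (simp add: \<kappa>)
      qed
    qed (use h(1) in measurable)
    moreover have "(LINT x|lebesgue. gK x * (\<kappa> n x * p m x)) = 0" for m
      using 0[OF test_functions_mult_smooth[OF \<kappa>(1) p(1)], of n m]
      by (simp add: set_lebesgue_integral_real eq)
    ultimately have "(LINT x|lebesgue. gK x * (\<kappa> n x * h x)) = 0"
      by (simp add: LIMSEQ_const_iff)
    moreover have "gK x * (\<kappa> n x * h x) = \<kappa> n x * \<bar>gK x\<bar>" for x
      by (simp add: h_def abs_sgn mult_ac)
    ultimately have int0: "(LINT x|lebesgue. \<kappa> n x * \<bar>gK x\<bar>) = 0"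
      by simp
    have "integrable lebesgue (\<lambda>x. \<kappa> n x * \<bar>gK x\<bar>)"
    proof (rule Bochner_Integration.integrable_bound[OF gK])
      show "AE x in lebesgue. norm (\<kappa> n x * \<bar>gK x\<bar>) \<le> norm (gK x)"
        using \<kappa>(5,6) by (auto simp: abs_mult intro!: mult_left_le_one_le)
    qed measurable
    with int0 have "AE x in lebesgue. \<kappa> n x * \<bar>gK x\<bar> = 0"
      by (subst (asm) integral_nonneg_eq_0_iff_AE) (auto simp: \<kappa>)
    then show ?thesis
    proof eventually_elim
      case (elim x)
      then show ?case
        using \<kappa>(4)[of x n] by (cases "x \<in> K n") (auto simp: gK_def)
    qed
  qed
  then have "AE x in lebesgue. \<forall>n. x \<in> {a<..<b} \<longrightarrow> \<kappa> n x * \<bar>g x\<bar> = 0"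
    unfolding AE_all_countable by blast
  then show ?thesis
  proof eventually_elim
    case (elim x)
    show ?case
    proof
      assume x: "x \<in> {a<..<b}"
      then obtain n where "\<kappa> n x = 1"
        using \<kappa>(7)[OF x] by (auto simp: eventually_sequentially)
      with elim x show "g x = 0"
        by (metis abs_eq_0 mult_1)
    qed
  qed
qed

section \<open>Weak derivatives\<close>

lemma continuous_locally_integrable:
  assumes "continuous_on UNIV f"
  shows "locally_integrable_on S f"
  unfolding locally_integrable_on_def set_integrable_def
proof (intro allI impI)
  fix K :: "real set"
  assume "compact K \<and> K \<subseteq> S"
  then have "integrable lborel (\<lambda>x. indicator K x *\<^sub>R f x)"
    using assms by (intro borel_integrable_compact) (auto intro: continuous_on_subset)
  then show "integrable lebesgue (\<lambda>x. indicator K x *\<^sub>R f x)"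
    using integrable_completion borel_measurable_integrable by blast
qed

lemma continuous_set_integrable:
  fixes f :: "real \<Rightarrow> real"
  assumes "continuous_on UNIV f"
  shows "set_integrable lebesgue {a<..<b} f"
proof (rule set_integrable_subset)
  show "set_integrable lebesgue {a..b} f"
    using continuous_locally_integrable[OF assms, of UNIV] by (auto simp: locally_integrable_on_def)
qed auto

lemma continuous_L2_on:
  fixes f :: "real \<Rightarrow> real"
  assumes "continuous_on UNIV f"
  shows "f \<in> L2_on {a<..<b}"
proof -
  have "set_integrable lebesgue {a<..<b} (\<lambda>x. (f x)\<^sup>2)"
    by (intro continuous_set_integrable continuous_intros assms)
  moreover have "f \<in> borel_measurable lebesgue"
    using assms by (intro measurable_completion) (simp add: borel_measurable_continuous_onI)
  ultimately show ?thesis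
    by (simp add: L2_on_def set_borel_measurable_def borel_measurable_times borel_measurable_indicator)
qed

lemma set_lebesgue_integral_continuous:
  fixes f :: "real \<Rightarrow> real"
  assumes "continuous_on UNIV f"
  shows "set_lebesgue_integral lebesgue {a<..<b} f = integral {a..b} f"
  using set_lebesgue_integral_eq_integral(2)[OF continuous_set_integrable[OF assms, of a b]]
  by (simp add: integral_open_interval_real)

lemma test_function_bounded:
  assumes "\<eta> \<in> test_functions S"
  obtains B where "B \<ge> 0" "\<And>x. \<bar>\<eta> x\<bar> \<le> B"
proof -
  obtain K where K: "smooth \<eta>" "compact K" "\<And>x. x \<notin> K \<Longrightarrow> \<eta> x = 0"
    using assms by (auto simp: test_functions_iff)
  have "bounded (\<eta> ` K)"
    using K by (intro compact_imp_bounded compact_continuous_image smooth_continuous)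
  then obtain B where "\<And>x. x \<in> K \<Longrightarrow> \<bar>\<eta> x\<bar> \<le> B"
    by (auto simp: bounded_iff)
  then have "\<bar>\<eta> x\<bar> \<le> max B 0" for x
    using K(3)[of x] by (cases "x \<in> K") (simp_all add: le_max_iff_disj)
  then show ?thesis
    by (intro that[of "max B 0"]) simp_all
qed

lemma smooth_borel_measurable: "smooth f \<Longrightarrow> f \<in> borel_measurable lebesgue"
  by (intro measurable_completion) (simp add: borel_measurable_continuous_onI smooth_continuous)

lemma locally_integrable_times_test:
  assumes g: "locally_integrable_on S g" and \<eta>: "\<eta> \<in> test_functions S"
  shows "set_integrable lebesgue S (\<lambda>x. g x * \<eta> x)"
proof -
  obtain K where K: "smooth \<eta>" "compact K" "K \<subseteq> S" "\<And>x. x \<notin> K \<Longrightarrow> \<eta> x = 0"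
    using \<eta> by (auto simp: test_functions_iff)
  obtain B where B: "B \<ge> 0" "\<And>x. \<bar>\<eta> x\<bar> \<le> B"
    using test_function_bounded[OF \<eta>] by blast
  have gK: "integrable lebesgue (\<lambda>x. indicator K x * g x)"
    using g K by (auto simp: locally_integrable_on_def set_integrable_def)
  have [measurable]: "\<eta> \<in> borel_measurable lebesgue"
    by (rule smooth_borel_measurable) fact
  have [measurable]: "(\<lambda>x. indicator K x * g x) \<in> borel_measurable lebesgue"
    using gK by simp
  have "integrable lebesgue (\<lambda>x. indicator K x * g x * \<eta> x)"
  proof (rule Bochner_Integration.integrable_bound)
    show "integrable lebesgue (\<lambda>x. B * (indicator K x * g x))"
      using gK by simp
    show "AE x in lebesgue. norm (indicator K x * g x * \<eta> x) \<le> norm (B * (indicator K x * g x))"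
      using B by (intro AE_I2) (auto simp: abs_mult indicator_def mult.commute intro!: mult_right_mono)
  qed measurable
  moreover have "indicator K x * g x * \<eta> x = indicator S x *\<^sub>R (g x * \<eta> x)" for x
    using K by (auto simp: indicator_def)
  ultimately show ?thesis
    by (simp add: set_integrable_def)
qed

lemma C1_has_weak_deriv:
  fixes a b :: real
  assumes u: "\<And>x. (u has_real_derivative u' x) (at x)" and u': "continuous_on UNIV u'"
  shows "has_weak_deriv_on {a<..<b} u u'"
proof (cases "a < b")
  case True
  have cu: "continuous_on UNIV u"
    by (simp add: DERIV_isCont[OF u] continuous_at_imp_continuous_on)
  show ?thesis
    unfolding has_weak_deriv_on_def
  proof (intro conjI ballI)
    fix \<eta>
    assume \<eta>: "\<eta> \<in> test_functions {a<..<b}"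
    then obtain K where K: "smooth \<eta>" "K \<subseteq> {a<..<b}" "\<And>x. x \<notin> K \<Longrightarrow> \<eta> x = 0"
      by (auto simp: test_functions_iff)
    have "a \<notin> K" "b \<notin> K"
      using K(2) by auto
    then have ends: "\<eta> a = 0" "\<eta> b = 0"
      using K(3) by auto
    have c: "continuous_on UNIV (\<lambda>x. u x * deriv \<eta> x)" "continuous_on UNIV (\<lambda>x. u' x * \<eta> x)"
      using cu u' smooth_continuous[OF K(1)] smooth_continuous[OF smooth_deriv[OF K(1)]]
      by (auto intro!: continuous_on_mult)
    have "((\<lambda>x. u x * deriv \<eta> x + u' x * \<eta> x) has_integral (u b * \<eta> b - u a * \<eta> a)) {a..b}"
    proof (rule fundamental_theorem_of_calculus)
      show "((\<lambda>x. u x * \<eta> x) has_vector_derivative u x * deriv \<eta> x + u' x * \<eta> x) (at x within {a..b})" for x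
        unfolding has_real_derivative_iff_has_vector_derivative[symmetric]
        using DERIV_mult[OF u[of x] smooth_DERIV[OF K(1), of x]]
        by (simp add: algebra_simps has_field_derivative_at_within)
    qed (use True in simp)
    then have "integral {a..b} (\<lambda>x. u x * deriv \<eta> x + u' x * \<eta> x) = 0"
      by (simp add: ends integral_unique)
    then have "integral {a..b} (\<lambda>x. u x * deriv \<eta> x) + integral {a..b} (\<lambda>x. u' x * \<eta> x) = 0"
      by (subst (asm) integral_add)
        (auto intro!: integrable_continuous_real continuous_on_subset[OF c(1)] continuous_on_subset[OF c(2)])
    then show "set_lebesgue_integral lebesgue {a<..<b} (\<lambda>x. u x * deriv \<eta> x) =
        - set_lebesgue_integral lebesgue {a<..<b} (\<lambda>x. u' x * \<eta> x)"
      using c by (simp add: set_lebesgue_integral_continuous)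
  qed (use cu u' in \<open>auto intro: continuous_locally_integrable\<close>)
next
  case False
  then have "{a<..<b} = {}"
    by auto
  then show ?thesis
    by (simp add: has_weak_deriv_on_def locally_integrable_on_def set_lebesgue_integral_def set_integrable_def)
qed

lemma locally_integrable_add:
  "locally_integrable_on S f \<Longrightarrow> locally_integrable_on S g \<Longrightarrow> locally_integrable_on S (\<lambda>x. f x + g x)"
  by (auto simp: locally_integrable_on_def intro!: set_integral_add)

lemma locally_integrable_cmult:
  "locally_integrable_on S f \<Longrightarrow> locally_integrable_on S (\<lambda>x. c * f x)"
  by (auto simp: locally_integrable_on_def intro!: set_integrable_mult_right)

lemma has_weak_deriv_add:
  assumes "has_weak_deriv_on S f f'" "has_weak_deriv_on S g g'"
  shows "has_weak_deriv_on S (\<lambda>x. f x + g x) (\<lambda>x. f' x + g' x)"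
  unfolding has_weak_deriv_on_def
proof (intro conjI ballI)
  fix \<eta>
  assume \<eta>: "\<eta> \<in> test_functions S"
  have f: "locally_integrable_on S f" "locally_integrable_on S f'"
    "locally_integrable_on S g" "locally_integrable_on S g'"
    using assms by (auto simp: has_weak_deriv_on_def)
  show "set_lebesgue_integral lebesgue S (\<lambda>x. (f x + g x) * deriv \<eta> x) =
        - set_lebesgue_integral lebesgue S (\<lambda>x. (f' x + g' x) * \<eta> x)"
    using assms \<eta> by (simp add: distrib_right set_integral_add locally_integrable_times_test f
        test_functions_deriv has_weak_deriv_on_def)
qed (use assms in \<open>auto simp: has_weak_deriv_on_def intro: locally_integrable_add\<close>)

lemma has_weak_deriv_cmult:
  assumes "has_weak_deriv_on S f f'"
  shows "has_weak_deriv_on S (\<lambda>x. c * f x) (\<lambda>x. c * f' x)"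
  using assms by (auto simp: has_weak_deriv_on_def mult.assoc intro: locally_integrable_cmult)

lemma has_weak_deriv_unique:
  assumes "has_weak_deriv_on {a<..<b} f g" "has_weak_deriv_on {a<..<b} f h"
  shows "AE x in lebesgue. x \<in> {a<..<b} \<longrightarrow> g x = h x"
proof -
  have gh: "locally_integrable_on {a<..<b} g" "locally_integrable_on {a<..<b} h"
    using assms by (auto simp: has_weak_deriv_on_def)
  have "AE x in lebesgue. x \<in> {a<..<b} \<longrightarrow> g x + (-1) * h x = 0"
  proof (rule fundamental_lemma)
    show "locally_integrable_on {a<..<b} (\<lambda>x. g x + (-1) * h x)"
      by (intro locally_integrable_add locally_integrable_cmult gh)
    fix \<eta>
    assume \<eta>: "\<eta> \<in> test_functions {a<..<b}"
    have "set_lebesgue_integral lebesgue {a<..<b} (\<lambda>x. g x * \<eta> x - h x * \<eta> x) =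
        set_lebesgue_integral lebesgue {a<..<b} (\<lambda>x. g x * \<eta> x) -
        set_lebesgue_integral lebesgue {a<..<b} (\<lambda>x. h x * \<eta> x)"
      by (intro set_integral_diff locally_integrable_times_test gh \<eta>)
    also have "\<dots> = 0"
      using assms \<eta> by (simp add: has_weak_deriv_on_def)
    finally show "set_lebesgue_integral lebesgue {a<..<b} (\<lambda>x. (g x + (-1) * h x) * \<eta> x) = 0"
      by (simp add: algebra_simps)
  qed
  then show ?thesis
    by (auto elim: AE_mp)
qed

text \<open>Local integrability provides measurability on compact subsets only; the products with
  cutoffs carry it over to the whole interval.\<close>

lemma locally_integrable_measurable:
  assumes "locally_integrable_on {a<..<b} g"
  shows "set_borel_measurable lebesgue {a<..<b} g"
proof -
  obtain \<kappa> K where \<kappa>: "\<And>n. \<kappa> n \<in> test_functions {a<..<b}"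
    "\<And>n. compact (K n)" "\<And>n. K n \<subseteq> {a<..<b}" "\<And>n x. x \<notin> K n \<Longrightarrow> \<kappa> n x = 0"
    "\<And>n x. 0 \<le> \<kappa> n x" "\<And>n x. \<kappa> n x \<le> 1"
    "\<And>x. x \<in> {a<..<b} \<Longrightarrow> eventually (\<lambda>n::nat. \<kappa> n x = 1) sequentially"
    using ex_cutoffs by blast
  show ?thesis
    unfolding set_borel_measurable_def
  proof (rule borel_measurable_LIMSEQ_real)
    show "(\<lambda>x. indicator {a<..<b} x *\<^sub>R (g x * \<kappa> n x)) \<in> borel_measurable lebesgue" for n
      using locally_integrable_times_test[OF assms \<kappa>(1)] by (simp add: set_integrable_def)
    show "(\<lambda>n. indicator {a<..<b} x *\<^sub>R (g x * \<kappa> n x)) \<longlonglongrightarrow> indicator {a<..<b} x *\<^sub>R g x" for x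
    proof (cases "x \<in> {a<..<b}")
      case True
      then show ?thesis
        by (intro tendsto_eventually) (use \<kappa>(7)[OF True] in \<open>auto elim: eventually_mono\<close>)
    qed simp
  qed
qed

lemma has_weak_deriv_weak_deriv_on:
  "has_weak_deriv_on S f g \<Longrightarrow> has_weak_deriv_on S f (weak_deriv_on S f)"
  unfolding weak_deriv_on_def by (rule someI[of "has_weak_deriv_on S f"])

lemma L2_norm_on_cong_AE:
  fixes f g :: "'a::euclidean_space \<Rightarrow> real"
  assumes "set_borel_measurable lebesgue S f" "set_borel_measurable lebesgue S g"
    "AE x in lebesgue. x \<in> S \<longrightarrow> f x = g x"
  shows "L2_norm_on S f = L2_norm_on S g"
proof -
  have eq: "indicator S x * (f x)\<^sup>2 = (indicator S x * f x)\<^sup>2" for f :: "'a \<Rightarrow> real" and x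
    by (auto simp: indicator_def)
  have "(LINT x|lebesgue. indicator S x * (f x)\<^sup>2) = (LINT x|lebesgue. indicator S x * (g x)\<^sup>2)"
  proof (rule integral_cong_AE)
    show "AE x in lebesgue. indicator S x * (f x)\<^sup>2 = indicator S x * (g x)\<^sup>2"
      using assms(3) by eventually_elim (auto simp: indicator_def)
  qed (use assms(1,2) in \<open>simp_all add: eq set_borel_measurable_def\<close>)
  then show ?thesis
    by (simp add: L2_norm_on_def set_lebesgue_integral_real)
qed

text \<open>\<open>weak_deriv_on\<close> is an arbitrary choice, so its norm becomes computable only
  through almost everywhere uniqueness.\<close>

lemma L2_norm_weak_deriv_on:
  assumes "has_weak_deriv_on {a<..<b} f g"
  shows "L2_norm_on {a<..<b} (weak_deriv_on {a<..<b} f) = L2_norm_on {a<..<b} g"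
proof (rule L2_norm_on_cong_AE)
  note w = has_weak_deriv_weak_deriv_on[OF assms]
  show "AE x in lebesgue. x \<in> {a<..<b} \<longrightarrow> weak_deriv_on {a<..<b} f x = g x"
    by (rule has_weak_deriv_unique[OF w assms])
  show "set_borel_measurable lebesgue {a<..<b} (weak_deriv_on {a<..<b} f)"
    "set_borel_measurable lebesgue {a<..<b} g"
    using w assms by (auto simp: has_weak_deriv_on_def intro: locally_integrable_measurable)
qed

section \<open>Norm bounds by testing\<close>

lemma L2_norm_on_nonneg: "0 \<le> L2_norm_on S f"
  unfolding L2_norm_on_def set_lebesgue_integral_real
  by (intro real_sqrt_ge_zero integral_nonneg_AE) auto

lemma L2_norm_on_sq: "(L2_norm_on S f)\<^sup>2 = (LINT x|lebesgue. indicator S x * (f x)\<^sup>2)"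
proof -
  have "0 \<le> (LINT x|lebesgue. indicator S x * (f x)\<^sup>2)"
    by (intro integral_nonneg_AE) auto
  then show ?thesis
    by (simp add: L2_norm_on_def set_lebesgue_integral_real)
qed

lemma L2_on_add:
  assumes "f \<in> L2_on S" "g \<in> L2_on S"
  shows "(\<lambda>x. f x + g x) \<in> L2_on S"
    and "(L2_norm_on S (\<lambda>x. f x + g x))\<^sup>2 \<le> 2 * (L2_norm_on S f)\<^sup>2 + 2 * (L2_norm_on S g)\<^sup>2"
proof -
  let ?h = "\<lambda>x. indicator S x * (f x + g x)\<^sup>2"
  have m: "set_borel_measurable lebesgue S f" "set_borel_measurable lebesgue S g"
    and i: "integrable lebesgue (\<lambda>x. indicator S x * (f x)\<^sup>2)" "integrable lebesgue (\<lambda>x. indicator S x * (g x)\<^sup>2)"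
    using assms by (auto simp: L2_on_def set_integrable_def)
  have mfg: "set_borel_measurable lebesgue S (\<lambda>x. f x + g x)"
    using m borel_measurable_add unfolding set_borel_measurable_def
    by (simp add: distrib_left borel_measurable_add)
  have le: "?h x \<le> 2 * (indicator S x * (f x)\<^sup>2) + 2 * (indicator S x * (g x)\<^sup>2)" for x
    using sum_squares_bound[of "f x" "g x"] by (auto simp: indicator_def power2_sum)
  have ib: "integrable lebesgue (\<lambda>x. 2 * (indicator S x * (f x)\<^sup>2) + 2 * (indicator S x * (g x)\<^sup>2))"
    using i by (intro Bochner_Integration.integrable_add integrable_mult_right)
  have h_eq: "?h x = (indicator S x *\<^sub>R (f x + g x))\<^sup>2" for x
    by (auto simp: indicator_def)
  have mh: "?h \<in> borel_measurable lebesgue"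
    unfolding h_eq using mfg by (intro borel_measurable_power) (simp add: set_borel_measurable_def)
  have int: "integrable lebesgue ?h"
  proof (rule Bochner_Integration.integrable_bound[OF ib mh], rule AE_I2)
    show "norm (?h x) \<le> norm (2 * (indicator S x * (f x)\<^sup>2) + 2 * (indicator S x * (g x)\<^sup>2))" for x
      using le[of x] by (simp add: abs_of_nonneg)
  qed
  then show "(\<lambda>x. f x + g x) \<in> L2_on S"
    using mfg by (simp add: L2_on_def set_integrable_def)
  have "(LINT x|lebesgue. ?h x) \<le>
      (LINT x|lebesgue. 2 * (indicator S x * (f x)\<^sup>2) + 2 * (indicator S x * (g x)\<^sup>2))"
    by (rule integral_mono[OF int ib le])
  also have "\<dots> = 2 * (LINT x|lebesgue. indicator S x * (f x)\<^sup>2) + 2 * (LINT x|lebesgue. indicator S x * (g x)\<^sup>2)"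
    using i by simp
  finally show "(L2_norm_on S (\<lambda>x. f x + g x))\<^sup>2 \<le> 2 * (L2_norm_on S f)\<^sup>2 + 2 * (L2_norm_on S g)\<^sup>2"
    by (simp add: L2_norm_on_sq)
qed

lemma L2_on_cmult:
  assumes "f \<in> L2_on S"
  shows "(\<lambda>x. c * f x) \<in> L2_on S"
proof -
  have "set_borel_measurable lebesgue S f" "set_integrable lebesgue S (\<lambda>x. (f x)\<^sup>2)"
    using assms by (auto simp: L2_on_def)
  then have "(\<lambda>x. c * (indicator S x *\<^sub>R f x)) \<in> borel_measurable lebesgue"
    "set_integrable lebesgue S (\<lambda>x. c\<^sup>2 * (f x)\<^sup>2)"
    by (auto simp: set_borel_measurable_def)
  then show ?thesis
    by (simp add: L2_on_def set_borel_measurable_def power_mult_distrib mult.left_commute)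
qed

lemma test_function_weak_deriv:
  assumes "\<eta> \<in> test_functions S"
  shows "has_weak_deriv_on {a<..<b} \<eta> (deriv \<eta>)"
  using assms by (intro C1_has_weak_deriv)
    (auto simp: test_functions_iff intro: smooth_DERIV smooth_continuous smooth_deriv)

lemma test_function_H1:
  assumes "\<eta> \<in> test_functions S"
  shows "\<eta> \<in> H1_on {a<..<b}"
proof -
  have "\<eta> \<in> L2_on {a<..<b}" "deriv \<eta> \<in> L2_on {a<..<b}"
    using assms by (auto simp: test_functions_iff intro!: continuous_L2_on smooth_continuous smooth_deriv)
  then show ?thesis
    using test_function_weak_deriv[OF assms] by (auto simp: H1_on_def)
qed

lemma H10_norm_eq: "has_weak_deriv_on Omega v g \<Longrightarrow> H10_norm v = L2_norm_on Omega g"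
  unfolding H10_norm_def Omega_def by (rule L2_norm_weak_deriv_on)

lemma H10_norm_le_H1_norm: "H10_norm v \<le> H1_norm_on Omega v"
  unfolding H10_norm_def H1_norm_on_def
  by (metis L2_norm_on_nonneg le_add_same_cancel2 real_le_rsqrt zero_le_power2)

lemma H1_on_add:
  assumes "f \<in> H1_on S" "g \<in> H1_on S"
  shows "(\<lambda>x. f x + g x) \<in> H1_on S"
  using assms by (auto simp: H1_on_def intro: L2_on_add has_weak_deriv_add
      intro!: bexI[of _ "\<lambda>x. _ x + _ x"])

lemma test_function_H10:
  assumes \<eta>: "\<eta> \<in> test_functions Omega"
  shows "\<eta> \<in> H10"
proof -
  \<comment> \<open>Even for the zero function \<open>weak_deriv_on\<close> is a choice, so that its
    norm vanishes is a consequence of uniqueness.\<close>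
  have "has_weak_deriv_on Omega (\<lambda>x. 0) (\<lambda>x. 0)"
    unfolding Omega_def by (rule C1_has_weak_deriv) auto
  from H10_norm_eq[OF this] have "H1_norm_on Omega (\<lambda>x. \<eta> x - \<eta> x) = 0"
    by (simp add: H1_norm_on_def H10_norm_def L2_norm_on_def)
  then have "(\<lambda>n::nat. H1_norm_on Omega (\<lambda>x. (\<lambda>_. \<eta>) n x - \<eta> x)) \<longlonglongrightarrow> 0"
    by simp
  moreover have "\<eta> \<in> H1_on Omega"
    unfolding Omega_def by (rule test_function_H1[OF \<eta>])
  ultimately show ?thesis
    unfolding H10_def using \<eta> by (intro CollectI conjI exI[of _ "\<lambda>_. \<eta>"]) auto
qed

text \<open>Puts the error \<open>v - \<zeta> n\<close> of an approximation into \<open>H10\<close>,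
  where linearity and boundedness of an element of \<open>Hm1\<close> apply. The approximating
  sequence is translated along with \<open>v\<close>.\<close>

lemma H10_add_test_function:
  assumes v: "v \<in> H10" and \<eta>: "\<eta> \<in> test_functions Omega"
  shows "(\<lambda>x. v x + \<eta> x) \<in> H10"
proof -
  obtain \<zeta> where \<zeta>: "\<And>n::nat. \<zeta> n \<in> test_functions Omega"
    "(\<lambda>n. H1_norm_on Omega (\<lambda>x. \<zeta> n x - v x)) \<longlonglongrightarrow> 0"
    using v by (auto simp: H10_def)
  have "(\<lambda>n. H1_norm_on Omega (\<lambda>x. (\<zeta> n x + \<eta> x) - (v x + \<eta> x))) \<longlonglongrightarrow> 0"
    using \<zeta>(2) by simp
  moreover have "(\<lambda>x. \<zeta> n x + \<eta> x) \<in> test_functions Omega" for n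
    by (intro test_functions_add \<zeta> \<eta>)
  moreover have "(\<lambda>x. v x + \<eta> x) \<in> H1_on Omega"
    using v test_function_H1[OF \<eta>, of 0 1] by (intro H1_on_add) (auto simp: H10_def Omega_def)
  ultimately show ?thesis
    unfolding H10_def by (intro CollectI conjI exI[of _ "\<lambda>n x. \<zeta> n x + \<eta> x"]) auto
qed

lemma Hm1_add: "l \<in> Hm1 \<Longrightarrow> v \<in> H10 \<Longrightarrow> w \<in> H10 \<Longrightarrow> l (\<lambda>x. v x + w x) = l v + l w"
  by (simp add: Hm1_def)

lemma Hm1_cmult: "l \<in> Hm1 \<Longrightarrow> v \<in> H10 \<Longrightarrow> l (\<lambda>x. a * v x) = a * l v"
  by (simp add: Hm1_def)

lemma Hm1_bounded:
  assumes "l \<in> Hm1"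
  obtains C where "\<And>v. v \<in> H10 \<Longrightarrow> \<bar>l v\<bar> \<le> C * H10_norm v"
proof -
  have "\<exists>C. \<forall>v\<in>H10. \<bar>l v\<bar> \<le> C * H10_norm v"
    using assms by (simp add: Hm1_def)
  then show ?thesis
    using that by blast
qed

lemma Hm1_zero:
  assumes "l \<in> Hm1"
  shows "l (\<lambda>x. 0) = 0"
proof -
  have "(\<lambda>x. 0) \<in> H10"
    by (intro test_function_H10) (auto simp: test_functions_iff)
  from Hm1_cmult[OF assms this, of 0] show ?thesis
    by simp
qed

text \<open>The factor 2 replaces Minkowski's inequality by \<open>(a + b)\<^sup>2 \<le> 2 a\<^sup>2 + 2 b\<^sup>2\<close>.\<close>

lemma Hm1_norm_sq_le:
  assumes l: "l \<in> Hm1" and "D \<ge> 0"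
    and bound: "\<And>\<eta>. \<eta> \<in> test_functions Omega \<Longrightarrow> (l \<eta>)\<^sup>2 \<le> D * (L2_norm_on Omega (deriv \<eta>))\<^sup>2"
  shows "(Hm1_norm l)\<^sup>2 \<le> 2 * D"
proof -
  have le: "\<bar>l v\<bar> \<le> sqrt (2 * D)" if v: "v \<in> H10" "H10_norm v \<le> 1" for v
  proof -
    obtain g where g: "has_weak_deriv_on Omega v g" "g \<in> L2_on Omega"
      using v by (auto simp: H10_def H1_on_def)
    obtain \<zeta> where \<zeta>: "\<And>n::nat. \<zeta> n \<in> test_functions Omega"
      "(\<lambda>n. H1_norm_on Omega (\<lambda>x. \<zeta> n x - v x)) \<longlonglongrightarrow> 0"
      using v by (auto simp: H10_def)
    define e where "e n = H10_norm (\<lambda>x. \<zeta> n x - v x)" for n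
    have "0 \<le> e n" for n
      by (simp add: e_def H10_norm_def L2_norm_on_nonneg)
    then have "e \<longlonglongrightarrow> 0"
      by (intro tendsto_sandwich[OF _ _ tendsto_const \<zeta>(2)])
        (auto simp: e_def intro!: H10_norm_le_H1_norm always_eventually)
    obtain C where C: "\<And>w. w \<in> H10 \<Longrightarrow> \<bar>l w\<bar> \<le> C * H10_norm w"
      using Hm1_bounded[OF l] by blast
    have wd: "has_weak_deriv_on Omega (\<lambda>x. \<zeta> n x - v x) (\<lambda>x. deriv (\<zeta> n) x - g x)" for n
      using has_weak_deriv_add[OF test_function_weak_deriv[OF \<zeta>(1), of 0 1] has_weak_deriv_cmult[of _ v g "-1"], of n] g(1)
      by (simp add: Omega_def)
    have e_eq: "e n = L2_norm_on Omega (\<lambda>x. deriv (\<zeta> n) x - g x)" for n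
      unfolding e_def by (rule H10_norm_eq[OF wd])
    \<comment> \<open>Split \<open>v\<close> into \<open>\<zeta> n\<close> and a remainder. The
      hypothesis covers \<open>\<zeta> n\<close>, whose derivative has square norm at most
      \<open>2 + 2 * (e n)\<^sup>2\<close>; the remainder is covered by boundedness of
      \<open>l\<close> with an uncontrolled constant \<open>C\<close>, which disappears in the
      limit.\<close>
    have "\<bar>l v\<bar> \<le> sqrt (D * (2 + 2 * (e n)\<^sup>2)) + \<bar>C\<bar> * e n" for n
    proof -
      have test: "(\<lambda>x. (-1) * \<zeta> n x) \<in> test_functions Omega"
        by (intro test_functions_cmult \<zeta>)
      have "l (\<lambda>x. v x + (-1) * \<zeta> n x) = l v + l (\<lambda>x. (-1) * \<zeta> n x)"
        by (rule Hm1_add[OF l v(1) test_function_H10[OF test]])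
      also have "l (\<lambda>x. (-1) * \<zeta> n x) = (-1) * l (\<zeta> n)"
        by (rule Hm1_cmult[OF l test_function_H10[OF \<zeta>(1)]])
      finally have eq: "l v - l (\<zeta> n) = l (\<lambda>x. v x - \<zeta> n x)"
        by simp
      have "(\<lambda>x. v x - \<zeta> n x) \<in> H10"
        using H10_add_test_function[OF v(1) test] by simp
      moreover have "H10_norm (\<lambda>x. v x - \<zeta> n x) = e n"
        using H10_norm_eq[OF has_weak_deriv_cmult[OF wd, of "-1" n]]
        by (simp add: e_eq L2_norm_on_def power2_commute)
      ultimately have "\<bar>l v - l (\<zeta> n)\<bar> \<le> C * e n"
        using C eq by metis
      also have "\<dots> \<le> \<bar>C\<bar> * e n"
        using \<open>0 \<le> e n\<close> by (intro mult_right_mono) auto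
      finally have 1: "\<bar>l v - l (\<zeta> n)\<bar> \<le> \<bar>C\<bar> * e n" .
      have d\<zeta>: "(\<lambda>x. deriv (\<zeta> n) x - g x) \<in> L2_on Omega"
      proof -
        have "deriv (\<zeta> n) \<in> L2_on Omega"
          using \<zeta>(1)[of n] by (auto simp: Omega_def test_functions_iff
              intro!: continuous_L2_on smooth_continuous smooth_deriv)
        from L2_on_add(1)[OF this L2_on_cmult[OF g(2), of "-1"]] show ?thesis
          by simp
      qed
      have "(L2_norm_on Omega g)\<^sup>2 \<le> 1"
        using v(2) H10_norm_eq[OF g(1)] L2_norm_on_nonneg[of Omega g]
        by (simp add: power_le_one)
      then have "(L2_norm_on Omega (deriv (\<zeta> n)))\<^sup>2 \<le> 2 + 2 * (e n)\<^sup>2"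
        using L2_on_add(2)[OF g(2) d\<zeta>] by (simp add: e_eq)
      then have "(l (\<zeta> n))\<^sup>2 \<le> D * (2 + 2 * (e n)\<^sup>2)"
        using bound[OF \<zeta>(1), of n] \<open>D \<ge> 0\<close> by (meson mult_left_mono order_trans)
      then have "\<bar>l (\<zeta> n)\<bar> \<le> sqrt (D * (2 + 2 * (e n)\<^sup>2))"
        by (simp add: real_le_rsqrt)
      with 1 show ?thesis
        by linarith
    qed
    moreover have "(\<lambda>n. sqrt (D * (2 + 2 * (e n)\<^sup>2)) + \<bar>C\<bar> * e n) \<longlonglongrightarrow> sqrt (D * (2 + 2 * 0\<^sup>2)) + \<bar>C\<bar> * 0"
      by (intro tendsto_intros \<open>e \<longlonglongrightarrow> 0\<close>)
    ultimately have "\<bar>l v\<bar> \<le> sqrt (D * (2 + 2 * 0\<^sup>2)) + \<bar>C\<bar> * 0"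
      by (intro LIMSEQ_le_const) auto
    then show ?thesis
      by (simp add: mult.commute)
  qed
  \<comment> \<open>\<open>Hm1_norm\<close> is a supremum of reals, so both bounds on it require an
    element of the unit ball.\<close>
  have z: "(\<lambda>x. 0) \<in> {v \<in> H10. H10_norm v \<le> 1}"
  proof -
    have "has_weak_deriv_on Omega (\<lambda>x. 0) (\<lambda>x. 0)"
      unfolding Omega_def by (rule C1_has_weak_deriv) auto
    from H10_norm_eq[OF this] have "H10_norm (\<lambda>x. 0) \<le> 1"
      by (simp add: L2_norm_on_def)
    moreover have "(\<lambda>x. 0) \<in> H10"
      by (intro test_function_H10) (auto simp: test_functions_iff)
    ultimately show ?thesis
      by simp
  qed
  have "Hm1_norm l \<le> sqrt (2 * D)"
    unfolding Hm1_norm_def using z le by (intro cSUP_least) auto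
  moreover have "0 \<le> Hm1_norm l"
    unfolding Hm1_norm_def
    using le by (intro cSUP_upper2[OF _ z]) (auto intro!: bdd_aboveI[of _ "sqrt (2 * D)"])
  ultimately have "(Hm1_norm l)\<^sup>2 \<le> (sqrt (2 * D))\<^sup>2"
    by (intro power_mono)
  then show ?thesis
    using \<open>D \<ge> 0\<close> by simp
qed

text \<open>Testing with smooth approximations of the truncations \<open>h\<close> of \<open>f\<close> gives
  \<open>\<parallel>h\<parallel>\<^sup>2 \<le> \<integral> f h \<le> sqrt D \<parallel>h\<parallel>\<close>.\<close>

lemma L2_norm_sq_le:
  assumes f: "f \<in> L2_on {a<..<b}" and "D \<ge> 0"
    and bound: "\<And>\<eta>. \<eta> \<in> test_functions {a<..<b} \<Longrightarrow>
      (set_lebesgue_integral lebesgue {a<..<b} (\<lambda>x. f x * \<eta> x))\<^sup>2 \<le> D * (L2_norm_on {a<..<b} \<eta>)\<^sup>2"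
  shows "(L2_norm_on {a<..<b} f)\<^sup>2 \<le> D"
proof -
  let ?I = "indicator {a<..<b} :: real \<Rightarrow> real"
  define F where "F x = ?I x * f x" for x
  have [measurable]: "F \<in> borel_measurable lebesgue"
    using f by (simp add: L2_on_def set_borel_measurable_def F_def[abs_def])
  have F2: "integrable lebesgue (\<lambda>x. (F x)\<^sup>2)"
  proof -
    have "(F x)\<^sup>2 = ?I x * (f x)\<^sup>2" for x
      by (auto simp: F_def indicator_def)
    then show ?thesis
      using f by (simp add: L2_on_def set_integrable_def)
  qed
  have I1: "integrable lebesgue ?I"
    using continuous_set_integrable[of "\<lambda>_. 1" a b] by (simp add: set_integrable_def)
  have F1: "integrable lebesgue F"
  proof (rule Bochner_Integration.integrable_bound)
    show "integrable lebesgue (\<lambda>x. ?I x + (F x)\<^sup>2)"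
      using I1 F2 by simp
    show "AE x in lebesgue. norm (F x) \<le> norm (?I x + (F x)\<^sup>2)"
    proof (rule AE_I2)
      fix x
      have "\<bar>F x\<bar> \<le> 1 + (F x)\<^sup>2"
      proof -
        have "2 * \<bar>F x\<bar> * 1 \<le> \<bar>F x\<bar>\<^sup>2 + 1\<^sup>2"
          by (rule sum_squares_bound)
        then show ?thesis
          by simp
      qed
      then show "norm (F x) \<le> norm (?I x + (F x)\<^sup>2)"
        by (auto simp: F_def indicator_def)
    qed
  qed measurable
  obtain \<kappa> K where \<kappa>: "\<And>n. \<kappa> n \<in> test_functions {a<..<b}"
    "\<And>n. compact (K n)" "\<And>n. K n \<subseteq> {a<..<b}" "\<And>n x. x \<notin> K n \<Longrightarrow> \<kappa> n x = 0"
    "\<And>n x. 0 \<le> \<kappa> n x" "\<And>n x. \<kappa> n x \<le> 1"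
    "\<And>x. x \<in> {a<..<b} \<Longrightarrow> eventually (\<lambda>n::nat. \<kappa> n x = 1) sequentially"
    using ex_cutoffs by blast
  \<comment> \<open>The truncation at height \<open>k\<close> is bounded, so test functions can
    approximate it with a common bound.\<close>
  have trunc: "(LINT x|lebesgue. (max (- real k) (min (real k) (F x)))\<^sup>2) \<le> D" for k :: nat
  proof -
    define h where "h x = max (- real k) (min (real k) (F x))" for x
    have hm [measurable]: "h \<in> borel_measurable lebesgue"
      unfolding h_def by measurable
    have hk: "\<bar>h x\<bar> \<le> real k" for x
      by (auto simp: h_def)
    obtain p where p: "\<And>m. smooth (p m)" "\<And>m x. x \<in> {a..b} \<Longrightarrow> \<bar>p m x\<bar> \<le> real k + 1"
      "AE x in lebesgue. x \<in> {a..b} \<longrightarrow> (\<lambda>m::nat. p m x) \<longlonglongrightarrow> h x"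
      using bounded_measurable_limit_of_smooth[OF hm hk] by blast
    define \<eta> where "\<eta> m x = \<kappa> m x * p m x" for m x
    have \<eta>: "\<eta> m \<in> test_functions {a<..<b}" for m
      unfolding \<eta>_def by (rule test_functions_mult_smooth[OF \<kappa>(1) p(1)])
    then have [measurable]: "\<eta> m \<in> borel_measurable lebesgue" for m
      by (auto simp: test_functions_iff intro: smooth_borel_measurable)
    have \<eta>_bd: "\<bar>\<eta> m x\<bar> \<le> real k + 1" if "x \<in> {a<..<b}" for m x
    proof -
      have "\<bar>\<kappa> m x\<bar> * \<bar>p m x\<bar> \<le> 1 * (real k + 1)"
        using \<kappa>(5)[of m x] \<kappa>(6)[of m x] p(2)[of x m] that by (intro mult_mono) auto
      then show ?thesis
        by (simp add: \<eta>_def abs_mult)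
    qed
    have lim: "AE x in lebesgue. x \<in> {a<..<b} \<longrightarrow> (\<lambda>m. \<eta> m x) \<longlonglongrightarrow> h x"
      using p(3)
    proof eventually_elim
      case (elim x)
      show ?case
      proof
        assume x: "x \<in> {a<..<b}"
        have "(\<lambda>m. \<kappa> m x) \<longlonglongrightarrow> 1"
          by (rule tendsto_eventually[OF \<kappa>(7)[OF x]])
        then have "(\<lambda>m. \<kappa> m x * p m x) \<longlonglongrightarrow> 1 * h x"
          using elim x by (intro tendsto_mult) auto
        then show "(\<lambda>m. \<eta> m x) \<longlonglongrightarrow> h x"
          by (simp add: \<eta>_def)
      qed
    qed
    have l1: "(\<lambda>m. LINT x|lebesgue. ?I x * (f x * \<eta> m x)) \<longlonglongrightarrow> (LINT x|lebesgue. F x * h x)"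
    proof (rule integral_dominated_convergence)
      show "integrable lebesgue (\<lambda>x. (real k + 1) * \<bar>F x\<bar>)"
        using F1 by simp
      show "AE x in lebesgue. (\<lambda>m. ?I x * (f x * \<eta> m x)) \<longlonglongrightarrow> F x * h x"
        using lim by eventually_elim (auto simp: F_def indicator_def intro!: tendsto_intros)
      show "AE x in lebesgue. norm (?I x * (f x * \<eta> m x)) \<le> (real k + 1) * \<bar>F x\<bar>" for m
        using \<eta>_bd by (intro AE_I2)
          (auto simp: F_def indicator_def abs_mult mult.commute intro!: mult_left_mono)
      have "(\<lambda>x. F x * \<eta> m x) \<in> borel_measurable lebesgue" for m
        by measurable
      then show "(\<lambda>x. ?I x * (f x * \<eta> m x)) \<in> borel_measurable lebesgue" for m
        by (simp add: F_def mult.assoc)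
    qed measurable
    have hI: "?I x * (h x)\<^sup>2 = (h x)\<^sup>2" for x
      by (auto simp: h_def F_def indicator_def)
    have l2: "(\<lambda>m. LINT x|lebesgue. ?I x * (\<eta> m x)\<^sup>2) \<longlonglongrightarrow> (LINT x|lebesgue. ?I x * (h x)\<^sup>2)"
    proof (rule integral_dominated_convergence)
      show "integrable lebesgue (\<lambda>x. (real k + 1)\<^sup>2 * ?I x)"
        using I1 by simp
      show "AE x in lebesgue. (\<lambda>m. ?I x * (\<eta> m x)\<^sup>2) \<longlonglongrightarrow> ?I x * (h x)\<^sup>2"
        using lim by eventually_elim (auto simp: indicator_def intro!: tendsto_intros)
      show "AE x in lebesgue. norm (?I x * (\<eta> m x)\<^sup>2) \<le> (real k + 1)\<^sup>2 * ?I x" for m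
        using \<eta>_bd by (intro AE_I2) (auto simp: indicator_def intro!: power2_le_iff_abs_le[THEN iffD2])
    qed (auto intro!: borel_measurable_times borel_measurable_power borel_measurable_indicator)
    have h2: "integrable lebesgue (\<lambda>x. (h x)\<^sup>2)"
    proof (rule Bochner_Integration.integrable_bound[OF F2])
      show "AE x in lebesgue. norm ((h x)\<^sup>2) \<le> norm ((F x)\<^sup>2)"
        by (intro AE_I2) (auto simp: h_def abs_le_square_iff[symmetric])
    qed measurable
    have Fh: "integrable lebesgue (\<lambda>x. F x * h x)"
    proof (rule Bochner_Integration.integrable_bound[OF F2])
      show "AE x in lebesgue. norm (F x * h x) \<le> norm ((F x)\<^sup>2)"
      proof (rule AE_I2)
        fix x
        have "\<bar>h x\<bar> \<le> \<bar>F x\<bar>"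
          by (auto simp: h_def)
        then have "\<bar>F x\<bar> * \<bar>h x\<bar> \<le> \<bar>F x\<bar> * \<bar>F x\<bar>"
          by (intro mult_left_mono) auto
        then show "norm (F x * h x) \<le> norm ((F x)\<^sup>2)"
          by (simp add: abs_mult power2_eq_square)
      qed
    qed measurable
    have "(LINT x|lebesgue. (h x)\<^sup>2) \<le> (LINT x|lebesgue. F x * h x)"
    proof (rule integral_mono[OF h2 Fh])
      show "(h x)\<^sup>2 \<le> F x * h x" for x
      proof (cases "0 \<le> F x")
        case True
        then have "0 \<le> h x" "h x \<le> F x"
          by (auto simp: h_def)
        then show ?thesis
          by (simp add: power2_eq_square mult_right_mono)
      next
        case False
        then have "h x \<le> 0" "F x \<le> h x"
          by (auto simp: h_def)
        then show ?thesis
          by (simp add: power2_eq_square mult_right_mono_neg)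
      qed
    qed
    moreover have "0 \<le> (LINT x|lebesgue. (h x)\<^sup>2)"
      by (intro integral_nonneg_AE) auto
    moreover have "(LINT x|lebesgue. F x * h x)\<^sup>2 \<le> D * (LINT x|lebesgue. (h x)\<^sup>2)"
    proof (rule LIMSEQ_le)
      show "(\<lambda>m. (LINT x|lebesgue. ?I x * (f x * \<eta> m x))\<^sup>2) \<longlonglongrightarrow> (LINT x|lebesgue. F x * h x)\<^sup>2"
        by (intro tendsto_intros l1)
      show "(\<lambda>m. D * (LINT x|lebesgue. ?I x * (\<eta> m x)\<^sup>2)) \<longlonglongrightarrow> D * (LINT x|lebesgue. (h x)\<^sup>2)"
        using l2 by (intro tendsto_intros) (simp add: hI)
      show "\<exists>N. \<forall>n\<ge>N. (LINT x|lebesgue. ?I x * (f x * \<eta> n x))\<^sup>2 \<le> D * (LINT x|lebesgue. ?I x * (\<eta> n x)\<^sup>2)"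
        using bound[OF \<eta>] by (simp add: L2_norm_on_sq set_lebesgue_integral_real)
    qed
    \<comment> \<open>With \<open>X\<close> the square norm of \<open>h\<close> this is
      \<open>X\<^sup>2 \<le> D * X\<close>. It gives \<open>X \<le> D\<close>, also for
      \<open>X = 0\<close> because \<open>D\<close> is nonnegative, and the bound does not depend on
      \<open>k\<close>.\<close>
    ultimately have "(LINT x|lebesgue. (h x)\<^sup>2)\<^sup>2 \<le> D * (LINT x|lebesgue. (h x)\<^sup>2)"
      by (meson order_trans power_mono)
    then have "(LINT x|lebesgue. (h x)\<^sup>2) \<le> D"
      using \<open>D \<ge> 0\<close> \<open>0 \<le> (LINT x|lebesgue. (h x)\<^sup>2)\<close>
      by (metis less_eq_real_def mult_le_cancel_right_pos power2_eq_square)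
    then show ?thesis
      by (simp add: h_def)
  qed
  have "(\<lambda>k. LINT x|lebesgue. (max (- real k) (min (real k) (F x)))\<^sup>2) \<longlonglongrightarrow> (LINT x|lebesgue. (F x)\<^sup>2)"
  proof (rule integral_dominated_convergence[OF _ _ F2])
    show "AE x in lebesgue. (\<lambda>k. (max (- real k) (min (real k) (F x)))\<^sup>2) \<longlonglongrightarrow> (F x)\<^sup>2"
    proof (rule AE_I2, rule tendsto_eventually)
      fix x
      have "eventually (\<lambda>k. k \<ge> nat \<lceil>\<bar>F x\<bar>\<rceil>) sequentially"
        by (rule eventually_ge_at_top)
      then show "eventually (\<lambda>k. (max (- real k) (min (real k) (F x)))\<^sup>2 = (F x)\<^sup>2) sequentially"
      proof eventually_elim
        case (elim k)
        then have "\<bar>F x\<bar> \<le> real k"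
          by linarith
        then have "max (- real k) (min (real k) (F x)) = F x"
          by linarith
        then show ?case
          by simp
      qed
    qed
    show "AE x in lebesgue. norm ((max (- real k) (min (real k) (F x)))\<^sup>2) \<le> (F x)\<^sup>2" for k
      by (intro AE_I2) (auto simp: abs_le_square_iff[symmetric])
  qed measurable
  then have "(LINT x|lebesgue. (F x)\<^sup>2) \<le> D"
    using trunc by (intro LIMSEQ_le_const2) auto
  moreover have "(F x)\<^sup>2 = ?I x * (f x)\<^sup>2" for x
    by (auto simp: F_def indicator_def)
  ultimately show ?thesis
    by (simp add: L2_norm_on_sq)
qed

section \<open>Regular representatives of admissible curves\<close>

text \<open>A primitive is constant on either side of the support of \<zeta>. Mean zero makes the
  two constants equal, and subtracting them leaves a function supported in the convex hull of the
  support.\<close>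

lemma test_function_antiderivative:
  fixes a b :: real
  assumes \<zeta>: "\<zeta> \<in> test_functions {a<..<b}" and 0: "integral {a..b} \<zeta> = 0" and "a < b"
  obtains \<eta> where "\<eta> \<in> test_functions {a<..<b}" "deriv \<eta> = \<zeta>"
proof (cases "\<zeta> = (\<lambda>_. 0)")
  case True
  then show ?thesis
    using \<zeta> by (intro that[of "\<lambda>_. 0"]) auto
next
  case False
  obtain K where K: "smooth \<zeta>" "compact K" "K \<subseteq> {a<..<b}" "\<And>x. x \<notin> K \<Longrightarrow> \<zeta> x = 0"
    using \<zeta> by (auto simp: test_functions_iff)
  then have "K \<noteq> {}"
    using False by auto
  obtain c d where cd: "c \<in> K" "\<And>x. x \<in> K \<Longrightarrow> c \<le> x" "d \<in> K" "\<And>x. x \<in> K \<Longrightarrow> x \<le> d"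
    using compact_attains_inf[OF K(2) \<open>K \<noteq> {}\<close>] compact_attains_sup[OF K(2) \<open>K \<noteq> {}\<close>] by metis
  obtain F where F: "\<And>x. (F has_real_derivative \<zeta> x) (at x)"
    using ex_antiderivative[OF smooth_continuous[OF K(1)]] by blast
  have const: "F x = F y" if xy: "x < y" "\<And>z. x < z \<Longrightarrow> z < y \<Longrightarrow> z \<notin> K" for x y
  proof -
    obtain z where "x < z" "z < y" "F y - F x = (y - x) * \<zeta> z"
      using MVT2[OF xy(1), of F \<zeta>] F by blast
    with xy K(4)[of z] show ?thesis
      by auto
  qed
  have "(\<zeta> has_integral F b - F a) {a..b}"
    using \<open>a < b\<close> F by (intro fundamental_theorem_of_calculus)
      (auto simp: has_real_derivative_iff_has_vector_derivative[symmetric] has_field_derivative_at_within)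
  then have Fab: "F b = F a"
    using 0 by (simp add: integral_unique)
  have "a < c" "c \<le> d" "d < b"
    using cd(1,3) cd(2)[OF cd(3)] K(3) by (force simp: subset_iff)+
  have left: "F x = F a" if "x < c" for x
    using const[of x a] const[of a x] that cd(2) \<open>a < c\<close>
    by (cases x a rule: linorder_cases) fastforce+
  have right: "F x = F b" if "d < x" for x
    using const[of x b] const[of b x] that cd(4) \<open>d < b\<close>
    by (cases x b rule: linorder_cases) fastforce+
  define \<eta> where "\<eta> x = F x - F a" for x
  have D: "(\<eta> has_real_derivative \<zeta> x) (at x)" for x
    using DERIV_diff[OF F[of x] DERIV_const[of "F a"]] by (simp add: \<eta>_def[abs_def])
  have "smooth \<eta>"
    by (rule smooth_antideriv[OF D K(1)])
  moreover have "\<eta> x = 0" if "x \<notin> {c..d}" for x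
    using that left[of x] right[of x] Fab by (auto simp: \<eta>_def not_le)
  moreover have "{c..d} \<subseteq> {a<..<b}"
    using \<open>a < c\<close> \<open>d < b\<close> by auto
  ultimately have "\<eta> \<in> test_functions {a<..<b}"
    unfolding test_functions_iff by (intro conjI exI[of _ "{c..d}"]) simp_all
  moreover have "deriv \<eta> = \<zeta>"
    using D DERIV_imp_deriv by blast
  ultimately show ?thesis
    by (rule that)
qed

text \<open>Du Bois-Reymond: subtracting a multiple of one fixed cutoff makes the mean of a test
  function zero, so the difference is the derivative of a test function and is annihilated by
  \<open>w\<close>. Hence the integral of \<open>w * \<zeta>\<close> depends on the mean of \<zeta>
  alone.\<close>

lemma weak_deriv_0_imp_const:
  fixes a b :: real
  assumes w: "has_weak_deriv_on {a<..<b} w (\<lambda>_. 0)" and "a < b"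
  obtains k where "AE x in lebesgue. x \<in> {a<..<b} \<longrightarrow> w x = k"
proof -
  let ?S = "{a<..<b}"
  have lw: "locally_integrable_on ?S w"
    using w by (simp add: has_weak_deriv_on_def)
  obtain \<kappa> K where \<kappa>: "\<And>n. \<kappa> n \<in> test_functions {a<..<b}"
    "\<And>n. compact (K n)" "\<And>n. K n \<subseteq> {a<..<b}" "\<And>n x. x \<notin> K n \<Longrightarrow> \<kappa> n x = 0"
    "\<And>n x. 0 \<le> \<kappa> n x" "\<And>n x. \<kappa> n x \<le> 1"
    "\<And>x. x \<in> {a<..<b} \<Longrightarrow> eventually (\<lambda>n::nat. \<kappa> n x = 1) sequentially"
    using ex_cutoffs by blast
  have "(a + b) / 2 \<in> ?S"
    using \<open>a < b\<close> by simp
  then obtain n where n: "\<kappa> n ((a + b) / 2) = 1"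
    using \<kappa>(7) unfolding eventually_sequentially by blast
  have c\<kappa>: "continuous_on A (\<kappa> n)" for A
    using \<kappa>(1)[of n] by (auto simp: test_functions_iff intro: smooth_continuous)
  define c0 where "c0 = integral {a..b} (\<kappa> n)"
  have "c0 \<noteq> 0"
  proof
    assume "c0 = 0"
    then have "\<kappa> n ((a + b) / 2) = 0"
      using \<open>a < b\<close> \<kappa>(5)[of n] integral_eq_0_iff[OF c\<kappa>, of a b] by (auto simp: c0_def)
    with n show False
      by simp
  qed
  \<comment> \<open>The only possible constant: the result of testing \<open>w\<close> with
    \<open>\<kappa> n / c0\<close>, which has mean 1.\<close>
  define k where "k = set_lebesgue_integral lebesgue ?S (\<lambda>x. w x * \<kappa> n x) / c0"
  have "AE x in lebesgue. x \<in> ?S \<longrightarrow> w x + (- k) = 0"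
  proof (rule fundamental_lemma)
    show "locally_integrable_on ?S (\<lambda>x. w x + - k)"
      by (intro locally_integrable_add lw continuous_locally_integrable) simp
    fix \<zeta>
    assume \<zeta>: "\<zeta> \<in> test_functions ?S"
    then have sz: "smooth \<zeta>"
      by (simp add: test_functions_iff)
    define c where "c = integral {a..b} \<zeta>"
    have test: "(\<lambda>x. \<zeta> x + (- c / c0) * \<kappa> n x) \<in> test_functions ?S"
      by (intro test_functions_add test_functions_cmult \<zeta> \<kappa>)
    have "integral {a..b} (\<lambda>x. \<zeta> x + (- c / c0) * \<kappa> n x) =
        integral {a..b} \<zeta> + (- c / c0) * integral {a..b} (\<kappa> n)"
      by (subst integral_add)
        (auto intro!: integrable_continuous_real continuous_on_minus continuous_on_divide
          continuous_on_mult c\<kappa> smooth_continuous[OF sz] simp: \<open>c0 \<noteq> 0\<close>)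
    also have "\<dots> = 0"
      using \<open>c0 \<noteq> 0\<close> by (simp add: c0_def[symmetric] c_def[symmetric])
    finally obtain \<eta> where \<eta>: "\<eta> \<in> test_functions ?S" "deriv \<eta> = (\<lambda>x. \<zeta> x + (- c / c0) * \<kappa> n x)"
      using test_function_antiderivative[OF test _ \<open>a < b\<close>] by blast
    have i: "set_integrable lebesgue ?S (\<lambda>x. w x * \<zeta> x)" "set_integrable lebesgue ?S (\<lambda>x. w x * \<kappa> n x)"
      by (intro locally_integrable_times_test lw \<zeta> \<kappa>)+
    have "set_lebesgue_integral lebesgue ?S (\<lambda>x. w x * deriv \<eta> x) = 0"
      using w \<eta>(1) by (simp add: has_weak_deriv_on_def set_lebesgue_integral_def)
    then have "0 = set_lebesgue_integral lebesgue ?S (\<lambda>x. w x * (\<zeta> x + (- c / c0) * \<kappa> n x))"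
      unfolding \<eta>(2) by simp
    also have "\<dots> = set_lebesgue_integral lebesgue ?S (\<lambda>x. w x * \<zeta> x + (- c / c0) * (w x * \<kappa> n x))"
      by (simp add: algebra_simps)
    also have "\<dots> = set_lebesgue_integral lebesgue ?S (\<lambda>x. w x * \<zeta> x) +
        set_lebesgue_integral lebesgue ?S (\<lambda>x. (- c / c0) * (w x * \<kappa> n x))"
      by (intro set_integral_add i set_integrable_mult_right)
    also have "set_lebesgue_integral lebesgue ?S (\<lambda>x. (- c / c0) * (w x * \<kappa> n x)) = - (k * c)"
      by (subst set_integral_mult_right) (simp add: k_def)
    finally have eq: "set_lebesgue_integral lebesgue ?S (\<lambda>x. w x * \<zeta> x) = k * c"
      by simp
    have "set_lebesgue_integral lebesgue ?S \<zeta> = c"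
      unfolding c_def by (intro set_lebesgue_integral_continuous smooth_continuous sz)
    moreover have "set_integrable lebesgue ?S \<zeta>"
      by (intro continuous_set_integrable smooth_continuous sz)
    moreover have "(w x + - k) * \<zeta> x = w x * \<zeta> x - k * \<zeta> x" for x
      by (simp add: algebra_simps)
    ultimately show "set_lebesgue_integral lebesgue ?S (\<lambda>x. (w x + - k) * \<zeta> x) = 0"
      using i(1) eq by (simp add: set_integral_diff)
  qed
  then have "AE x in lebesgue. x \<in> ?S \<longrightarrow> w x = k"
    by eventually_elim simp
  then show ?thesis
    by (rule that)
qed

lemma continuous_on_lipschitz:
  fixes f :: "real \<Rightarrow> real"
  assumes "\<And>x y. \<bar>f x - f y\<bar> \<le> L * \<bar>x - y\<bar>"
  shows "continuous_on A f"
proof -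
  have "L \<ge> 0"
    using assms[of 0 1] abs_ge_zero[of "f 0 - f 1"] by simp
  then have "L-lipschitz_on A f"
    using assms by (intro lipschitz_onI) (auto simp: dist_real_def)
  then show ?thesis
    by (rule lipschitz_on_continuous_on)
qed

text \<open>The representative is a primitive of the weak derivative plus a constant. It is obtained
  as a limit of primitives \<open>P m\<close> of smooth functions, so that Lipschitz bounds and
  classical integration by parts pass to the limit and no differentiation theorem for Lipschitz
  functions enters. The constant \<open>M + 1\<close> is inherited from
  \<open>bounded_measurable_limit_of_smooth\<close>.\<close>

lemma bounded_weak_deriv_lipschitz:
  assumes w: "has_weak_deriv_on {0<..<T} \<gamma> g" and "0 < T" and "M \<ge> 0"
    and g: "AE x in lebesgue. x \<in> {0<..<T} \<longrightarrow> \<bar>g x\<bar> \<le> M"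
  obtains G where "\<And>x y. \<bar>G x - G y\<bar> \<le> (M + 1) * \<bar>x - y\<bar>"
    "AE x in lebesgue. x \<in> {0<..<T} \<longrightarrow> \<gamma> x = G x"
proof -
  let ?S = "{0<..<T}"
  \<comment> \<open>\<open>g\<close> is bounded only almost everywhere on the interval; its clamped
    version is bounded everywhere and agrees with it there up to a null set.\<close>
  define h where "h x = max (- M) (min M (indicator ?S x *\<^sub>R g x))" for x
  have "set_borel_measurable lebesgue ?S g"
    using w by (auto simp: has_weak_deriv_on_def intro: locally_integrable_measurable)
  then have hm [measurable]: "h \<in> borel_measurable lebesgue"
    unfolding h_def set_borel_measurable_def by measurable
  have hM: "\<bar>h x\<bar> \<le> M" for x
    using \<open>M \<ge> 0\<close> by (auto simp: h_def)
  have hg: "AE x in lebesgue. x \<in> ?S \<longrightarrow> h x = g x"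
    using g by eventually_elim (auto simp: h_def)
  obtain p where p: "\<And>m. smooth (p m)" "\<And>m x. x \<in> {0..T} \<Longrightarrow> \<bar>p m x\<bar> \<le> M + 1"
    "AE x in lebesgue. x \<in> {0..T} \<longrightarrow> (\<lambda>m::nat. p m x) \<longlonglongrightarrow> h x"
    using bounded_measurable_limit_of_smooth[OF hm hM] by blast
  have [measurable]: "p m \<in> borel_measurable lebesgue" for m
    by (rule smooth_borel_measurable[OF p(1)])
  have "\<exists>P. P 0 = 0 \<and> (\<forall>x. (P has_real_derivative p m x) (at x))" for m
  proof -
    obtain F where F: "\<And>x. (F has_real_derivative p m x) (at x)"
      using ex_antiderivative[OF smooth_continuous[OF p(1)]] by blast
    have "((\<lambda>x. F x - F 0) has_real_derivative p m x) (at x)" for x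
      using DERIV_diff[OF F[of x] DERIV_const[of "F 0"]] by simp
    then show ?thesis
      by (intro exI[of _ "\<lambda>x. F x - F 0"]) simp
  qed
  then obtain P where P: "\<And>m. P m 0 = 0" "\<And>m x. (P m has_real_derivative p m x) (at x)"
    by metis
  have cP: "continuous_on A (P m)" for A m
    by (simp add: DERIV_isCont[OF P(2)] continuous_at_imp_continuous_on)
  have I: "integrable lebesgue (indicator {a..b} :: real \<Rightarrow> real)" for a b :: real
    by (rule integrable_real_indicator) (auto simp: emeasure_lborel_Icc_eq)
  define \<Gamma> where "\<Gamma> t = (LINT x|lebesgue. indicator {0..t} x * h x)" for t
  have lim: "(\<lambda>m. P m t) \<longlonglongrightarrow> \<Gamma> t" if t: "t \<in> {0..T}" for t
  proof -
    have "(\<lambda>m. LINT x|lebesgue. indicator {0..t} x * p m x) \<longlonglongrightarrow> \<Gamma> t"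
      unfolding \<Gamma>_def
    proof (rule integral_dominated_convergence)
      show "integrable lebesgue (\<lambda>x. (M + 1) * indicator {0..t} x)"
        using I by simp
      show "AE x in lebesgue. (\<lambda>m. indicator {0..t} x * p m x) \<longlonglongrightarrow> indicator {0..t} x * h x"
        using p(3) by eventually_elim (use t in \<open>auto simp: indicator_def\<close>)
      show "AE x in lebesgue. norm (indicator {0..t} x * p m x) \<le> (M + 1) * indicator {0..t} x" for m
        using p(2) t by (intro AE_I2) (auto simp: indicator_def)
    qed (auto intro!: borel_measurable_times borel_measurable_indicator)
    moreover have "(LINT x|lebesgue. indicator {0..t} x * p m x) = P m t" for m
    proof -
      have "set_integrable lebesgue {0..t} (p m)"
        using continuous_locally_integrable[OF smooth_continuous[OF p(1)], of UNIV]
        by (auto simp: locally_integrable_on_def)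
      then have "(LINT x|lebesgue. indicator {0..t} x * p m x) = integral {0..t} (p m)"
        using set_lebesgue_integral_eq_integral(2) by (fastforce simp: set_lebesgue_integral_real)
      moreover have "(p m has_integral P m t - P m 0) {0..t}"
        using t P(2) by (intro fundamental_theorem_of_calculus)
          (auto simp: has_real_derivative_iff_has_vector_derivative[symmetric] has_field_derivative_at_within)
      ultimately show ?thesis
        by (simp add: P integral_unique)
    qed
    ultimately show ?thesis
      by simp
  qed
  have lipP: "\<bar>P m y - P m x\<bar> \<le> (M + 1) * \<bar>y - x\<bar>" if "x \<in> {0..T}" "y \<in> {0..T}" for m x y
  proof -
    have *: "\<bar>P m y - P m x\<bar> \<le> (M + 1) * \<bar>y - x\<bar>" if xy: "x < y" "x \<in> {0..T}" "y \<in> {0..T}" for x y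
    proof -
      obtain z where z: "x < z" "z < y" "P m y - P m x = (y - x) * p m z"
        using MVT2[OF xy(1), of "P m" "p m"] P by blast
      have "\<bar>p m z\<bar> \<le> M + 1"
        using z xy by (intro p) auto
      then show ?thesis
        by (simp add: z(3) abs_mult mult.commute[of "M + 1"] mult_left_mono)
    qed
    show ?thesis
      using *[of x y] *[of y x] that by (cases x y rule: linorder_cases) (auto simp: abs_minus_commute)
  qed
  have lip\<Gamma>: "\<bar>\<Gamma> y - \<Gamma> x\<bar> \<le> (M + 1) * \<bar>y - x\<bar>" if "x \<in> {0..T}" "y \<in> {0..T}" for x y
  proof (rule LIMSEQ_le_const2)
    show "(\<lambda>m. \<bar>P m y - P m x\<bar>) \<longlonglongrightarrow> \<bar>\<Gamma> y - \<Gamma> x\<bar>"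
      by (intro tendsto_intros lim that)
  qed (use lipP[OF that] in auto)
  \<comment> \<open>Freezing \<Gamma> outside \<open>{0..T}\<close> makes the Lipschitz bound
    global.\<close>
  define G where "G x = \<Gamma> (max 0 (min T x))" for x
  have lipG: "\<bar>G x - G y\<bar> \<le> (M + 1) * \<bar>x - y\<bar>" for x y
  proof -
    have "\<bar>G x - G y\<bar> \<le> (M + 1) * \<bar>max 0 (min T x) - max 0 (min T y)\<bar>"
      unfolding G_def using \<open>0 < T\<close> by (intro lip\<Gamma>) auto
    also have "\<dots> \<le> (M + 1) * \<bar>x - y\<bar>"
      using \<open>M \<ge> 0\<close> by (intro mult_left_mono) auto
    finally show ?thesis .
  qed
  have cG: "continuous_on A G" for A
    by (rule continuous_on_lipschitz[OF lipG])
  have "has_weak_deriv_on ?S G g"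
    unfolding has_weak_deriv_on_def
  proof (intro conjI ballI)
    show "locally_integrable_on ?S G"
      by (rule continuous_locally_integrable[OF cG])
    show "locally_integrable_on ?S g"
      using w by (simp add: has_weak_deriv_on_def)
    fix \<eta>
    assume \<eta>: "\<eta> \<in> test_functions ?S"
    then have s\<eta>: "smooth \<eta>" "smooth (deriv \<eta>)"
      by (auto simp: test_functions_iff intro: smooth_deriv)
    have [measurable]: "\<eta> \<in> borel_measurable lebesgue" "deriv \<eta> \<in> borel_measurable lebesgue"
      using s\<eta> by (auto intro: smooth_borel_measurable)
    obtain B where B: "B \<ge> 0" "\<And>x. \<bar>\<eta> x\<bar> \<le> B"
      using test_function_bounded[OF \<eta>] by blast
    obtain B' where B': "B' \<ge> 0" "\<And>x. \<bar>deriv \<eta> x\<bar> \<le> B'"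
      using test_function_bounded[OF test_functions_deriv[OF \<eta>]] by blast
    have l1: "(\<lambda>m. LINT x|lebesgue. indicator ?S x * (P m x * deriv \<eta> x)) \<longlonglongrightarrow>
        (LINT x|lebesgue. indicator ?S x * (G x * deriv \<eta> x))"
    proof (rule integral_dominated_convergence)
      show "integrable lebesgue (\<lambda>x. ((M + 1) * T * B') * indicator {0..T} x)"
        using I by simp
      show "AE x in lebesgue. (\<lambda>m. indicator ?S x * (P m x * deriv \<eta> x)) \<longlonglongrightarrow> indicator ?S x * (G x * deriv \<eta> x)"
        using lim by (intro AE_I2) (auto simp: G_def indicator_def intro!: tendsto_intros)
      show "AE x in lebesgue. norm (indicator ?S x * (P m x * deriv \<eta> x)) \<le> ((M + 1) * T * B') * indicator {0..T} x" for m
      proof (rule AE_I2)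
        fix x
        have "\<bar>P m x\<bar> * \<bar>deriv \<eta> x\<bar> \<le> ((M + 1) * T) * B'" if "x \<in> ?S"
        proof (rule mult_mono)
          have "\<bar>P m x - P m 0\<bar> \<le> (M + 1) * \<bar>x - 0\<bar>"
            using that by (intro lipP) auto
          also have "\<dots> \<le> (M + 1) * T"
            using that \<open>M \<ge> 0\<close> by (intro mult_left_mono) auto
          finally show "\<bar>P m x\<bar> \<le> (M + 1) * T"
            by (simp add: P)
        qed (use B' \<open>M \<ge> 0\<close> \<open>0 < T\<close> in auto)
        then show "norm (indicator ?S x * (P m x * deriv \<eta> x)) \<le> ((M + 1) * T * B') * indicator {0..T} x"
          using \<open>0 < T\<close> \<open>M \<ge> 0\<close> \<open>B' \<ge> 0\<close> by (auto simp: indicator_def abs_mult)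
      qed
      have "G \<in> borel_measurable lebesgue" "P m \<in> borel_measurable lebesgue" for m
        by (intro measurable_completion; simp add: borel_measurable_continuous_onI cG cP)+
      then show "(\<lambda>x. indicator ?S x * (G x * deriv \<eta> x)) \<in> borel_measurable lebesgue"
        "(\<lambda>x. indicator ?S x * (P m x * deriv \<eta> x)) \<in> borel_measurable lebesgue" for m
        by (auto intro!: borel_measurable_times borel_measurable_indicator)
    qed
    have l2: "(\<lambda>m. LINT x|lebesgue. indicator ?S x * (p m x * \<eta> x)) \<longlonglongrightarrow>
        (LINT x|lebesgue. indicator ?S x * (h x * \<eta> x))"
    proof (rule integral_dominated_convergence)
      show "integrable lebesgue (\<lambda>x. ((M + 1) * B) * indicator {0..T} x)"
        using I by simp
      show "AE x in lebesgue. (\<lambda>m. indicator ?S x * (p m x * \<eta> x)) \<longlonglongrightarrow> indicator ?S x * (h x * \<eta> x)"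
        using p(3) by eventually_elim (auto simp: indicator_def intro!: tendsto_intros)
      show "AE x in lebesgue. norm (indicator ?S x * (p m x * \<eta> x)) \<le> ((M + 1) * B) * indicator {0..T} x" for m
        using p(2)[of _ m] B \<open>M \<ge> 0\<close> by (intro AE_I2) (auto simp: indicator_def abs_mult intro!: mult_mono)
    qed (auto intro!: borel_measurable_times borel_measurable_indicator)
    have eq: "(LINT x|lebesgue. indicator ?S x * (P m x * deriv \<eta> x)) =
        - (LINT x|lebesgue. indicator ?S x * (p m x * \<eta> x))" for m
      using C1_has_weak_deriv[OF P(2) smooth_continuous[OF p(1)], of 0 T m] \<eta>
      by (simp add: has_weak_deriv_on_def set_lebesgue_integral_real)
    have "(LINT x|lebesgue. indicator ?S x * (G x * deriv \<eta> x)) = - (LINT x|lebesgue. indicator ?S x * (h x * \<eta> x))"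
      using LIMSEQ_unique[OF l1[unfolded eq] tendsto_minus[OF l2]] .
    also have "(LINT x|lebesgue. indicator ?S x * (h x * \<eta> x)) = (LINT x|lebesgue. indicator ?S x * (g x * \<eta> x))"
    proof (rule integral_cong_AE)
      show "(\<lambda>x. indicator ?S x * (g x * \<eta> x)) \<in> borel_measurable lebesgue"
        using locally_integrable_times_test[of ?S g \<eta>] w \<eta>
        by (auto simp: has_weak_deriv_on_def set_integrable_def)
      show "AE x in lebesgue. indicator ?S x * (h x * \<eta> x) = indicator ?S x * (g x * \<eta> x)"
        using hg by eventually_elim (auto simp: indicator_def)
    qed (auto intro!: borel_measurable_times borel_measurable_indicator)
    finally show "set_lebesgue_integral lebesgue ?S (\<lambda>x. G x * deriv \<eta> x) =
        - set_lebesgue_integral lebesgue ?S (\<lambda>x. g x * \<eta> x)"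
      by (simp add: set_lebesgue_integral_real)
  qed
  \<comment> \<open>\<gamma> and \<open>G\<close> have the same weak derivative, so they differ by a
    constant almost everywhere.\<close>
  then have "has_weak_deriv_on ?S (\<lambda>x. \<gamma> x + (-1) * G x) (\<lambda>x. g x + (-1) * g x)"
    by (intro has_weak_deriv_add has_weak_deriv_cmult w)
  then have "has_weak_deriv_on ?S (\<lambda>x. \<gamma> x + (-1) * G x) (\<lambda>_. 0)"
    by simp
  then obtain k where k: "AE x in lebesgue. x \<in> ?S \<longrightarrow> \<gamma> x + (-1) * G x = k"
    using weak_deriv_0_imp_const \<open>0 < T\<close> by blast
  show ?thesis
  proof (rule that)
    show "\<bar>(G x + k) - (G y + k)\<bar> \<le> (M + 1) * \<bar>x - y\<bar>" for x y
      using lipG by simp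
    show "AE x in lebesgue. x \<in> ?S \<longrightarrow> \<gamma> x = G x + k"
      using k by eventually_elim auto
  qed
qed

text \<open>\<open>g\<close> is the second difference quotient of a double primitive of
  \<open>f\<close>, that is, an average of \<open>f\<close> with a triangular weight on
  \<open>[t, t + 2 * h]\<close>. Its derivatives are difference quotients of a primitive of
  \<open>f\<close> and of \<open>f\<close> itself, bounded through \<open>h\<close> and the range of
  \<open>f\<close> alone. The mean value theorem, used twice, makes \<open>g t\<close> a value of
  \<open>f\<close> in the window: \<open>g\<close> inherits the range of \<open>f\<close>, and since
  the window lies to the right of \<open>t\<close> it also inherits constancy on a right
  half-line.\<close>

lemma ex_C2_approx:
  fixes f :: "real \<Rightarrow> real"
  assumes f: "continuous_on UNIV f" "\<And>x. 0 \<le> f x" "\<And>x. f x \<le> 1" and h: "0 < h"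
  obtains g g' g'' where
    "\<And>t. (g has_real_derivative g' t) (at t)" "\<And>t. (g' has_real_derivative g'' t) (at t)"
    "continuous_on UNIV g''" "\<And>t. \<exists>r. t < r \<and> r < t + 2 * h \<and> g t = f r"
    "\<And>t. \<bar>g' t\<bar> \<le> 1 / h" "\<And>t. \<bar>g'' t\<bar> \<le> 2 / h\<^sup>2"
proof -
  obtain F where F: "\<And>x. (F has_real_derivative f x) (at x)"
    using ex_antiderivative[OF f(1)] by blast
  have cF: "continuous_on UNIV F"
    by (simp add: DERIV_isCont[OF F] continuous_at_imp_continuous_on)
  obtain H where H: "\<And>x. (H has_real_derivative F x) (at x)"
    using ex_antiderivative[OF cF] by blast
  have shift: "((\<lambda>t. u (t + c)) has_real_derivative u' (t + c)) (at t)"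
    if "\<And>x. (u has_real_derivative u' x) (at x)" for u u' :: "real \<Rightarrow> real" and c t
    using DERIV_shift that by blast
  define d where "d u t = (u (t + 2 * h) - u (t + h)) - (u (t + h) - u t)" for u :: "real \<Rightarrow> real" and t
  have Dd: "((\<lambda>t. d u t / h\<^sup>2) has_real_derivative d u' t / h\<^sup>2) (at t)"
    if "\<And>x. (u has_real_derivative u' x) (at x)" for u u' t
    unfolding d_def using shift[OF that] that
    by (intro DERIV_cdivide DERIV_diff) auto
  have F1: "\<exists>r. t < r \<and> r < t + h \<and> F (t + h) - F t = h * f r" for t
    using MVT2[of t "t + h" F f] F h by auto
  show ?thesis
  proof (rule that)
    show "((\<lambda>t. d H t / h\<^sup>2) has_real_derivative d F t / h\<^sup>2) (at t)" for t
      by (rule Dd[OF H])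
    show "((\<lambda>t. d F t / h\<^sup>2) has_real_derivative d f t / h\<^sup>2) (at t)" for t
      by (rule Dd[OF F])
    show "continuous_on UNIV (\<lambda>t. d f t / h\<^sup>2)"
      unfolding d_def using h by (intro continuous_intros continuous_on_compose2[OF f(1)]) auto
    show "\<exists>r. t < r \<and> r < t + 2 * h \<and> d H t / h\<^sup>2 = f r" for t
    proof -
      have "((\<lambda>s. H (s + h) - H s) has_real_derivative F (s + h) - F s) (at s)" for s
        by (intro DERIV_diff shift H)
      then obtain s where s: "t < s" "s < t + h"
        "(H (t + h + h) - H (t + h)) - (H (t + h) - H t) = h * (F (s + h) - F s)"
        using MVT2[of t "t + h" "\<lambda>s. H (s + h) - H s" "\<lambda>s. F (s + h) - F s"] h by auto
      obtain r where r: "s < r" "r < s + h" "F (s + h) - F s = h * f r"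
        using F1 by blast
      have "d H t = h\<^sup>2 * f r"
        using s(3) r(3) by (simp add: d_def power2_eq_square add.assoc)
      with s r h show ?thesis
        by (intro exI[of _ r]) auto
    qed
    show "\<bar>d F t / h\<^sup>2\<bar> \<le> 1 / h" for t
    proof -
      obtain r1 where r1: "F (t + h) - F t = h * f r1"
        using F1 by blast
      obtain r2 where r2: "F (t + h + h) - F (t + h) = h * f r2"
        using F1 by blast
      have "d F t = h * (f r2 - f r1)"
        using r1 r2 by (simp add: d_def algebra_simps)
      then have "d F t / h\<^sup>2 = (f r2 - f r1) / h"
        using h by (simp add: power2_eq_square)
      moreover have "\<bar>f r2 - f r1\<bar> \<le> 1"
        using f(2,3)[of r1] f(2,3)[of r2] by linarith
      ultimately show ?thesis
        using h by (simp add: abs_divide divide_right_mono)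
    qed
    show "\<bar>d f t / h\<^sup>2\<bar> \<le> 2 / h\<^sup>2" for t
    proof -
      have "\<bar>d f t\<bar> \<le> 2"
        using f(2,3)[of t] f(2,3)[of "t + h"] f(2,3)[of "t + 2 * h"] unfolding d_def by linarith
      then show ?thesis
        by (simp add: abs_divide divide_right_mono)
    qed
  qed
qed

section \<open>Controlling the wave equation along a curve\<close>

definition C2_step :: "real \<Rightarrow> (real \<Rightarrow> real) \<Rightarrow> (real \<Rightarrow> real) \<Rightarrow> (real \<Rightarrow> real) \<Rightarrow> bool" where
  "C2_step N \<sigma> \<sigma>' \<sigma>'' \<longleftrightarrow>
    (\<forall>x. (\<sigma> has_real_derivative \<sigma>' x) (at x)) \<and> (\<forall>x. (\<sigma>' has_real_derivative \<sigma>'' x) (at x)) \<and>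
    continuous_on UNIV \<sigma>'' \<and>
    (\<forall>x\<le>0. \<sigma> x = 0 \<and> \<sigma>' x = 0) \<and> (\<forall>x\<ge>1. \<sigma> x = 1 \<and> \<sigma>' x = 0) \<and>
    (\<forall>x. x < 0 \<or> 1 < x \<longrightarrow> \<sigma>'' x = 0) \<and>
    (\<forall>x. 0 \<le> \<sigma> x \<and> \<sigma> x \<le> 1) \<and> 0 \<le> N \<and> (\<forall>x. \<bar>\<sigma>' x\<bar> \<le> N) \<and> (\<forall>x. \<bar>\<sigma>'' x\<bar> \<le> N)"

lemma ex_C2_step: "\<exists>N \<sigma> \<sigma>' \<sigma>''. C2_step N \<sigma> \<sigma>' \<sigma>''"
proof -
  obtain \<sigma> where \<sigma>: "smooth \<sigma>" "\<And>x. x \<le> 0 \<Longrightarrow> \<sigma> x = 0" "\<And>x. x \<ge> 1 \<Longrightarrow> \<sigma> x = 1"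
    "\<And>x. 0 \<le> \<sigma> x" "\<And>x. \<sigma> x \<le> 1"
    using ex_smooth_step by blast
  have s': "smooth (deriv \<sigma>)" and s'': "smooth (deriv (deriv \<sigma>))"
    using \<sigma>(1) by (auto intro: smooth_deriv)
  \<comment> \<open>Where \<sigma> takes the value 0 it has a global minimum, and where it takes the
    value 1 a global maximum; so the derivative vanishes there, endpoints included.\<close>
  have l: "deriv \<sigma> x = 0" if "x \<le> 0" for x
    by (rule DERIV_local_min[OF smooth_DERIV[OF \<sigma>(1)] zero_less_one]) (simp add: \<sigma> that)
  have r: "deriv \<sigma> x = 0" if "x \<ge> 1" for x
    by (rule DERIV_local_max[OF smooth_DERIV[OF \<sigma>(1)] zero_less_one]) (simp add: \<sigma> that)
  have out: "deriv (deriv \<sigma>) x = 0" if "x < 0 \<or> 1 < x" for x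
  proof -
    have "eventually (\<lambda>y. y \<in> {..<0} \<union> {1<..}) (nhds x)"
      using that by (intro eventually_nhds_in_open) auto
    then have "eventually (\<lambda>y. deriv \<sigma> y = 0) (nhds x)"
      by eventually_elim (auto simp: l r)
    then show ?thesis
      using deriv_cong_ev[of "deriv \<sigma>" "\<lambda>_. 0" x x] by simp
  qed
  have "bounded (deriv \<sigma> ` {0..1})" "bounded (deriv (deriv \<sigma>) ` {0..1})"
    using s' s'' by (auto intro!: compact_imp_bounded compact_continuous_image smooth_continuous)
  then obtain N1 N2 where N: "\<And>x. x \<in> {0..1} \<Longrightarrow> \<bar>deriv \<sigma> x\<bar> \<le> N1" "\<And>x. x \<in> {0..1} \<Longrightarrow> \<bar>deriv (deriv \<sigma>) x\<bar> \<le> N2"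
    unfolding bounded_iff by (metis imageI real_norm_def)
  have N1: "\<bar>deriv \<sigma> x\<bar> \<le> max N1 (max N2 0)" for x
    using N(1)[of x] l[of x] r[of x] by (cases "x \<in> {0..1}") (auto simp: le_max_iff_disj)
  have N2: "\<bar>deriv (deriv \<sigma>) x\<bar> \<le> max N1 (max N2 0)" for x
    using N(2)[of x] out[of x] by (cases "x \<in> {0..1}") (auto simp: le_max_iff_disj)
  have "C2_step (max N1 (max N2 0)) \<sigma> (deriv \<sigma>) (deriv (deriv \<sigma>))"
    unfolding C2_step_def using \<sigma> l r out N1 N2 smooth_continuous[OF s''] smooth_DERIV[OF \<sigma>(1)] smooth_DERIV[OF s']
    by auto
  then show ?thesis
    by blast
qed

text \<open>Leaves the value of the derivative as an equation, in the style of
  \<open>derivative_eq_intros\<close>, so that instances can be used together with those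
  rules.\<close>

lemma DERIV_chain_eq:
  assumes "\<And>y. (u has_real_derivative u' y) (at y)" "(g has_real_derivative g') (at x within S)"
    "u' (g x) * g' = D"
  shows "((\<lambda>x. u (g x)) has_real_derivative D) (at x within S)"
  using DERIV_chain2[OF assms(1) assms(2)] assms(3) by simp

lemma DERIV_continuous_on_UNIV:
  fixes u :: "real \<Rightarrow> real"
  shows "(\<And>y. (u has_real_derivative u' y) (at y)) \<Longrightarrow> continuous_on UNIV u"
  by (meson DERIV_isCont continuous_at_imp_continuous_on)

text \<open>An affine substitution stretches the rise of the step from [0, 1] to
  \<open>[-w, w]\<close>; each derivative brings a factor \<open>1 / (2 * w)\<close>, whence the
  bounds.\<close>

lemma C2_step_scaled:
  assumes "C2_step N \<sigma> \<sigma>' \<sigma>''" and "0 < w"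
  obtains \<kappa> \<kappa>' \<kappa>'' where
    "\<And>y. (\<kappa> has_real_derivative \<kappa>' y) (at y)" "\<And>y. (\<kappa>' has_real_derivative \<kappa>'' y) (at y)"
    "continuous_on UNIV \<kappa>''"
    "\<And>y. y \<le> - w \<Longrightarrow> \<kappa> y = 0" "\<And>y. y \<ge> w \<Longrightarrow> \<kappa> y = 1"
    "\<And>y. w \<le> \<bar>y\<bar> \<Longrightarrow> \<kappa>' y = 0" "\<And>y. w < \<bar>y\<bar> \<Longrightarrow> \<kappa>'' y = 0"
    "\<And>y. \<bar>\<kappa>' y\<bar> \<le> N / (2 * w)" "\<And>y. \<bar>\<kappa>'' y\<bar> \<le> N / (2 * w)\<^sup>2"
proof -
  define s where "s y = (y + w) / (2 * w)" for y
  have \<sigma>: "\<And>x. (\<sigma> has_real_derivative \<sigma>' x) (at x)" "\<And>x. (\<sigma>' has_real_derivative \<sigma>'' x) (at x)"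
    "continuous_on UNIV \<sigma>''"
    "\<And>x. x \<le> 0 \<Longrightarrow> \<sigma> x = 0" "\<And>x. x \<le> 0 \<Longrightarrow> \<sigma>' x = 0" "\<And>x. x \<ge> 1 \<Longrightarrow> \<sigma> x = 1" "\<And>x. x \<ge> 1 \<Longrightarrow> \<sigma>' x = 0"
    "\<And>x. x < 0 \<or> 1 < x \<Longrightarrow> \<sigma>'' x = 0" "\<And>x. \<bar>\<sigma>' x\<bar> \<le> N" "\<And>x. \<bar>\<sigma>'' x\<bar> \<le> N"
    using assms(1) by (auto simp: C2_step_def)
  have ds: "(s has_real_derivative 1 / (2 * w)) (at y)" for y
    unfolding s_def using \<open>0 < w\<close> by (auto intro!: derivative_eq_intros)
  have s: "y \<le> - w \<Longrightarrow> s y \<le> 0" "y \<ge> w \<Longrightarrow> s y \<ge> 1" "y < - w \<Longrightarrow> s y < 0" "y > w \<Longrightarrow> s y > 1" for y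
    using \<open>0 < w\<close> by (auto simp: s_def divide_simps)
  show ?thesis
  proof (rule that)
    show "((\<lambda>y. \<sigma> (s y)) has_real_derivative \<sigma>' (s y) / (2 * w)) (at y)" for y
      by (rule DERIV_chain_eq[OF \<sigma>(1) ds]) simp
    show "((\<lambda>y. \<sigma>' (s y) / (2 * w)) has_real_derivative \<sigma>'' (s y) / (2 * w)\<^sup>2) (at y)" for y
      by (rule DERIV_cdivide[THEN DERIV_cong, OF DERIV_chain_eq[OF \<sigma>(2) ds refl]]) (simp add: power2_eq_square)
    show "continuous_on UNIV (\<lambda>y. \<sigma>'' (s y) / (2 * w)\<^sup>2)"
      using \<open>0 < w\<close> by (intro continuous_on_divide continuous_on_compose2[OF \<sigma>(3)] continuous_on_const
          DERIV_continuous_on_UNIV[OF ds]) auto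
    show "\<sigma> (s y) = 0" if "y \<le> - w" for y
      using s(1)[OF that] \<sigma> by blast
    show "\<sigma> (s y) = 1" if "y \<ge> w" for y
      using s(2)[OF that] \<sigma> by blast
    show "\<sigma>' (s y) / (2 * w) = 0" if "w \<le> \<bar>y\<bar>" for y
    proof -
      have "s y \<le> 0 \<or> s y \<ge> 1"
        using that s(1,2)[of y] by linarith
      with \<sigma> show ?thesis
        by auto
    qed
    show "\<sigma>'' (s y) / (2 * w)\<^sup>2 = 0" if "w < \<bar>y\<bar>" for y
    proof -
      have "s y < 0 \<or> s y > 1"
        using that s(3,4)[of y] by linarith
      with \<sigma> show ?thesis
        by auto
    qed
    show "\<bar>\<sigma>' (s y) / (2 * w)\<bar> \<le> N / (2 * w)" for y
      using \<sigma>(9)[of "s y"] \<open>0 < w\<close> by (simp add: divide_right_mono)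
    show "\<bar>\<sigma>'' (s y) / (2 * w)\<^sup>2\<bar> \<le> N / (2 * w)\<^sup>2" for y
      using \<sigma>(10)[of "s y"] \<open>0 < w\<close> by (simp add: divide_right_mono)
  qed
qed

text \<open>\<open>P\<close> is \<open>G\<close> times the cutoff \<open>\<sigma> ((s - A) / \<rho>) - \<sigma> ((s - A - 2) / \<rho>)\<close>, whose translates by 2
  telescope to 1.\<close>

lemma periodic_cutoff:
  fixes G G' G'' :: "real \<Rightarrow> real"
  assumes step: "C2_step N \<sigma> \<sigma>' \<sigma>''" and \<rho>: "0 < \<rho>" "0 \<le> A" "A + \<rho> \<le> 1"
    and G: "\<And>s. (G has_real_derivative G' s) (at s)" "\<And>s. (G' has_real_derivative G'' s) (at s)"
      "continuous_on UNIV G''"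
    and per: "\<And>x. x \<in> {0..1} \<Longrightarrow> G (x + 2) = G x" "\<And>x. x \<in> {0..1} \<Longrightarrow> G' (x + 2) = G' x"
  obtains P P' P'' where
    "\<And>s. (P has_real_derivative P' s) (at s)" "\<And>s. (P' has_real_derivative P'' s) (at s)"
    "continuous_on UNIV P''"
    "\<And>s. s \<le> A \<or> A + 2 + \<rho> \<le> s \<Longrightarrow> P s = 0" "\<And>s. s \<le> A \<or> A + 2 + \<rho> \<le> s \<Longrightarrow> P' s = 0"
    "\<And>x. x \<in> {0..1} \<Longrightarrow> P (x + 2) + P x = G x" "\<And>x. x \<in> {0..1} \<Longrightarrow> P' (x + 2) + P' x = G' x"
    "\<And>x. x \<in> {0..1} \<Longrightarrow> P (2 - x) = G (2 - x)" "\<And>x. x \<in> {0..1} \<Longrightarrow> P' (2 - x) = G' (2 - x)"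
    "\<And>s. \<bar>P s\<bar> \<le> \<bar>G s\<bar>" "\<And>s. \<bar>P' s\<bar> \<le> \<bar>G' s\<bar> + (2 * N / \<rho>) * \<bar>G s\<bar>"
proof -
  have \<sigma>: "\<And>x. (\<sigma> has_real_derivative \<sigma>' x) (at x)" "\<And>x. (\<sigma>' has_real_derivative \<sigma>'' x) (at x)"
    "continuous_on UNIV \<sigma>''"
    "\<And>x. x \<le> 0 \<Longrightarrow> \<sigma> x = 0" "\<And>x. x \<le> 0 \<Longrightarrow> \<sigma>' x = 0" "\<And>x. x \<ge> 1 \<Longrightarrow> \<sigma> x = 1" "\<And>x. x \<ge> 1 \<Longrightarrow> \<sigma>' x = 0"
    "\<And>x. \<bar>\<sigma>' x\<bar> \<le> N" "\<And>x. 0 \<le> \<sigma> x" "\<And>x. \<sigma> x \<le> 1"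
    using step by (auto simp: C2_step_def)
  define a where "a s = (s - A) / \<rho>" for s
  define b where "b s = (s - A - 2) / \<rho>" for s
  have da: "(a has_real_derivative 1 / \<rho>) (at s)" "(b has_real_derivative 1 / \<rho>) (at s)" for s
    unfolding a_def b_def using \<rho> by (auto intro!: derivative_eq_intros)
  note cont = continuous_on_compose2[OF _ _ subset_UNIV]
  note ca = DERIV_continuous_on_UNIV[OF da(1)] DERIV_continuous_on_UNIV[OF da(2)]
  define \<psi> where "\<psi> s = \<sigma> (a s) - \<sigma> (b s)" for s
  define \<psi>' where "\<psi>' s = (\<sigma>' (a s) - \<sigma>' (b s)) / \<rho>" for s
  define \<psi>'' where "\<psi>'' s = (\<sigma>'' (a s) - \<sigma>'' (b s)) / \<rho>\<^sup>2" for s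
  have d\<psi>: "(\<psi> has_real_derivative \<psi>' s) (at s)" for s
    unfolding \<psi>_def \<psi>'_def diff_divide_distrib
    by (intro DERIV_diff DERIV_chain_eq[OF \<sigma>(1) da(1)] DERIV_chain_eq[OF \<sigma>(1) da(2)]) simp_all
  have d\<psi>': "(\<psi>' has_real_derivative \<psi>'' s) (at s)" for s
    unfolding \<psi>'_def \<psi>''_def
    by (rule DERIV_cdivide[THEN DERIV_cong],
        rule DERIV_diff[OF DERIV_chain_eq[OF \<sigma>(2) da(1) refl] DERIV_chain_eq[OF \<sigma>(2) da(2) refl]])
      (use \<rho> in \<open>simp add: power2_eq_square field_simps\<close>)
  have c\<psi>'': "continuous_on UNIV \<psi>''"
    unfolding \<psi>''_def using \<rho> by (intro continuous_on_divide continuous_on_diff continuous_on_const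
        cont[OF \<sigma>(3)] ca) auto
  have a: "s \<le> A \<Longrightarrow> a s \<le> 0" "s \<ge> A + \<rho> \<Longrightarrow> a s \<ge> 1" "s \<le> A + 2 \<Longrightarrow> b s \<le> 0" "s \<ge> A + 2 + \<rho> \<Longrightarrow> b s \<ge> 1" for s
    using \<rho> by (auto simp: a_def b_def divide_simps)
  have \<psi>0: "\<psi> s = 0 \<and> \<psi>' s = 0" if "s \<le> A \<or> A + 2 + \<rho> \<le> s" for s
  proof (cases "s \<le> A")
    case True
    then have "a s \<le> 0" "b s \<le> 0"
      by (auto intro: a)
    then show ?thesis
      by (simp add: \<psi>_def \<psi>'_def \<sigma>)
  next
    case False
    with that \<rho> have "a s \<ge> 1" "b s \<ge> 1"
      by (auto intro!: a)
    then show ?thesis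
      by (simp add: \<psi>_def \<psi>'_def \<sigma>)
  qed
  have \<psi>1: "\<psi> s = 1 \<and> \<psi>' s = 0" if "A + \<rho> \<le> s" "s \<le> A + 2" for s
  proof -
    have "a s \<ge> 1" "b s \<le> 0"
      using that by (auto intro: a)
    then show ?thesis
      by (simp add: \<psi>_def \<psi>'_def \<sigma>)
  qed
  have tel: "\<psi> (x + 2) + \<psi> x = 1 \<and> \<psi>' (x + 2) + \<psi>' x = 0" if "x \<in> {0..1}" for x
  proof -
    have "b (x + 2) = a x"
      by (simp add: a_def b_def)
    moreover have "a (x + 2) \<ge> 1" "b x \<le> 0"
      using that \<rho> by (auto intro!: a)
    ultimately show ?thesis
      by (simp add: \<psi>_def \<psi>'_def \<sigma>)
  qed
  have \<psi>_le: "\<bar>\<psi> s\<bar> \<le> 1" for s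
    using \<sigma>(9,10)[of "a s"] \<sigma>(9,10)[of "b s"] by (auto simp: \<psi>_def)
  have \<psi>'_le: "\<bar>\<psi>' s\<bar> \<le> 2 * N / \<rho>" for s
  proof -
    have "\<bar>\<sigma>' (a s) - \<sigma>' (b s)\<bar> \<le> 2 * N"
      using \<sigma>(8)[of "a s"] \<sigma>(8)[of "b s"] by linarith
    then show ?thesis
      using \<rho> by (simp add: \<psi>'_def divide_right_mono)
  qed
  show ?thesis
  proof (rule that)
    show "((\<lambda>s. G s * \<psi> s) has_real_derivative (G' s * \<psi> s + \<psi>' s * G s)) (at s)" for s
      by (intro DERIV_mult G d\<psi>)
    show "((\<lambda>s. G' s * \<psi> s + \<psi>' s * G s) has_real_derivative
        ((G'' s * \<psi> s + \<psi>' s * G' s) + (\<psi>'' s * G s + G' s * \<psi>' s))) (at s)" for s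
      by (intro DERIV_mult DERIV_add G d\<psi> d\<psi>')
    show "continuous_on UNIV (\<lambda>s. (G'' s * \<psi> s + \<psi>' s * G' s) + (\<psi>'' s * G s + G' s * \<psi>' s))"
      by (intro continuous_on_add continuous_on_mult G(3) c\<psi>''
          DERIV_continuous_on_UNIV[OF G(1)] DERIV_continuous_on_UNIV[OF G(2)]
          DERIV_continuous_on_UNIV[OF d\<psi>] DERIV_continuous_on_UNIV[OF d\<psi>'])
    show "G s * \<psi> s = 0" "G' s * \<psi> s + \<psi>' s * G s = 0" if "s \<le> A \<or> A + 2 + \<rho> \<le> s" for s
      using \<psi>0[OF that] by simp_all
    show "G (x + 2) * \<psi> (x + 2) + G x * \<psi> x = G x" if "x \<in> {0..1}" for x
      using tel[OF that] per[OF that] by (metis distrib_left mult.right_neutral)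
    show "(G' (x + 2) * \<psi> (x + 2) + \<psi>' (x + 2) * G (x + 2)) + (G' x * \<psi> x + \<psi>' x * G x) = G' x" if "x \<in> {0..1}" for x
    proof -
      have "(G' (x + 2) * \<psi> (x + 2) + \<psi>' (x + 2) * G (x + 2)) + (G' x * \<psi> x + \<psi>' x * G x) =
          G' x * (\<psi> (x + 2) + \<psi> x) + (\<psi>' (x + 2) + \<psi>' x) * G x"
        using per[OF that] by (simp add: algebra_simps)
      then show ?thesis
        using tel[OF that] by simp
    qed
    \<comment> \<open>For \<open>x\<close> in [0, 1] the point \<open>2 - x\<close> lies in [1, 2],
      on the plateau \<open>[A + \<rho>, A + 2]\<close> of the cutoff.\<close>
    show "G (2 - x) * \<psi> (2 - x) = G (2 - x)" "G' (2 - x) * \<psi> (2 - x) + \<psi>' (2 - x) * G (2 - x) = G' (2 - x)"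
      if "x \<in> {0..1}" for x
      using \<psi>1[of "2 - x"] that \<rho> by auto
    show "\<bar>G s * \<psi> s\<bar> \<le> \<bar>G s\<bar>" for s
      using \<psi>_le[of s] by (simp add: abs_mult mult_left_le)
    show "\<bar>G' s * \<psi> s + \<psi>' s * G s\<bar> \<le> \<bar>G' s\<bar> + (2 * N / \<rho>) * \<bar>G s\<bar>" for s
    proof -
      have "\<bar>G' s * \<psi> s\<bar> \<le> \<bar>G' s\<bar>"
        using \<psi>_le[of s] by (simp add: abs_mult mult_left_le)
      moreover have "\<bar>\<psi>' s * G s\<bar> \<le> (2 * N / \<rho>) * \<bar>G s\<bar>"
        unfolding abs_mult by (intro mult_right_mono \<psi>'_le) auto
      ultimately show ?thesis
        by linarith
    qed
  qed
qed

section \<open>The explicit controlled wave\<close>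

lemma C1_rect_cong:
  assumes "C1_rect T u ux ut" "\<And>t x. x \<in> {0..1} \<Longrightarrow> v t x = u t x"
  shows "C1_rect T v ux ut"
proof -
  have "((\<lambda>y. v t y) has_real_derivative ux t x) (at x within {0..1})"
    "((\<lambda>s. v s x) has_real_derivative ut t x) (at t within {0..T})"
    if "x \<in> {0..1}" "t \<in> {0..T}" for x t
    using assms that unfolding C1_rect_def has_field_derivative_def
    by (auto intro: has_derivative_transform[of x] has_derivative_transform[of t])
  with assms(1) show ?thesis
    by (auto simp: C1_rect_def)
qed

text \<open>\<phi>1 acts on functions on the whole line, so the profile at time 0 is prescribed
  outside [0, 1] as well. The cost is measured on each line of constant \<open>x\<close>; as Omega
  has length 1, this bounds the square norm of the source over \<open>Q T\<close> by the same
  \<open>e\<close>.\<close>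

definition controlled :: "real \<Rightarrow> (real \<Rightarrow> real) \<Rightarrow> real \<Rightarrow> (real \<Rightarrow> real) \<Rightarrow> (real \<Rightarrow> real) \<Rightarrow> real \<Rightarrow> bool" where
  "controlled T g r v0 v1 e \<longleftrightarrow> (\<exists>f \<theta> \<theta>t. adjoint_solution T f \<theta> \<theta>t \<and>
    (\<forall>x\<in>{0..1}. \<theta> 0 x = v0 x \<and> \<theta>t 0 x = v1 x) \<and> (\<forall>x. x \<notin> {0..1} \<longrightarrow> \<theta> 0 x = 0) \<and>
    (\<forall>x\<in>{0..1}. \<forall>t\<in>{0..T}. f t x \<noteq> 0 \<longrightarrow> t \<le> 2 \<and> \<bar>x - g t\<bar> \<le> r) \<and>
    (\<forall>x\<in>{0..1}. integral {0..T} (\<lambda>t. (f t x)\<^sup>2) \<le> e))"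

text \<open>The free wave \<open>G (t + x) - G (t - x)\<close> is a superposition of pulses, each of which travels
  to the left along \<open>t + x = s\<close> for some \<open>s \<in> [A, A + 2 + \<rho>]\<close> before time 2, where it crosses the
  curve \<open>k\<close>; multiplication by \<open>\<kappa> (x - k t)\<close> switches it off there.\<close>

lemma control:
  fixes G G' G'' k k' k'' :: "real \<Rightarrow> real"
  assumes step: "C2_step N \<sigma> \<sigma>' \<sigma>''" and \<rho>: "0 < \<rho>" "0 \<le> A" "A + \<rho> \<le> 1" and "0 < w" and "2 \<le> T" and "0 \<le> B"
    and G: "\<And>s. (G has_real_derivative G' s) (at s)" "\<And>s. (G' has_real_derivative G'' s) (at s)"
      "continuous_on UNIV G''"
    and per: "\<And>x. x \<in> {0..1} \<Longrightarrow> G (x + 2) = G x" "\<And>x. x \<in> {0..1} \<Longrightarrow> G' (x + 2) = G' x"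
    and k: "\<And>t. (k has_real_derivative k' t) (at t)" "\<And>t. (k' has_real_derivative k'' t) (at t)"
      "continuous_on UNIV k''"
    and kA: "k 0 + w \<le> A" "\<And>t. 2 \<le> t \<Longrightarrow> A + \<rho> \<le> k t - w"
    and k01: "\<And>t. 0 \<le> t \<Longrightarrow> t \<le> 2 \<Longrightarrow> w \<le> k t" "\<And>t. 0 \<le> t \<Longrightarrow> t \<le> 2 \<Longrightarrow> k t \<le> 1 - w"
    and kB: "\<And>t. 0 \<le> t \<Longrightarrow> t \<le> 2 \<Longrightarrow> \<bar>k' t\<bar> \<le> B" "\<And>t. 0 \<le> t \<Longrightarrow> t \<le> 2 \<Longrightarrow> \<bar>k'' t\<bar> \<le> B"
    and e: "\<And>s. 0 \<le> s \<Longrightarrow> s \<le> 3 \<Longrightarrow> (G s)\<^sup>2 \<le> e" "integral {0..3} (\<lambda>s. (G' s)\<^sup>2) \<le> e"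
    and a: "a = 2 * (B + 1) * (N / (2 * w))"
    and b: "b = a * (2 * N / \<rho>) + (B\<^sup>2 + 1) * (N / (2 * w)\<^sup>2) + B * (N / (2 * w))"
  shows "controlled T k w (\<lambda>x. G x - G (2 - x)) (\<lambda>x. G' x - G' (2 - x)) ((2 * a\<^sup>2 + 4 * b\<^sup>2) * e)"
proof -
  obtain \<kappa> \<kappa>' \<kappa>'' where \<kappa>:
    "\<And>y. (\<kappa> has_real_derivative \<kappa>' y) (at y)" "\<And>y. (\<kappa>' has_real_derivative \<kappa>'' y) (at y)"
    "continuous_on UNIV \<kappa>''"
    "\<And>y. y \<le> - w \<Longrightarrow> \<kappa> y = 0" "\<And>y. y \<ge> w \<Longrightarrow> \<kappa> y = 1"
    "\<And>y. w \<le> \<bar>y\<bar> \<Longrightarrow> \<kappa>' y = 0" "\<And>y. w < \<bar>y\<bar> \<Longrightarrow> \<kappa>'' y = 0"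
    "\<And>y. \<bar>\<kappa>' y\<bar> \<le> N / (2 * w)" "\<And>y. \<bar>\<kappa>'' y\<bar> \<le> N / (2 * w)\<^sup>2"
    using C2_step_scaled[OF step \<open>0 < w\<close>] by blast
  obtain P P' P'' where P:
    "\<And>s. (P has_real_derivative P' s) (at s)" "\<And>s. (P' has_real_derivative P'' s) (at s)"
    "continuous_on UNIV P''"
    "\<And>s. s \<le> A \<or> A + 2 + \<rho> \<le> s \<Longrightarrow> P s = 0" "\<And>s. s \<le> A \<or> A + 2 + \<rho> \<le> s \<Longrightarrow> P' s = 0"
    "\<And>x. x \<in> {0..1} \<Longrightarrow> P (x + 2) + P x = G x" "\<And>x. x \<in> {0..1} \<Longrightarrow> P' (x + 2) + P' x = G' x"
    "\<And>x. x \<in> {0..1} \<Longrightarrow> P (2 - x) = G (2 - x)" "\<And>x. x \<in> {0..1} \<Longrightarrow> P' (2 - x) = G' (2 - x)"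
    "\<And>s. \<bar>P s\<bar> \<le> \<bar>G s\<bar>" "\<And>s. \<bar>P' s\<bar> \<le> \<bar>G' s\<bar> + (2 * N / \<rho>) * \<bar>G s\<bar>"
    using periodic_cutoff[OF step \<rho> G per] by blast
  have "0 \<le> N"
    using step by (simp add: C2_step_def)
  \<comment> \<open>Three legs of one family of pulses: left-going ones present at the start, their
    reflection at \<open>x = 0\<close>, and the left-going wave after reflection at
    \<open>x = 1\<close>. The last leg also carries those pulses of \<open>P x\<close> that are
    present at the start. It is switched off at the curve, with \<kappa> equal to 1 on its right and
    0 on its left.\<close>
  define \<theta>0 where "\<theta>0 t x = P (t + x + 2) - P (t - x + 2) + P (t + x) * \<kappa> (x - k t)" for t x
  define \<theta>x where "\<theta>x t x = P' (t + x + 2) + P' (t - x + 2) + P' (t + x) * \<kappa> (x - k t) +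
    P (t + x) * \<kappa>' (x - k t)" for t x
  define \<theta>t where "\<theta>t t x = P' (t + x + 2) - P' (t - x + 2) + P' (t + x) * \<kappa> (x - k t) -
    P (t + x) * \<kappa>' (x - k t) * k' t" for t x
  define \<theta>xx where "\<theta>xx t x = P'' (t + x + 2) - P'' (t - x + 2) + P'' (t + x) * \<kappa> (x - k t) +
    2 * P' (t + x) * \<kappa>' (x - k t) + P (t + x) * \<kappa>'' (x - k t)" for t x
  define \<theta>xt where "\<theta>xt t x = P'' (t + x + 2) + P'' (t - x + 2) + P'' (t + x) * \<kappa> (x - k t) -
    P' (t + x) * \<kappa>' (x - k t) * k' t + P' (t + x) * \<kappa>' (x - k t) - P (t + x) * \<kappa>'' (x - k t) * k' t" for t x
  define \<theta>tt where "\<theta>tt t x = P'' (t + x + 2) - P'' (t - x + 2) + P'' (t + x) * \<kappa> (x - k t) -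
    2 * P' (t + x) * \<kappa>' (x - k t) * k' t + P (t + x) * \<kappa>'' (x - k t) * (k' t)\<^sup>2 -
    P (t + x) * \<kappa>' (x - k t) * k'' t" for t x
  \<comment> \<open>All terms with \<open>P''\<close> have cancelled because each leg solves the
    wave equation; every remaining term contains a derivative of \<kappa> and so lives within
    distance \<open>w\<close> of the curve.\<close>
  define f where "f t x = - 2 * P' (t + x) * \<kappa>' (x - k t) * (k' t + 1) +
    P (t + x) * (\<kappa>'' (x - k t) * ((k' t)\<^sup>2 - 1) - \<kappa>' (x - k t) * k'' t)" for t x
  note chain = DERIV_chain_eq[OF P(1)] DERIV_chain_eq[OF P(2)] DERIV_chain_eq[OF \<kappa>(1)] DERIV_chain_eq[OF \<kappa>(2)]
    DERIV_chain_eq[OF k(1)] DERIV_chain_eq[OF k(2)]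
  note kw = DERIV_subset[OF k(1) subset_UNIV] DERIV_subset[OF k(2) subset_UNIV]
  have D0: "((\<lambda>x. \<theta>0 t x) has_real_derivative \<theta>x t x) (at x within S)"
    "((\<lambda>t. \<theta>0 t x) has_real_derivative \<theta>t t x) (at t within S)" for t x S
    unfolding \<theta>0_def \<theta>x_def \<theta>t_def
    by (auto intro!: derivative_eq_intros chain kw[THEN DERIV_cong] simp: algebra_simps)
  have Dx: "((\<lambda>x. \<theta>x t x) has_real_derivative \<theta>xx t x) (at x within S)"
    "((\<lambda>t. \<theta>x t x) has_real_derivative \<theta>xt t x) (at t within S)" for t x S
    unfolding \<theta>x_def \<theta>xx_def \<theta>xt_def
    by (auto intro!: derivative_eq_intros chain kw[THEN DERIV_cong] simp: algebra_simps)
  have Dt: "((\<lambda>x. \<theta>t t x) has_real_derivative \<theta>xt t x) (at x within S)"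
    "((\<lambda>t. \<theta>t t x) has_real_derivative \<theta>tt t x) (at t within S)" for t x S
    unfolding \<theta>t_def \<theta>xt_def \<theta>tt_def
    by (auto intro!: derivative_eq_intros chain kw[THEN DERIV_cong] simp: algebra_simps power2_eq_square)
  note c = P(3) \<kappa>(3) k(3) DERIV_continuous_on_UNIV[OF P(1)] DERIV_continuous_on_UNIV[OF P(2)]
    DERIV_continuous_on_UNIV[OF \<kappa>(1)] DERIV_continuous_on_UNIV[OF \<kappa>(2)]
    DERIV_continuous_on_UNIV[OF k(1)] DERIV_continuous_on_UNIV[OF k(2)]
  note cont = c[THEN continuous_on_compose2, OF _ subset_UNIV]
  have C: "continuous_on S (\<lambda>(x, t). \<theta>x t x)" "continuous_on S (\<lambda>(x, t). \<theta>t t x)"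
    "continuous_on S (\<lambda>(x, t). \<theta>xx t x)" "continuous_on S (\<lambda>(x, t). \<theta>xt t x)"
    "continuous_on S (\<lambda>(x, t). \<theta>tt t x)" for S
    unfolding \<theta>x_def \<theta>t_def \<theta>xx_def \<theta>xt_def \<theta>tt_def case_prod_beta
    by (intro continuous_intros cont)+
  define \<theta> where "\<theta> t x = (if x \<in> {0..1} then \<theta>0 t x else 0)" for t x
  have rect: "C1_rect T \<theta> \<theta>x \<theta>t" "C1_rect T \<theta>x \<theta>xx \<theta>xt" "C1_rect T \<theta>t \<theta>xt \<theta>tt"
  proof -
    have "C1_rect T \<theta>0 \<theta>x \<theta>t"
      using D0 C by (simp add: C1_rect_def)
    then show "C1_rect T \<theta> \<theta>x \<theta>t"
      by (rule C1_rect_cong) (simp add: \<theta>_def)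
  qed (use Dx Dt C in \<open>simp_all add: C1_rect_def\<close>)
  have f: "\<theta>tt t x - \<theta>xx t x = f t x" for t x
    by (simp add: \<theta>tt_def \<theta>xx_def f_def algebra_simps)
  \<comment> \<open>After time 2 either \<open>t + x\<close> has passed the support of
    \<open>P\<close>, or \<open>x < A + 2 + \<rho> - t \<le> A + \<rho> \<le> k t - w\<close>, a
    point to the left of the cutoff zone.\<close>
  have late: "P (t + x) * \<kappa> (x - k t) = 0" "P' (t + x) * \<kappa> (x - k t) = 0" "P (t + x) * \<kappa>' (x - k t) = 0"
    "P' (t + x) * \<kappa>' (x - k t) = 0" "P (t + x) * \<kappa>'' (x - k t) = 0"
    if "2 \<le> t" "0 \<le> x" for t x
  proof -
    have *: "P (t + x) = 0 \<and> P' (t + x) = 0 \<or> x - k t < - w"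
    proof (cases "A + 2 + \<rho> \<le> t + x")
      case True
      then show ?thesis
        using P(4,5) by blast
    next
      case False
      then show ?thesis
        using kA(2)[OF that(1)] that(1) by linarith
    qed
    have "\<kappa> y = 0 \<and> \<kappa>' y = 0 \<and> \<kappa>'' y = 0" if "y < - w" for y
      using that \<open>0 < w\<close> by (simp add: \<kappa>)
    with * show "P (t + x) * \<kappa> (x - k t) = 0" "P' (t + x) * \<kappa> (x - k t) = 0" "P (t + x) * \<kappa>' (x - k t) = 0"
      "P' (t + x) * \<kappa>' (x - k t) = 0" "P (t + x) * \<kappa>'' (x - k t) = 0"
      by auto
  qed
  \<comment> \<open>At \<open>x = 0\<close> the first two legs cancel, and the third has already
    been switched off: by \<open>k01\<close> up to time 2 and by \<open>late\<close>
    afterwards.\<close>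
  have bc0: "\<theta>0 t 0 = 0" if "0 \<le> t" for t
  proof (cases "t \<le> 2")
    case True
    then have "\<kappa> (0 - k t) = 0"
      using k01(1)[OF that True] by (intro \<kappa>) simp
    then show ?thesis
      by (simp add: \<theta>0_def)
  next
    case False
    then show ?thesis
      using late(1)[of t 0] by (simp add: \<theta>0_def)
  qed
  \<comment> \<open>At \<open>x = 1\<close> the first leg is past the support of \<open>P\<close>.
    The second arrives as \<open>- P (t + 1)\<close> and cancels the third, on which the cutoff is
    still 1 up to time 2; afterwards \<open>P (t + 1)\<close> is 0.\<close>
  have bc1: "\<theta>0 t 1 = 0" if "0 \<le> t" for t
  proof -
    have "P (t + 1 + 2) = 0"
      using that \<rho> by (intro P) auto
    moreover have "P (t + 1) * (\<kappa> (1 - k t) - 1) = 0"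
    proof (cases "t \<le> 2")
      case True
      then have "\<kappa> (1 - k t) = 1"
        using k01(2)[OF that True] by (intro \<kappa>) simp
      then show ?thesis
        by simp
    next
      case False
      then have "P (t + 1) = 0"
        using \<rho> by (intro P) auto
      then show ?thesis
        by simp
    qed
    moreover have "t - 1 + 2 = t + 1"
      by simp
    ultimately show ?thesis
      by (simp only: \<theta>0_def) (simp add: algebra_simps)
  qed
  have final: "\<theta>0 T x = 0" "\<theta>t T x = 0" if "x \<in> {0..1}" for x
  proof -
    have "P (T + x + 2) = 0" "P (T - x + 2) = 0" "P' (T + x + 2) = 0" "P' (T - x + 2) = 0"
      using that \<rho> \<open>2 \<le> T\<close> by (auto intro!: P)
    then show "\<theta>0 T x = 0" "\<theta>t T x = 0"
      using late[of T x] that \<open>2 \<le> T\<close> by (auto simp: \<theta>0_def \<theta>t_def)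
  qed
  have adj: "adjoint_solution T f \<theta> \<theta>t"
  proof -
    have "\<exists>\<theta>x \<theta>xx \<theta>xt \<theta>tx \<theta>tt. C1_rect T \<theta> \<theta>x \<theta>t \<and> C1_rect T \<theta>x \<theta>xx \<theta>xt \<and> C1_rect T \<theta>t \<theta>tx \<theta>tt \<and>
        (\<forall>x\<in>{0..1}. \<forall>t\<in>{0..T}. \<theta>tt t x - \<theta>xx t x = f t x)"
      by (intro exI[of _ \<theta>x] exI[of _ \<theta>xx] exI[of _ \<theta>xt] exI[of _ \<theta>tt] conjI rect) (simp add: f)
    moreover have "\<theta> t 0 = 0 \<and> \<theta> t 1 = 0" if "t \<in> {0..T}" for t
      using bc0 bc1 that by (simp add: \<theta>_def)
    moreover have "\<theta> T x = 0 \<and> \<theta>t T x = 0" if "x \<in> {0..1}" for x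
      using final[OF that] that by (simp add: \<theta>_def)
    ultimately show ?thesis
      unfolding adjoint_solution_def by blast
  qed
  \<comment> \<open>The cutoff is invisible at time 0: \<open>P\<close> vanishes up to
    \<open>A\<close>, and beyond \<open>A \<ge> k 0 + w\<close> the cutoff equals 1.\<close>
  have init: "P x * \<kappa> (x - k 0) = P x" "P' x * \<kappa> (x - k 0) = P' x" "P x * \<kappa>' (x - k 0) = 0" for x
  proof -
    have "P x = 0 \<and> P' x = 0 \<or> x - k 0 \<ge> w"
      using P(4)[of x] P(5)[of x] kA(1) by (cases "x \<le> A") auto
    moreover have "\<kappa> y = 1 \<and> \<kappa>' y = 0" if "y \<ge> w" for y
      using that by (simp add: \<kappa>)
    ultimately show "P x * \<kappa> (x - k 0) = P x" "P' x * \<kappa> (x - k 0) = P' x" "P x * \<kappa>' (x - k 0) = 0"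
      by auto
  qed
  have supp: "t < 2 \<and> \<bar>x - k t\<bar> \<le> w" if "x \<in> {0..1}" "t \<in> {0..T}" "f t x \<noteq> 0" for t x
  proof
    show "t < 2"
    proof (rule ccontr)
      assume "\<not> t < 2"
      then show False
        using late(3-5)[of t x] that by (auto simp: f_def)
    qed
    show "\<bar>x - k t\<bar> \<le> w"
    proof (rule ccontr)
      assume "\<not> \<bar>x - k t\<bar> \<le> w"
      then have "\<kappa>' (x - k t) = 0" "\<kappa>'' (x - k t) = 0"
        by (auto intro!: \<kappa>)
      with that(3) show False
        by (simp add: f_def)
    qed
  qed
  have "0 \<le> a" "0 \<le> b"
    using \<open>0 \<le> N\<close> \<open>0 \<le> B\<close> \<open>0 < w\<close> \<rho> by (auto simp: a b)
  \<comment> \<open>\<open>a\<close> bounds the factor of \<open>P'\<close>. Since \<open>P'\<close>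
    itself costs \<open>2 * N / \<rho>\<close> times \<open>G\<close>, a share of \<open>a\<close>
    moves into \<open>b\<close>, which also bounds the factor of \<open>P\<close>.\<close>
  have f_le: "\<bar>f t x\<bar> \<le> a * \<bar>G' (t + x)\<bar> + b * \<bar>G (t + x)\<bar>" if "0 \<le> t" "t \<le> 2" for t x
  proof -
    let ?s = "t + x" and ?y = "x - k t"
    have 1: "\<bar>2 * P' ?s * \<kappa>' ?y * (k' t + 1)\<bar> \<le> a * (\<bar>G' ?s\<bar> + (2 * N / \<rho>) * \<bar>G ?s\<bar>)"
    proof -
      have "\<bar>k' t + 1\<bar> \<le> B + 1"
        using kB(1)[OF that] by linarith
      then have "\<bar>P' ?s\<bar> * (2 * \<bar>\<kappa>' ?y\<bar> * \<bar>k' t + 1\<bar>) \<le> (\<bar>G' ?s\<bar> + (2 * N / \<rho>) * \<bar>G ?s\<bar>) * (2 * (N / (2 * w)) * (B + 1))"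
        using \<open>0 \<le> N\<close> \<open>0 \<le> B\<close> \<open>0 < w\<close> \<rho> by (intro mult_mono P \<kappa>) auto
      also have "\<dots> = a * (\<bar>G' ?s\<bar> + (2 * N / \<rho>) * \<bar>G ?s\<bar>)"
        unfolding a by (simp only: mult_ac)
      finally show ?thesis
        by (simp add: abs_mult mult_ac)
    qed
    have "\<bar>(k' t)\<^sup>2 - 1\<bar> \<le> B\<^sup>2 + 1"
    proof -
      have "(k' t)\<^sup>2 \<le> B\<^sup>2"
        using kB(1)[OF that] \<open>0 \<le> B\<close> by (simp add: abs_le_square_iff[symmetric])
      then show ?thesis
        using zero_le_power2[of "k' t"] by linarith
    qed
    then have "\<bar>\<kappa>'' ?y\<bar> * \<bar>(k' t)\<^sup>2 - 1\<bar> \<le> N / (2 * w)\<^sup>2 * (B\<^sup>2 + 1)"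
      using \<open>0 \<le> N\<close> by (intro mult_mono \<kappa>) auto
    moreover have "\<bar>\<kappa>' ?y\<bar> * \<bar>k'' t\<bar> \<le> N / (2 * w) * B"
      using \<open>0 \<le> N\<close> \<open>0 < w\<close> kB(2)[OF that] by (intro mult_mono \<kappa>) auto
    ultimately have "\<bar>\<kappa>'' ?y * ((k' t)\<^sup>2 - 1) - \<kappa>' ?y * k'' t\<bar> \<le> (B\<^sup>2 + 1) * (N / (2 * w)\<^sup>2) + B * (N / (2 * w))"
      unfolding abs_mult[symmetric] by (simp add: mult.commute)
    then have "\<bar>P ?s\<bar> * \<bar>\<kappa>'' ?y * ((k' t)\<^sup>2 - 1) - \<kappa>' ?y * k'' t\<bar> \<le>
        \<bar>G ?s\<bar> * ((B\<^sup>2 + 1) * (N / (2 * w)\<^sup>2) + B * (N / (2 * w)))"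
      by (intro mult_mono P) auto
    then have 2: "\<bar>P ?s * (\<kappa>'' ?y * ((k' t)\<^sup>2 - 1) - \<kappa>' ?y * k'' t)\<bar> \<le>
        \<bar>G ?s\<bar> * ((B\<^sup>2 + 1) * (N / (2 * w)\<^sup>2) + B * (N / (2 * w)))"
      by (simp add: abs_mult)
    have "\<bar>f t x\<bar> \<le> \<bar>2 * P' ?s * \<kappa>' ?y * (k' t + 1)\<bar> + \<bar>P ?s * (\<kappa>'' ?y * ((k' t)\<^sup>2 - 1) - \<kappa>' ?y * k'' t)\<bar>"
      unfolding f_def by linarith
    also have "\<dots> \<le> a * (\<bar>G' ?s\<bar> + (2 * N / \<rho>) * \<bar>G ?s\<bar>) +
        \<bar>G ?s\<bar> * ((B\<^sup>2 + 1) * (N / (2 * w)\<^sup>2) + B * (N / (2 * w)))"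
      by (rule add_mono[OF 1 2])
    also have "\<dots> = a * \<bar>G' ?s\<bar> + b * \<bar>G ?s\<bar>"
      unfolding b by (simp add: algebra_simps)
    finally show ?thesis .
  qed
  \<comment> \<open>\<open>G\<close> is bounded uniformly and \<open>G'\<close> in square mean. The
    length 2 of the time interval doubles the coefficient of \<open>b\<^sup>2\<close>, and the shift
    by \<open>x\<close> explains why \<open>G'\<close> is integrated up to 3.\<close>
  have int: "integral {0..T} (\<lambda>t. (f t x)\<^sup>2) \<le> (2 * a\<^sup>2 + 4 * b\<^sup>2) * e" if x: "x \<in> {0..1}" for x
  proof -
    have cf: "continuous_on S (\<lambda>t. (f t x)\<^sup>2)" for S
      unfolding f_def by (intro continuous_intros cont)
    have cG': "continuous_on S (\<lambda>t. (G' (t + x))\<^sup>2)" "continuous_on S (\<lambda>t. (G' t)\<^sup>2)" for S x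
      by (intro continuous_intros continuous_on_compose2[OF DERIV_continuous_on_UNIV[OF G(2)]] subset_UNIV)+
    have "integral {0..T} (\<lambda>t. (f t x)\<^sup>2) = integral {0..2} (\<lambda>t. (f t x)\<^sup>2) + integral {2..T} (\<lambda>t. (f t x)\<^sup>2)"
      using \<open>2 \<le> T\<close> by (subst Henstock_Kurzweil_Integration.integral_combine)
        (auto intro!: integrable_continuous_real cf)
    also have "integral {2..T} (\<lambda>t. (f t x)\<^sup>2) = integral {2..T} (\<lambda>t. 0)"
    proof (rule Henstock_Kurzweil_Integration.integral_cong)
      show "(f t x)\<^sup>2 = 0" if "t \<in> {2..T}" for t
        using supp[OF x, of t] that by auto
    qed
    also have "integral {0..2} (\<lambda>t. (f t x)\<^sup>2) \<le> integral {0..2} (\<lambda>t. 2 * a\<^sup>2 * (G' (t + x))\<^sup>2 + 2 * b\<^sup>2 * e)"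
    proof (rule integral_le)
      show "(\<lambda>t. (f t x)\<^sup>2) integrable_on {0..2}"
        by (intro integrable_continuous_real cf)
      show "(\<lambda>t. 2 * a\<^sup>2 * (G' (t + x))\<^sup>2 + 2 * b\<^sup>2 * e) integrable_on {0..2}"
        by (intro integrable_continuous_real continuous_intros cG')
      fix t :: real
      assume t: "t \<in> {0..2}"
      have "(f t x)\<^sup>2 \<le> (a * \<bar>G' (t + x)\<bar> + b * \<bar>G (t + x)\<bar>)\<^sup>2"
        using f_le[of t x] t \<open>0 \<le> a\<close> \<open>0 \<le> b\<close> by (simp add: abs_le_square_iff[symmetric])
      also have "\<dots> \<le> 2 * (a * \<bar>G' (t + x)\<bar>)\<^sup>2 + 2 * (b * \<bar>G (t + x)\<bar>)\<^sup>2"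
        using sum_squares_bound[of "a * \<bar>G' (t + x)\<bar>" "b * \<bar>G (t + x)\<bar>"] by (simp add: power2_sum)
      also have "\<dots> = 2 * a\<^sup>2 * (G' (t + x))\<^sup>2 + 2 * b\<^sup>2 * (G (t + x))\<^sup>2"
        by (simp add: power_mult_distrib)
      also have "\<dots> \<le> 2 * a\<^sup>2 * (G' (t + x))\<^sup>2 + 2 * b\<^sup>2 * e"
        using t x by (intro add_left_mono mult_left_mono e) auto
      finally show "(f t x)\<^sup>2 \<le> 2 * a\<^sup>2 * (G' (t + x))\<^sup>2 + 2 * b\<^sup>2 * e" .
    qed
    also have "\<dots> = 2 * a\<^sup>2 * integral {0..2} (\<lambda>t. (G' (t + x))\<^sup>2) + 4 * b\<^sup>2 * e"
      by (subst integral_add) (auto intro!: integrable_continuous_real continuous_intros cG')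
    finally have le: "integral {0..T} (\<lambda>t. (f t x)\<^sup>2) \<le>
        2 * a\<^sup>2 * integral {0..2} (\<lambda>t. (G' (t + x))\<^sup>2) + 4 * b\<^sup>2 * e"
      by simp
    have "integral {0..2} (\<lambda>t. (G' (t + x))\<^sup>2) = integral {0 + x..2 + x} (\<lambda>t. (G' t)\<^sup>2)"
      using integral_shift_Icc_real[of 0 2 "\<lambda>t. (G' t)\<^sup>2" x] by (simp add: o_def add.commute)
    also have "\<dots> \<le> integral {0..3} (\<lambda>t. (G' t)\<^sup>2)"
      using x by (intro integral_subset_le integrable_continuous_real cG') auto
    also have "\<dots> \<le> e"
      by (rule e)
    finally have "2 * a\<^sup>2 * integral {0..2} (\<lambda>t. (G' (t + x))\<^sup>2) \<le> 2 * a\<^sup>2 * e"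
      by (intro mult_left_mono) auto
    with le show ?thesis
      by (simp add: distrib_right)
  qed
  have "\<theta> 0 x = G x - G (2 - x) \<and> \<theta>t 0 x = G' x - G' (2 - x)" if x: "x \<in> {0..1}" for x
  proof
    have "\<theta> 0 x = P (x + 2) - P (2 - x) + P x * \<kappa> (x - k 0)"
      using x by (simp add: \<theta>_def \<theta>0_def)
    then show "\<theta> 0 x = G x - G (2 - x)"
      unfolding init(1) using P(6,8)[OF x] by linarith
    have "\<theta>t 0 x = P' (x + 2) - P' (2 - x) + P' x * \<kappa> (x - k 0) - P x * \<kappa>' (x - k 0) * k' 0"
      by (simp add: \<theta>t_def)
    then show "\<theta>t 0 x = G' x - G' (2 - x)"
      unfolding init(2,3) using P(7,9)[OF x] by linarith
  qed
  moreover have "\<theta> 0 x = 0" if "x \<notin> {0..1}" for x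
    using that by (auto simp: \<theta>_def)
  moreover have "t \<le> 2 \<and> \<bar>x - k t\<bar> \<le> w" if "x \<in> {0..1}" "t \<in> {0..T}" "f t x \<noteq> 0" for t x
    using supp[OF that] by simp
  ultimately show ?thesis
    unfolding controlled_def using adj int by blast
qed

section \<open>Initial data as periodic profiles\<close>

lemma antiderivative_sq_le:
  fixes u U :: "real \<Rightarrow> real"
  assumes U: "\<And>x. (U has_real_derivative u x) (at x)" "U 0 = 0" and u: "continuous_on UNIV u"
    and s: "0 \<le> s" "s \<le> 1"
  shows "(U s)\<^sup>2 \<le> integral {0..1} (\<lambda>x. (u x)\<^sup>2)"
proof -
  have cu: "continuous_on A u" for A
    using u continuous_on_subset by blast
  have "(u has_integral U s - U 0) {0..s}"
    using s U(1) by (intro fundamental_theorem_of_calculus)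
      (auto simp: has_real_derivative_iff_has_vector_derivative[symmetric] has_field_derivative_at_within)
  then have int: "integral {0..s} u = U s"
    by (simp add: U integral_unique)
  \<comment> \<open>Cauchy-Schwarz through
    \<open>2 * U s * u x \<le> (U s)\<^sup>2 + (u x)\<^sup>2\<close>: the left side integrates to
    \<open>2 * (U s)\<^sup>2\<close>, and \<open>s \<le> 1\<close> lets one copy be
    absorbed.\<close>
  have "integral {0..s} (\<lambda>x. 2 * U s * u x) \<le> integral {0..s} (\<lambda>x. (U s)\<^sup>2 + (u x)\<^sup>2)"
    by (rule integral_le)
      (auto intro!: integrable_continuous_real continuous_intros cu sum_squares_bound)
  also have "\<dots> = s * (U s)\<^sup>2 + integral {0..s} (\<lambda>x. (u x)\<^sup>2)"
    using s by (subst integral_add) (auto intro!: integrable_continuous_real continuous_intros cu)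
  also have "\<dots> \<le> 1 * (U s)\<^sup>2 + integral {0..1} (\<lambda>x. (u x)\<^sup>2)"
    using s by (intro add_mono mult_right_mono integral_subset_le)
      (auto intro!: integrable_continuous_real continuous_intros cu)
  finally show ?thesis
    by (simp add: int power2_eq_square)
qed

lemma test_function_at_boundary:
  assumes "\<eta> \<in> test_functions Omega" "x \<le> 0 \<or> 1 \<le> x"
  shows "\<eta> x = 0"
proof -
  obtain K where K: "K \<subseteq> Omega" "\<forall>x. x \<notin> K \<longrightarrow> \<eta> x = 0"
    using assms(1) unfolding test_functions_iff by blast
  have "x \<notin> K"
    using K(1) assms(2) by (auto simp: Omega_def)
  then show ?thesis
    using K(2) by blast
qed

text \<open>\<open>\<tau> = -1\<close> extends \<open>U\<close> oddly across 0 and 1, \<open>\<tau> = 1\<close> evenly.\<close>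

lemma reflected_extension:
  assumes u: "u \<in> test_functions Omega" and U: "\<And>x. (U has_real_derivative u x) (at x)"
    and U0: "\<And>x. x \<le> 0 \<Longrightarrow> U x = 0" and \<tau>: "\<tau> = 1 \<or> \<tau> = - 1" "\<tau> * U 1 = U 1"
  obtains G G' G'' where
    "\<And>s. (G has_real_derivative G' s) (at s)" "\<And>s. (G' has_real_derivative G'' s) (at s)"
    "continuous_on UNIV G''"
    "\<And>x. x \<in> {0..1} \<Longrightarrow> G (x + 2) = G x" "\<And>x. x \<in> {0..1} \<Longrightarrow> G' (x + 2) = G' x"
    "\<And>x. x \<in> {0..1} \<Longrightarrow> G x - G (2 - x) = (1 - \<tau>) / 2 * U x"
    "\<And>x. x \<in> {0..1} \<Longrightarrow> G' x - G' (2 - x) = (1 + \<tau>) / 2 * u x"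
    "\<And>s. (G s)\<^sup>2 \<le> 5 * integral {0..1} (\<lambda>x. (u x)\<^sup>2)"
    "integral {0..3} (\<lambda>s. (G' s)\<^sup>2) \<le> 5 * integral {0..1} (\<lambda>x. (u x)\<^sup>2)"
proof -
  define c where "c = U 1"
  define E where "E = integral {0..1} (\<lambda>x. (u x)\<^sup>2)"
  have su: "smooth u"
    using u by (simp add: test_functions_iff)
  note u0 = test_function_at_boundary[OF u]
  have cu: "continuous_on A u" for A
    by (rule smooth_continuous[OF su])
  have U1: "U x = c" if x1: "1 \<le> x" for x
  proof (cases "x = 1")
    case False
    then obtain z where "1 < z" "U x - U 1 = (x - 1) * u z"
      using MVT2[of 1 x U u] U x1 by auto
    then show ?thesis
      using u0[of z] by (simp add: c_def)
  qed (simp add: c_def)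
  have \<tau>c: "\<tau> * c = c"
    using \<tau>(2) by (simp add: c_def)
  have \<tau>2: "\<tau> * \<tau> = 1"
    using \<tau>(1) by auto
  \<comment> \<open>On [0, 1], [1, 2] and [2, 3] this equals \<open>U s / 2\<close>,
    \<open>\<tau> * U (2 - s) / 2\<close> and \<open>U (s - 2) / 2\<close>. As a sum of globally
    differentiable terms it needs no gluing; the constants cancel because
    \<open>\<tau> * c = c\<close>, which for an odd extension says that \<open>U\<close> vanishes at
    1.\<close>
  define G where "G s = (U s + \<tau> * (U (2 - s) - c) + U (s - 2)) / 2" for s
  define G' where "G' s = (u s - \<tau> * u (2 - s) + u (s - 2)) / 2" for s
  define G'' where "G'' s = (deriv u s + \<tau> * deriv u (2 - s) + deriv u (s - 2)) / 2" for s
  note chain = DERIV_chain_eq[OF U] DERIV_chain_eq[OF smooth_DERIV[OF su]]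
  have U_le: "(U s)\<^sup>2 \<le> E" for s
  proof -
    have "(U s)\<^sup>2 \<le> E" if "s \<in> {0..1}" for s
      unfolding E_def using U0[of 0] cu that by (intro antiderivative_sq_le[OF U]) auto
    from this[of s] this[of 0] this[of 1] show ?thesis
      using U0[of s] U0[of 0] U1[of s] U1[of 1] by (cases "s < 0"; cases "1 < s") auto
  qed
  have "0 \<le> E"
    using U_le[of 0] by (meson order_trans zero_le_power2)
  have sq3: "((a + b + d) / 2)\<^sup>2 \<le> 3 / 4 * (a\<^sup>2 + b\<^sup>2 + d\<^sup>2)" for a b d :: real
  proof -
    have "3 * (a\<^sup>2 + b\<^sup>2 + d\<^sup>2) = (a + b + d)\<^sup>2 + ((a - b)\<^sup>2 + (a - d)\<^sup>2 + (b - d)\<^sup>2)"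
      by (simp add: power2_eq_square algebra_simps)
    then have "(a + b + d)\<^sup>2 \<le> 3 * (a\<^sup>2 + b\<^sup>2 + d\<^sup>2)"
      by simp
    then show ?thesis
      by (simp add: power_divide)
  qed
  have uE: "integral {a..b} (\<lambda>x. (u x)\<^sup>2) \<le> E" if "a \<le> 0" "1 \<le> b" for a b
  proof -
    have "integral {a..b} (\<lambda>x. (u x)\<^sup>2) = integral {a..b} (\<lambda>x. if x \<in> {0..1} then (u x)\<^sup>2 else 0)"
      using u0 by (intro Henstock_Kurzweil_Integration.integral_cong) auto
    also have "\<dots> = integral ({0..1} \<inter> {a..b}) (\<lambda>x. (u x)\<^sup>2)"
      by (rule integral_restrict_Int)
    also have "{0..1} \<inter> {a..b} = {0..1}"
      using that by auto
    finally show ?thesis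
      by (simp add: E_def)
  qed
  show ?thesis
  proof (rule that)
    show "(G has_real_derivative G' s) (at s)" for s
      unfolding G_def G'_def by (auto intro!: derivative_eq_intros chain simp: field_simps)
    show "(G' has_real_derivative G'' s) (at s)" for s
      unfolding G'_def G''_def by (auto intro!: derivative_eq_intros chain simp: field_simps)
    show "continuous_on UNIV G''"
      unfolding G''_def
      by (intro continuous_intros continuous_on_compose2[OF smooth_continuous[OF smooth_deriv[OF su]]] subset_UNIV) auto
    fix x :: real
    assume x: "x \<in> {0..1}"
    have vals: "U (x + 2) = c" "U (2 - (x + 2)) = 0" "U (x + 2 - 2) = U x" "U (2 - x) = c" "U (x - 2) = 0"
      "U (2 - (2 - x)) = U x" "U (2 - x - 2) = 0"
      using x by (auto intro!: U1 U0)
    have valu: "u (x + 2) = 0" "u (2 - (x + 2)) = 0" "u (x + 2 - 2) = u x" "u (2 - x) = 0" "u (x - 2) = 0"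
      "u (2 - (2 - x)) = u x" "u (2 - x - 2) = 0"
      using x by (auto intro!: u0)
    show "G (x + 2) = G x"
      unfolding G_def vals using \<tau>c by (simp add: algebra_simps)
    show "G' (x + 2) = G' x"
      unfolding G'_def valu by simp
    show "G x - G (2 - x) = (1 - \<tau>) / 2 * U x"
      unfolding G_def vals using \<tau>c by (simp add: field_simps)
    show "G' x - G' (2 - x) = (1 + \<tau>) / 2 * u x"
      unfolding G'_def valu by (simp add: field_simps)
  next
    fix s
    have "(\<tau> * (U (2 - s) - c))\<^sup>2 = (U (2 - s) - c)\<^sup>2"
      using \<tau>2 by (simp add: power_mult_distrib power2_eq_square[of \<tau>])
    also have "\<dots> \<le> 2 * (U (2 - s))\<^sup>2 + 2 * c\<^sup>2"
      using sum_squares_bound[of "U (2 - s)" "- c"] by (simp add: power2_eq_square algebra_simps)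
    also have "\<dots> \<le> 4 * E"
      using U_le[of "2 - s"] U_le[of 1] by (simp add: c_def)
    \<comment> \<open>The total is \<open>9 / 2 * E\<close>, rounded up to 5; the same factor is
      more than enough for \<open>G'\<close>.\<close>
    finally have "(G s)\<^sup>2 \<le> 3 / 4 * (E + 4 * E + E)"
      unfolding G_def by (intro order_trans[OF sq3] mult_left_mono add_mono U_le) simp_all
    then show "(G s)\<^sup>2 \<le> 5 * integral {0..1} (\<lambda>x. (u x)\<^sup>2)"
      using \<open>0 \<le> E\<close> by (simp add: E_def)
  next
    have "integral {0..3} (\<lambda>s. (G' s)\<^sup>2) \<le>
        integral {0..3} (\<lambda>s. 3 / 4 * ((u s)\<^sup>2 + (u (2 - s))\<^sup>2 + (u (s - 2))\<^sup>2))"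
    proof (rule integral_le)
      show "(\<lambda>s. (G' s)\<^sup>2) integrable_on {0..3}"
        "(\<lambda>s. 3 / 4 * ((u s)\<^sup>2 + (u (2 - s))\<^sup>2 + (u (s - 2))\<^sup>2)) integrable_on {0..3}"
        unfolding G'_def by (intro integrable_continuous_real continuous_intros
            continuous_on_compose2[OF cu[of UNIV]] subset_UNIV; simp)+
      fix s :: real
      have "(- \<tau> * u (2 - s))\<^sup>2 = (u (2 - s))\<^sup>2"
        using \<tau>2 by (simp add: power_mult_distrib power2_eq_square[of \<tau>])
      then show "(G' s)\<^sup>2 \<le> 3 / 4 * ((u s)\<^sup>2 + (u (2 - s))\<^sup>2 + (u (s - 2))\<^sup>2)"
        unfolding G'_def using sq3[of "u s" "- \<tau> * u (2 - s)" "u (s - 2)"] by simp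
    qed
    also have "\<dots> = 3 / 4 * (integral {0..3} (\<lambda>s. (u s)\<^sup>2) + integral {0..3} (\<lambda>s. (u (2 - s))\<^sup>2) +
        integral {0..3} (\<lambda>s. (u (s - 2))\<^sup>2))"
    proof -
      have i: "(\<lambda>s. (u s)\<^sup>2) integrable_on {0..3}" "(\<lambda>s. (u (2 - s))\<^sup>2) integrable_on {0..3}"
        "(\<lambda>s. (u (s - 2))\<^sup>2) integrable_on {0..3}"
        by (intro integrable_continuous_real continuous_intros
            continuous_on_compose2[OF cu[of UNIV]] subset_UNIV; simp)+
      then show ?thesis
        by (simp add: integral_add integrable_add)
    qed
    also have "\<dots> \<le> 3 / 4 * (E + E + E)"
    proof -
      have "integral {0..3} (\<lambda>s. (u (s - 2))\<^sup>2) = integral {-2..1} (\<lambda>s. (u s)\<^sup>2)"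
        using integral_shift_Icc_real[of 0 3 "\<lambda>t. (u t)\<^sup>2" "-2"] by (simp add: o_def)
      moreover have "integral {0..3} (\<lambda>s. (u (2 - s))\<^sup>2) = integral {-1..2} (\<lambda>s. (u s)\<^sup>2)"
      proof -
        have "integral {0..3} (\<lambda>s. (u (2 - s))\<^sup>2) = integral {-3..-0} (\<lambda>s. (u (2 - (- s)))\<^sup>2)"
          by (rule Henstock_Kurzweil_Integration.integral_reflect_real[symmetric])
        also have "\<dots> = integral {-1..2} (\<lambda>s. (u s)\<^sup>2)"
          using integral_shift_Icc_real[of "-3" 0 "\<lambda>t. (u t)\<^sup>2" 2] by (simp add: o_def)
        finally show ?thesis .
      qed
      ultimately show ?thesis
        using uE[of 0 3] uE[of "-2" 1] uE[of "-1" 2] by simp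
    qed
    also have "\<dots> \<le> 5 * E"
      using \<open>0 \<le> E\<close> by simp
    finally show "integral {0..3} (\<lambda>s. (G' s)\<^sup>2) \<le> 5 * integral {0..1} (\<lambda>x. (u x)\<^sup>2)"
      by (simp add: E_def)
  qed
qed

section \<open>Reflection in space and a cost uniform in the curve\<close>

definition C2_curve :: "real \<Rightarrow> real \<Rightarrow> (real \<Rightarrow> real) \<Rightarrow> (real \<Rightarrow> real) \<Rightarrow> (real \<Rightarrow> real) \<Rightarrow> bool" where
  "C2_curve \<delta> L g g' g'' \<longleftrightarrow>
    (\<forall>t. (g has_real_derivative g' t) (at t)) \<and> (\<forall>t. (g' has_real_derivative g'' t) (at t)) \<and>
    continuous_on UNIV g'' \<and> (\<forall>t. \<delta> \<le> g t \<and> g t \<le> 1 - \<delta>) \<and> (\<forall>t\<ge>2. g t = g 2) \<and>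
    (\<forall>t. \<bar>g' t\<bar> \<le> L) \<and> (\<forall>t. \<bar>g'' t\<bar> \<le> L)"

lemma C1_rect_reflect:
  assumes "C1_rect T u ux ut"
  shows "C1_rect T (\<lambda>t x. u t (1 - x)) (\<lambda>t x. - ux t (1 - x)) (\<lambda>t x. ut t (1 - x))"
proof -
  have u: "((\<lambda>y. u t y) has_real_derivative ux t x) (at x within {0..1})"
    "((\<lambda>s. u s x) has_real_derivative ut t x) (at t within {0..T})" if "x \<in> {0..1}" "t \<in> {0..T}" for x t
    using assms that by (auto simp: C1_rect_def)
  have "((\<lambda>y. u t (1 - y)) has_real_derivative - ux t (1 - x)) (at x within {0..1})"
    if "x \<in> {0..1}" "t \<in> {0..T}" for x t
  proof -
    \<comment> \<open>Derivatives are one-sided at the endpoints, so the chain rule has to know that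
      the reflection maps [0, 1] onto itself.\<close>
    have img: "(\<lambda>y::real. 1 - y) ` {0..1} = {0..1}"
      by (auto simp: image_iff intro!: bexI[of _ "1 - _"])
    have "((\<lambda>y::real. 1 - y) has_real_derivative - 1) (at x within {0..1})"
      by (auto intro!: derivative_eq_intros)
    moreover have "(u t has_real_derivative ux t (1 - x)) (at (1 - x) within (\<lambda>y. 1 - y) ` {0..1})"
      unfolding img using u(1)[of "1 - x" t] that by simp
    ultimately have "(u t \<circ> (\<lambda>y. 1 - y) has_real_derivative ux t (1 - x) * - 1) (at x within {0..1})"
      by (intro DERIV_image_chain)
    then show ?thesis
      by (simp add: o_def)
  qed
  moreover have "((\<lambda>s. u s (1 - x)) has_real_derivative ut t (1 - x)) (at t within {0..T})"
    if "x \<in> {0..1}" "t \<in> {0..T}" for x t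
    using u(2)[of "1 - x" t] that by simp
  moreover have "continuous_on ({0..1} \<times> {0..T}) (\<lambda>(x, t). v t (1 - x))"
    if "continuous_on ({0..1} \<times> {0..T}) (\<lambda>(x, t). v t x)" for v :: "real \<Rightarrow> real \<Rightarrow> real"
  proof -
    have "continuous_on ({0..1} \<times> {0..T}) (\<lambda>p. (\<lambda>(x, t). v t x) (1 - fst p, snd p))"
      by (rule continuous_on_compose2[OF that]) (auto intro!: continuous_intros)
    then show ?thesis
      by (simp add: case_prod_beta)
  qed
  ultimately show ?thesis
    using assms by (auto simp: C1_rect_def case_prod_beta intro!: continuous_on_minus)
qed

lemma C1_rect_minus:
  assumes "C1_rect T u ux ut"
  shows "C1_rect T (\<lambda>t x. - u t x) (\<lambda>t x. - ux t x) (\<lambda>t x. - ut t x)"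
proof -
  have "((\<lambda>y. - u t y) has_real_derivative - ux t x) (at x within {0..1})"
    "((\<lambda>s. - u s x) has_real_derivative - ut t x) (at t within {0..T})"
    if "x \<in> {0..1}" "t \<in> {0..T}" for x t
    using assms that by (auto simp: C1_rect_def intro!: DERIV_minus)
  moreover have "continuous_on ({0..1} \<times> {0..T}) (\<lambda>(x, t). - ux t x)"
    "continuous_on ({0..1} \<times> {0..T}) (\<lambda>(x, t). - ut t x)"
    using assms by (auto simp: C1_rect_def case_prod_beta intro!: continuous_on_minus)
  ultimately show ?thesis
    by (simp add: C1_rect_def)
qed

lemma adjoint_solution_reflect:
  assumes "adjoint_solution T f \<theta> \<theta>t"
  shows "adjoint_solution T (\<lambda>t x. f t (1 - x)) (\<lambda>t x. \<theta> t (1 - x)) (\<lambda>t x. \<theta>t t (1 - x))"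
proof -
  obtain \<theta>x \<theta>xx \<theta>xt \<theta>tx \<theta>tt where
    r: "C1_rect T \<theta> \<theta>x \<theta>t" "C1_rect T \<theta>x \<theta>xx \<theta>xt" "C1_rect T \<theta>t \<theta>tx \<theta>tt"
      "\<forall>x\<in>{0..1}. \<forall>t\<in>{0..T}. \<theta>tt t x - \<theta>xx t x = f t x"
    using assms by (auto simp: adjoint_solution_def)
  \<comment> \<open>The first derivative in \<open>x\<close> changes sign under the reflection; the
    second keeps it.\<close>
  have neg: "C1_rect T (\<lambda>t x. - \<theta>x t (1 - x)) (\<lambda>t x. \<theta>xx t (1 - x)) (\<lambda>t x. - \<theta>xt t (1 - x))"
    using C1_rect_minus[OF C1_rect_reflect[OF r(2)]] by simp
  have "\<exists>\<theta>x \<theta>xx \<theta>xt \<theta>tx \<theta>tt. C1_rect T (\<lambda>t x. \<theta> t (1 - x)) \<theta>x (\<lambda>t x. \<theta>t t (1 - x)) \<and>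
      C1_rect T \<theta>x \<theta>xx \<theta>xt \<and> C1_rect T (\<lambda>t x. \<theta>t t (1 - x)) \<theta>tx \<theta>tt \<and>
      (\<forall>x\<in>{0..1}. \<forall>t\<in>{0..T}. \<theta>tt t x - \<theta>xx t x = f t (1 - x))"
    by (intro exI conjI, rule C1_rect_reflect[OF r(1)], rule neg, rule C1_rect_reflect[OF r(3)])
      (use r(4) in simp)
  moreover have "\<theta> t (1 - 0) = 0 \<and> \<theta> t (1 - 1) = 0" if "t \<in> {0..T}" for t
    using assms that by (simp add: adjoint_solution_def)
  moreover have "\<theta> T (1 - x) = 0 \<and> \<theta>t T (1 - x) = 0" if "x \<in> {0..1}" for x
    using assms that by (simp add: adjoint_solution_def)
  ultimately show ?thesis
    unfolding adjoint_solution_def by blast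
qed

lemma controlled_reflect:
  assumes "controlled T g r v0 v1 e"
  shows "controlled T (\<lambda>t. 1 - g t) r (\<lambda>x. v0 (1 - x)) (\<lambda>x. v1 (1 - x)) e"
proof -
  obtain f \<theta> \<theta>t where
    *: "adjoint_solution T f \<theta> \<theta>t" "\<And>x. x \<in> {0..1} \<Longrightarrow> \<theta> 0 x = v0 x \<and> \<theta>t 0 x = v1 x"
      "\<And>x. x \<notin> {0..1} \<Longrightarrow> \<theta> 0 x = 0"
      "\<And>x t. x \<in> {0..1} \<Longrightarrow> t \<in> {0..T} \<Longrightarrow> f t x \<noteq> 0 \<Longrightarrow> t \<le> 2 \<and> \<bar>x - g t\<bar> \<le> r"
      "\<And>x. x \<in> {0..1} \<Longrightarrow> integral {0..T} (\<lambda>t. (f t x)\<^sup>2) \<le> e"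
    using assms unfolding controlled_def by blast
  have "t \<le> 2 \<and> \<bar>x - (1 - g t)\<bar> \<le> r" if "x \<in> {0..1}" "t \<in> {0..T}" "f t (1 - x) \<noteq> 0" for x t
    using *(4)[of "1 - x" t] that abs_minus_commute[of "1 - x" "g t"] by (simp add: algebra_simps)
  note supp = this
  show ?thesis
    unfolding controlled_def
  proof (intro exI conjI)
    show "adjoint_solution T (\<lambda>t x. f t (1 - x)) (\<lambda>t x. \<theta> t (1 - x)) (\<lambda>t x. \<theta>t t (1 - x))"
      by (rule adjoint_solution_reflect[OF *(1)])
    show "\<forall>x\<in>{0..1}. \<theta> 0 (1 - x) = v0 (1 - x) \<and> \<theta>t 0 (1 - x) = v1 (1 - x)"
      using *(2) by simp
    show "\<forall>x. x \<notin> {0..1} \<longrightarrow> \<theta> 0 (1 - x) = 0"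
      by (intro allI impI *(3)) auto
    show "\<forall>x\<in>{0..1}. \<forall>t\<in>{0..T}. f t (1 - x) \<noteq> 0 \<longrightarrow> t \<le> 2 \<and> \<bar>x - (1 - g t)\<bar> \<le> r"
      using supp by blast
    show "\<forall>x\<in>{0..1}. integral {0..T} (\<lambda>t. (f t (1 - x))\<^sup>2) \<le> e"
      using *(5) by simp
  qed
qed

text \<open>\<open>\<tau> = - 1\<close> means data (\<open>U\<close>, 0) and
  \<open>\<tau> = 1\<close> means data (0, \<open>u\<close>), so one statement covers both
  components of the norm. The predicate \<open>S\<close> lets the ordered and the general case share
  this form. The radius \<open>5 / 8 * \<delta>\<close> is \<open>\<delta> / 2\<close> for the tilt
  plus \<open>\<delta> / 8\<close> for the cutoff.\<close>

definition control_cost :: "real \<Rightarrow> real \<Rightarrow> ((real \<Rightarrow> real) \<Rightarrow> bool) \<Rightarrow> real \<Rightarrow> bool" where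
  "control_cost \<delta> L S C \<longleftrightarrow> 0 \<le> C \<and> (\<forall>T g g' g'' u U \<tau>. 2 \<le> T \<longrightarrow> C2_curve \<delta> L g g' g'' \<longrightarrow> S g \<longrightarrow>
    u \<in> test_functions Omega \<longrightarrow> (\<forall>x. (U has_real_derivative u x) (at x)) \<longrightarrow> (\<forall>x\<le>0. U x = 0) \<longrightarrow>
    (\<tau> = 1 \<or> \<tau> = - 1) \<longrightarrow> \<tau> * U 1 = U 1 \<longrightarrow>
    controlled T g (5 / 8 * \<delta>) (\<lambda>x. (1 - \<tau>) / 2 * U x) (\<lambda>x. (1 + \<tau>) / 2 * u x)
      (C * integral {0..1} (\<lambda>x. (u x)\<^sup>2)))"

lemma control_costD:
  assumes "control_cost \<delta> L S C" "2 \<le> T" "C2_curve \<delta> L g g' g''" "S g" "u \<in> test_functions Omega"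
    "\<And>x. (U has_real_derivative u x) (at x)" "\<And>x. x \<le> 0 \<Longrightarrow> U x = 0" "\<tau> = 1 \<or> \<tau> = - 1" "\<tau> * U 1 = U 1"
  shows "controlled T g (5 / 8 * \<delta>) (\<lambda>x. (1 - \<tau>) / 2 * U x) (\<lambda>x. (1 + \<tau>) / 2 * u x)
      (C * integral {0..1} (\<lambda>x. (u x)\<^sup>2))"
proof -
  note * = conjunct2[OF assms(1)[unfolded control_cost_def], rule_format]
  show ?thesis
    by (rule *[of T g g' g'' u U \<tau>]) (blast intro: assms(1-7) | rule assms(8,9))+
qed

lemma ex_control_ordered:
  fixes \<delta> L :: real
  assumes "0 < \<delta>" "0 \<le> L"
  shows "\<exists>C. control_cost \<delta> L (\<lambda>g. g 0 \<le> g 2) C"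
proof -
  obtain N \<sigma> \<sigma>' \<sigma>'' where step: "C2_step N \<sigma> \<sigma>' \<sigma>''"
    using ex_C2_step by blast
  \<comment> \<open>After the tilt the curve starts at \<open>g 0 - \<delta> / 2\<close> and is at
    \<open>g 2 + \<delta> / 2\<close> at time 2. With \<open>A = g 0 - \<delta> / 4\<close> the
    choices leave room at both ends: \<open>k 0 + w\<close> is
    \<open>g 0 - 3 / 8 * \<delta>\<close>, at most \<open>A\<close>, and
    \<open>A + \<rho> = g 0 + \<delta> / 4\<close> is at most
    \<open>k 2 - w = g 2 + 3 / 8 * \<delta>\<close>. \<open>B\<close> allows for the slope of the
    tilt.\<close>
  define w \<rho> B where "w = \<delta> / 8" and "\<rho> = \<delta> / 2" and "B = L + \<delta> / 2"
  define a where "a = 2 * (B + 1) * (N / (2 * w))"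
  define b where "b = a * (2 * N / \<rho>) + (B\<^sup>2 + 1) * (N / (2 * w)\<^sup>2) + B * (N / (2 * w))"
  show ?thesis
    unfolding control_cost_def
  proof (intro exI[of _ "(2 * a\<^sup>2 + 4 * b\<^sup>2) * 5"] conjI allI impI)
    show "0 \<le> (2 * a\<^sup>2 + 4 * b\<^sup>2) * 5"
      by simp
    fix T :: real and g g' g'' u U :: "real \<Rightarrow> real" and \<tau> :: real
    assume "2 \<le> T" and g: "C2_curve \<delta> L g g' g''" and g02: "g 0 \<le> g 2"
      and u: "u \<in> test_functions Omega" and U_all: "\<forall>x. (U has_real_derivative u x) (at x)"
      "\<forall>x\<le>0. U x = 0" and \<tau>: "\<tau> = 1 \<or> \<tau> = - 1" "\<tau> * U 1 = U 1"
    note U = U_all[rule_format]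
    have g': "\<And>t. (g has_real_derivative g' t) (at t)" "\<And>t. (g' has_real_derivative g'' t) (at t)"
      "continuous_on UNIV g''" "\<And>t. \<delta> \<le> g t" "\<And>t. g t \<le> 1 - \<delta>" "\<And>t. 2 \<le> t \<Longrightarrow> g t = g 2"
      "\<And>t. \<bar>g' t\<bar> \<le> L" "\<And>t. \<bar>g'' t\<bar> \<le> L"
      using g unfolding C2_curve_def by blast+
    obtain G G' G'' where G:
      "\<And>s. (G has_real_derivative G' s) (at s)" "\<And>s. (G' has_real_derivative G'' s) (at s)"
      "continuous_on UNIV G''"
      "\<And>x. x \<in> {0..1} \<Longrightarrow> G (x + 2) = G x" "\<And>x. x \<in> {0..1} \<Longrightarrow> G' (x + 2) = G' x"
      "\<And>x. x \<in> {0..1} \<Longrightarrow> G x - G (2 - x) = (1 - \<tau>) / 2 * U x"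
      "\<And>x. x \<in> {0..1} \<Longrightarrow> G' x - G' (2 - x) = (1 + \<tau>) / 2 * u x"
      "\<And>s. (G s)\<^sup>2 \<le> 5 * integral {0..1} (\<lambda>x. (u x)\<^sup>2)"
      "integral {0..3} (\<lambda>s. (G' s)\<^sup>2) \<le> 5 * integral {0..1} (\<lambda>x. (u x)\<^sup>2)"
      using reflected_extension[OF u U \<tau>] by blast
    \<comment> \<open>The tilt gives \<open>k 2 \<ge> k 0 + \<delta>\<close>, which leaves room for the cutoffs of widths \<open>\<rho>\<close> and \<open>w\<close>.\<close>
    define k where "k t = g t + \<delta> / 2 * (t - 1)" for t
    define k' where "k' t = g' t + \<delta> / 2" for t
    have dk: "(k has_real_derivative k' t) (at t)" "(k' has_real_derivative g'' t) (at t)" for t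
      unfolding k_def k'_def by (auto intro!: derivative_eq_intros g'(1,2))
    have k_near: "\<bar>k t - g t\<bar> \<le> \<delta> / 2" if "0 \<le> t" "t \<le> 2" for t
    proof -
      have "\<delta> / 2 * \<bar>t - 1\<bar> \<le> \<delta> / 2 * 1"
        using that \<open>0 < \<delta>\<close> by (intro mult_left_mono) auto
      then show ?thesis
        using \<open>0 < \<delta>\<close> by (simp add: k_def abs_mult)
    qed
    have "controlled T k w (\<lambda>x. G x - G (2 - x)) (\<lambda>x. G' x - G' (2 - x))
        ((2 * a\<^sup>2 + 4 * b\<^sup>2) * (5 * integral {0..1} (\<lambda>x. (u x)\<^sup>2)))"
    proof (rule control[where A = "g 0 - \<delta> / 4" and B = B and \<rho> = \<rho> and k' = k',
          OF step _ _ _ _ \<open>2 \<le> T\<close> _ G(1-3) _ _ dk g'(3) _ _ _ _ _ _ _ G(9) a_def b_def])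
      show "G (x + 2) = G x" "G' (x + 2) = G' x" if "x \<in> {0..1}" for x
        using G(4,5)[OF that] .
      show "(G s)\<^sup>2 \<le> 5 * integral {0..1} (\<lambda>x. (u x)\<^sup>2)" for s
        by (rule G(8))
      show "0 < \<rho>" "0 < w" "0 \<le> B"
        using assms by (auto simp: \<rho>_def w_def B_def)
      show "0 \<le> g 0 - \<delta> / 4" "g 0 - \<delta> / 4 + \<rho> \<le> 1" "k 0 + w \<le> g 0 - \<delta> / 4"
        using g'(4,5)[of 0] \<open>0 < \<delta>\<close> by (auto simp: \<rho>_def w_def k_def)
      \<comment> \<open>The condition concerns all times after 2; it persists because
        \<open>g\<close> is frozen there and the tilt keeps growing.\<close>
      show "g 0 - \<delta> / 4 + \<rho> \<le> k t - w" if "2 \<le> t" for t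
      proof -
        have "\<delta> / 2 * 1 \<le> \<delta> / 2 * (t - 1)"
          using that \<open>0 < \<delta>\<close> by (intro mult_left_mono) auto
        then show ?thesis
          unfolding k_def \<rho>_def w_def using g'(6)[OF that] g02 \<open>0 < \<delta>\<close> by linarith
      qed
      have kt: "w \<le> k t" "k t \<le> 1 - w" "\<bar>k' t\<bar> \<le> B" "\<bar>g'' t\<bar> \<le> B" if "0 \<le> t" "t \<le> 2" for t
        unfolding w_def B_def k'_def
        using k_near[OF that] g'(4,5,7,8)[of t] \<open>0 < \<delta>\<close> by linarith+
      show "w \<le> k t" if "0 \<le> t" "t \<le> 2" for t
        using kt(1)[OF that] .
      show "k t \<le> 1 - w" if "0 \<le> t" "t \<le> 2" for t
        using kt(2)[OF that] .
      show "\<bar>k' t\<bar> \<le> B" if "0 \<le> t" "t \<le> 2" for t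
        using kt(3)[OF that] .
      show "\<bar>g'' t\<bar> \<le> B" if "0 \<le> t" "t \<le> 2" for t
        using kt(4)[OF that] .
    qed
    then obtain f \<theta> \<theta>t where f: "adjoint_solution T f \<theta> \<theta>t"
      "\<forall>x\<in>{0..1}. \<theta> 0 x = G x - G (2 - x) \<and> \<theta>t 0 x = G' x - G' (2 - x)"
      "\<forall>x. x \<notin> {0..1} \<longrightarrow> \<theta> 0 x = 0"
      "\<forall>x\<in>{0..1}. \<forall>t\<in>{0..T}. f t x \<noteq> 0 \<longrightarrow> t \<le> 2 \<and> \<bar>x - k t\<bar> \<le> w"
      "\<forall>x\<in>{0..1}. integral {0..T} (\<lambda>t. (f t x)\<^sup>2) \<le>
        (2 * a\<^sup>2 + 4 * b\<^sup>2) * (5 * integral {0..1} (\<lambda>x. (u x)\<^sup>2))"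
      unfolding controlled_def by blast
    have "t \<le> 2 \<and> \<bar>x - g t\<bar> \<le> 5 / 8 * \<delta>" if "x \<in> {0..1}" "t \<in> {0..T}" "f t x \<noteq> 0" for x t
    proof -
      have "t \<le> 2" "\<bar>x - k t\<bar> \<le> \<delta> / 8"
        using f(4) that unfolding w_def by blast+
      moreover have "\<bar>k t - g t\<bar> \<le> \<delta> / 2"
        using k_near that(2) \<open>t \<le> 2\<close> by simp
      ultimately show ?thesis
        by linarith
    qed
    note supp = this
    show "controlled T g (5 / 8 * \<delta>) (\<lambda>x. (1 - \<tau>) / 2 * U x) (\<lambda>x. (1 + \<tau>) / 2 * u x)
      ((2 * a\<^sup>2 + 4 * b\<^sup>2) * 5 * integral {0..1} (\<lambda>x. (u x)\<^sup>2))"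
      unfolding controlled_def
    proof (intro exI conjI)
      show "adjoint_solution T f \<theta> \<theta>t"
        by (rule f)
      show "\<forall>x\<in>{0..1}. \<theta> 0 x = (1 - \<tau>) / 2 * U x \<and> \<theta>t 0 x = (1 + \<tau>) / 2 * u x"
        using f(2) G(6,7) by metis
      show "\<forall>x. x \<notin> {0..1} \<longrightarrow> \<theta> 0 x = 0"
        by (rule f)
      show "\<forall>x\<in>{0..1}. \<forall>t\<in>{0..T}. f t x \<noteq> 0 \<longrightarrow> t \<le> 2 \<and> \<bar>x - g t\<bar> \<le> 5 / 8 * \<delta>"
        using supp by blast
      show "\<forall>x\<in>{0..1}. integral {0..T} (\<lambda>t. (f t x)\<^sup>2) \<le> (2 * a\<^sup>2 + 4 * b\<^sup>2) * 5 * integral {0..1} (\<lambda>x. (u x)\<^sup>2)"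
        using f(5) by (simp only: mult.assoc)
    qed
  qed
qed

lemma ex_control:
  fixes \<delta> L :: real
  assumes "0 < \<delta>" "0 \<le> L"
  shows "\<exists>C. control_cost \<delta> L (\<lambda>g. True) C"
proof -
  obtain C where C: "control_cost \<delta> L (\<lambda>g. g 0 \<le> g 2) C"
    using ex_control_ordered[OF assms] by blast
  have "0 \<le> C"
    using C by (simp add: control_cost_def)
  show ?thesis
    unfolding control_cost_def
  proof (intro exI[of _ C] conjI allI impI \<open>0 \<le> C\<close>)
    fix T :: real and g g' g'' u U :: "real \<Rightarrow> real" and \<tau> :: real
    assume "2 \<le> T" and g: "C2_curve \<delta> L g g' g''" and True
      and u: "u \<in> test_functions Omega" and U_all: "\<forall>x. (U has_real_derivative u x) (at x)"
      "\<forall>x\<le>0. U x = 0" and \<tau>: "\<tau> = 1 \<or> \<tau> = - 1" "\<tau> * U 1 = U 1"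
    note U = U_all[rule_format]
    show "controlled T g (5 / 8 * \<delta>) (\<lambda>x. (1 - \<tau>) / 2 * U x) (\<lambda>x. (1 + \<tau>) / 2 * u x)
      (C * integral {0..1} (\<lambda>x. (u x)\<^sup>2))"
    proof (cases "g 0 \<le> g 2")
      case True
      then show ?thesis
        using control_costD[OF C \<open>2 \<le> T\<close> g _ u U \<tau>] by blast
    next
      case False
      obtain K where K: "smooth u" "compact K" "K \<subseteq> Omega" "\<And>x. x \<notin> K \<Longrightarrow> u x = 0"
        using u by (auto simp: test_functions_iff)
      \<comment> \<open>The primitive of the reflected \<open>u\<close> that vanishes to the left of
        0 is \<open>U 1 - U (1 - x)\<close>. The factor \<tau> repairs the sign: for
        \<open>\<tau> = - 1\<close>, where \<open>U 1 = 0\<close>, it makes \<open>Ur\<close> the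
        reflection of \<open>U\<close>, and for \<open>\<tau> = 1\<close> it leaves
        \<open>ur\<close> the reflection of \<open>u\<close>.\<close>
      define ur where "ur x = \<tau> * u ((-1) * x + 1)" for x
      define Ur where "Ur x = \<tau> * (U 1 - U ((-1) * x + 1))" for x
      have gr: "C2_curve \<delta> L (\<lambda>t. 1 - g t) (\<lambda>t. - g' t) (\<lambda>t. - g'' t)"
      proof -
        have g1: "\<forall>t. (g has_real_derivative g' t) (at t)" "\<forall>t. (g' has_real_derivative g'' t) (at t)"
          "continuous_on UNIV g''" "\<forall>t. \<delta> \<le> g t \<and> g t \<le> 1 - \<delta>" "\<forall>t\<ge>2. g t = g 2"
          "\<forall>t. \<bar>g' t\<bar> \<le> L" "\<forall>t. \<bar>g'' t\<bar> \<le> L"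
          using g unfolding C2_curve_def by blast+
        have "((\<lambda>t. 1 - g t) has_real_derivative - g' t) (at t)" for t
          using g1(1) by (auto intro!: derivative_eq_intros)
        moreover have "((\<lambda>t. - g' t) has_real_derivative - g'' t) (at t)" for t
          using g1(2) by (auto intro!: derivative_eq_intros)
        moreover have "\<delta> \<le> 1 - g t \<and> 1 - g t \<le> 1 - \<delta>" for t
          using g1(4)[rule_format, of t] by linarith
        moreover have "\<forall>t\<ge>2. 1 - g t = 1 - g 2"
          using g1(5) by (metis order_refl)
        ultimately show ?thesis
          using continuous_on_minus[OF g1(3)] g1(6,7) unfolding C2_curve_def abs_minus_cancel by blast
      qed
      have ur_test: "ur \<in> test_functions Omega"
      proof -
        have "compact ((\<lambda>x. 1 - x) ` K)"
          using K(2) by (intro compact_continuous_image continuous_intros)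
        moreover have "(\<lambda>x. 1 - x) ` K \<subseteq> Omega"
          using K(3) by (auto simp: Omega_def)
        moreover have "ur x = 0" if "x \<notin> (\<lambda>x. 1 - x) ` K" for x
        proof -
          have "1 - x \<notin> K"
            using that by (auto simp: image_iff)
          then show ?thesis
            using K(4)[of "1 - x"] by (simp add: ur_def)
        qed
        moreover have "smooth ur"
          unfolding ur_def by (rule smooth_cmult[OF smooth_affine[OF K(1)]])
        ultimately show ?thesis
          unfolding test_functions_iff by blast
      qed
      have dUr: "(Ur has_real_derivative ur x) (at x)" for x
        unfolding Ur_def ur_def
        by (auto intro!: derivative_eq_intros DERIV_chain_eq[OF U(1)])
      have U1: "U x = U 1" if x1: "1 \<le> x" for x
      proof (cases "x = 1")
        case False
        then obtain z where "1 < z" "U x - U 1 = (x - 1) * u z"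
          using MVT2[of 1 x U u] U x1 by auto
        then show ?thesis
          using test_function_at_boundary[OF u, of z] by simp
      qed simp
      have Ur0: "Ur x = 0" if "x \<le> 0" for x
        using U1[of "1 - x"] that by (simp add: Ur_def)
      have "\<tau> * Ur 1 = Ur 1"
        using \<tau> U(2)[of 0] by (auto simp: Ur_def)
      from control_costD[OF C \<open>2 \<le> T\<close> gr _ ur_test dUr Ur0 \<tau>(1) this]
      have "controlled T (\<lambda>t. 1 - g t) (5 / 8 * \<delta>) (\<lambda>x. (1 - \<tau>) / 2 * Ur x) (\<lambda>x. (1 + \<tau>) / 2 * ur x)
          (C * integral {0..1} (\<lambda>x. (ur x)\<^sup>2))"
        using False by simp
      from controlled_reflect[OF this]
      have "controlled T g (5 / 8 * \<delta>) (\<lambda>x. (1 - \<tau>) / 2 * Ur (1 - x)) (\<lambda>x. (1 + \<tau>) / 2 * ur (1 - x))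
          (C * integral {0..1} (\<lambda>x. (ur x)\<^sup>2))"
        by simp
      moreover have "(1 - \<tau>) / 2 * Ur (1 - x) = (1 - \<tau>) / 2 * U x" for x
        using \<tau> by (auto simp: Ur_def)
      moreover have "(1 + \<tau>) / 2 * ur (1 - x) = (1 + \<tau>) / 2 * u x" for x
        using \<tau>(1) by (auto simp: ur_def)
      moreover have "integral {0..1} (\<lambda>x. (ur x)\<^sup>2) = integral {0..1} (\<lambda>x. (u x)\<^sup>2)"
      proof -
        have "(ur x)\<^sup>2 = (u (1 - x))\<^sup>2" for x
          using \<tau>(1) by (auto simp: ur_def)
        then have "integral {0..1} (\<lambda>x. (ur x)\<^sup>2) = integral {0..1} (\<lambda>x. (u (1 - x))\<^sup>2)"
          by simp
        also have "\<dots> = integral {-1..-0} (\<lambda>x. (u (1 - (- x)))\<^sup>2)"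
          by (rule Henstock_Kurzweil_Integration.integral_reflect_real[symmetric])
        also have "\<dots> = integral {0..1} (\<lambda>x. (u x)\<^sup>2)"
          using integral_shift_Icc_real[of "-1" 0 "\<lambda>t. (u t)\<^sup>2" 1] by (simp add: o_def)
        finally show ?thesis .
      qed
      ultimately show ?thesis
        by (simp only:)
    qed
  qed
qed

section \<open>Duality\<close>

text \<open>The discriminant argument behind Cauchy-Schwarz: \<open>c = X / F\<close> is optimal,
  and for \<open>F = 0\<close> a large multiple of the sign of \<open>X\<close> rules out
  \<open>X \<noteq> 0\<close>.\<close>

lemma sq_le_mult_if_quadratic:
  fixes X P F :: real
  assumes "0 \<le> P" "0 \<le> F" and le: "\<And>c. 2 * c * X \<le> P + c\<^sup>2 * F"
  shows "X\<^sup>2 \<le> P * F"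
proof (cases "F = 0")
  case True
  have "X = 0"
  proof (rule ccontr)
    assume "X \<noteq> 0"
    then show False
      using le[of "(P + 1) / (2 * X)"] True by simp
  qed
  then show ?thesis
    using assms by simp
next
  case False
  then have "0 < F"
    using assms by simp
  then show ?thesis
    using le[of "X / F"] by (simp add: power2_eq_square field_simps)
qed

lemma AE_snd_lebesgue:
  assumes "AE t in (lebesgue :: real measure). P t"
  shows "AE p in (lebesgue :: (real \<times> real) measure). P (snd p)"
proof -
  have "AE t in lborel. P t"
    using assms by (simp add: AE_completion_iff)
  then obtain N where N: "{t. \<not> P t} \<subseteq> N" "N \<in> null_sets lborel"
    by (auto elim!: AE_E simp: null_sets_def)
  have "UNIV \<times> N \<in> null_sets (lborel \<Otimes>\<^sub>M (lborel :: real measure))"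
    using N(2) by (intro lborel.times_in_null_sets2) auto
  then have "(UNIV :: real set) \<times> N \<in> null_sets lborel"
    by (simp add: lborel_prod)
  then have "AE p in lborel. p \<notin> (UNIV :: real set) \<times> N"
    by (rule AE_not_in)
  then have "AE p in lborel. P (snd (p :: real \<times> real))"
    by eventually_elim (use N(1) in auto)
  then show ?thesis
    by (rule AE_completion)
qed

text \<open>The domain belonging to a continuous representative is open, and it differs from
  \<open>q \<delta> T \<gamma>\<close> by a null set, which is harmless for a complete
  measure.\<close>

lemma q_measurable:
  assumes "continuous_on UNIV G" "AE t in lebesgue. t \<in> {0<..<T} \<longrightarrow> \<gamma> t = G t"
  shows "q \<delta> T \<gamma> \<in> sets lebesgue"
proof (rule completion.in_sets_AE)
  have "open (q \<delta> T G)"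
  proof -
    have "q \<delta> T G = (Omega \<times> {0<..<T}) \<inter> {p. \<bar>fst p - G (snd p)\<bar> < \<delta>}"
      by (auto simp: q_def Q_def)
    moreover have "open {p. \<bar>fst p - G (snd p)\<bar> < \<delta>}"
      by (intro open_Collect_less continuous_intros continuous_on_compose2[OF assms(1)]) auto
    ultimately show ?thesis
      by (auto simp: Omega_def intro!: open_Int open_Times)
  qed
  then show "q \<delta> T G \<in> sets lebesgue"
    by simp
  show "AE p in lebesgue. p \<in> q \<delta> T G \<longleftrightarrow> p \<in> q \<delta> T \<gamma>"
    using AE_snd_lebesgue[OF assms(2)] by eventually_elim (auto simp: q_def Q_def)
qed auto

text \<open>The transposition identity equates the left side with the pairing of \<phi> with the
  source; the source vanishes almost everywhere outside \<open>q \<delta> T \<gamma>\<close>, so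
  Cauchy-Schwarz involves \<phi> on that set only.\<close>

lemma duality_bound:
  assumes trans: "transposition_solution T \<phi>0 \<phi>1 \<phi>"
    and ctl: "controlled T g r v0 v1 e" and v0: "\<And>x. x \<notin> {0..1} \<Longrightarrow> v0 x = 0"
    and q: "q \<delta> T \<gamma> \<in> sets lebesgue"
    and near: "AE t in lebesgue. t \<in> {0<..<T} \<longrightarrow> t \<le> 2 \<longrightarrow> (\<forall>x. \<bar>x - g t\<bar> \<le> r \<longrightarrow> \<bar>x - \<gamma> t\<bar> < \<delta>)"
  shows "(\<phi>1 v0 - set_lebesgue_integral lebesgue Omega (\<lambda>x. \<phi>0 x * v1 x))\<^sup>2 \<le>
    (L2_norm_on (q \<delta> T \<gamma>) (\<lambda>(x, t). \<phi> t x))\<^sup>2 * e"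
proof -
  obtain f \<theta> \<theta>t where f: "adjoint_solution T f \<theta> \<theta>t"
    "\<forall>x\<in>{0..1}. \<theta> 0 x = v0 x \<and> \<theta>t 0 x = v1 x" "\<forall>x. x \<notin> {0..1} \<longrightarrow> \<theta> 0 x = 0"
    "\<forall>x\<in>{0..1}. \<forall>t\<in>{0..T}. f t x \<noteq> 0 \<longrightarrow> t \<le> 2 \<and> \<bar>x - g t\<bar> \<le> r"
    "\<forall>x\<in>{0..1}. integral {0..T} (\<lambda>t. (f t x)\<^sup>2) \<le> e"
    using ctl unfolding controlled_def by blast
  let ?R = "{0..1::real} \<times> {0..T}"
  let ?q = "q \<delta> T \<gamma>"
  define F where "F p = f (snd p) (fst p)" for p :: "real \<times> real"
  define \<Phi> where "\<Phi> p = \<phi> (snd p) (fst p)" for p :: "real \<times> real"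
  have R: "?R = cbox (0, 0) (1, T)"
    by (simp add: cbox_Pair_eq)
  have QR: "Q T \<subseteq> ?R"
    by (auto simp: Q_def Omega_def)
  have Qm: "Q T \<in> sets lebesgue"
    by (simp add: Q_def Omega_def open_Times)
  have qQ: "?q \<subseteq> Q T"
    by (auto simp: q_def)
  have cF: "continuous_on ?R F"
  proof -
    obtain \<theta>x \<theta>xx \<theta>xt \<theta>tx \<theta>tt where
      r: "C1_rect T \<theta>x \<theta>xx \<theta>xt" "C1_rect T \<theta>t \<theta>tx \<theta>tt"
        "\<forall>x\<in>{0..1}. \<forall>t\<in>{0..T}. \<theta>tt t x - \<theta>xx t x = f t x"
      using f(1) by (auto simp: adjoint_solution_def)
    then have "continuous_on ?R (\<lambda>p. \<theta>tt (snd p) (fst p) - \<theta>xx (snd p) (fst p))"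
      by (intro continuous_on_diff) (auto simp: C1_rect_def case_prod_beta)
    then show ?thesis
      by (rule continuous_on_eq) (use r(3) in \<open>auto simp: F_def\<close>)
  qed
  have F2_int: "set_integrable lebesgue (Q T) (\<lambda>p. (F p)\<^sup>2)" "set_integrable lebesgue (Q T) F"
    by (rule set_integrable_subset[OF _ Qm QR],
        simp only: R, intro absolutely_integrable_continuous continuous_on_power,
        use cF in \<open>simp only: R\<close>)+
  \<comment> \<open>Fubini turns the bound on each line of constant \<open>x\<close> into a bound
    over the rectangle, whose width is 1.\<close>
  have F2_le: "set_lebesgue_integral lebesgue (Q T) (\<lambda>p. (F p)\<^sup>2) \<le> e"
  proof -
    have c2: "continuous_on (cbox (0, 0) (1, T)) (\<lambda>p. (F p)\<^sup>2)"
      using cF by (intro continuous_on_power) (simp only: R)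
    have "set_lebesgue_integral lebesgue (Q T) (\<lambda>p. (F p)\<^sup>2) \<le> set_lebesgue_integral lebesgue ?R (\<lambda>p. (F p)\<^sup>2)"
      unfolding set_lebesgue_integral_def
      using F2_int(1) absolutely_integrable_continuous[OF c2] QR
      by (intro integral_mono) (auto simp: set_integrable_def R[symmetric] indicator_def)
    also have "\<dots> = integral (cbox (0, 0) (1, T)) (\<lambda>p. (F p)\<^sup>2)"
      unfolding R by (rule set_lebesgue_integral_eq_integral(2)[OF absolutely_integrable_continuous[OF c2]])
    also have "\<dots> = integral (cbox 0 1) (\<lambda>x. integral (cbox 0 T) (\<lambda>t. (F (x, t))\<^sup>2))"
      by (rule integral_prod_continuous[OF c2])
    also have "\<dots> \<le> integral (cbox 0 1) (\<lambda>x::real. e)"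
    proof (rule integral_le)
      show "(\<lambda>x. integral (cbox 0 T) (\<lambda>t. (F (x, t))\<^sup>2)) integrable_on cbox 0 1"
        using integral_integrable_2dim[OF c2] by simp
    qed (use f(5) in \<open>auto simp: F_def\<close>)
    finally show ?thesis
      by simp
  qed
  have \<Phi>_eq: "\<Phi> = (\<lambda>(x, t). \<phi> t x)"
    by (auto simp: \<Phi>_def)
  have "\<Phi> \<in> L2_on (Q T)"
    using trans by (simp add: transposition_solution_def \<Phi>_eq)
  then have \<Phi>: "set_borel_measurable lebesgue (Q T) \<Phi>" "set_integrable lebesgue (Q T) (\<lambda>p. (\<Phi> p)\<^sup>2)"
    by (auto simp: L2_on_def)
  have \<Phi>2q: "set_integrable lebesgue ?q (\<lambda>p. (\<Phi> p)\<^sup>2)"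
    by (rule set_integrable_subset[OF \<Phi>(2) q qQ])
  define X where "X = set_lebesgue_integral lebesgue (Q T) (\<lambda>p. \<Phi> p * F p)"
  have \<Phi>F: "set_integrable lebesgue (Q T) (\<lambda>p. \<Phi> p * F p)"
    unfolding set_integrable_def
  proof (rule Bochner_Integration.integrable_bound)
    show "integrable lebesgue (\<lambda>p. indicator (Q T) p *\<^sub>R (\<Phi> p)\<^sup>2 + indicator (Q T) p *\<^sub>R (F p)\<^sup>2)"
      using \<Phi>(2) F2_int(1) by (simp add: set_integrable_def)
    have "(\<lambda>p. (indicator (Q T) p *\<^sub>R \<Phi> p) * (indicator (Q T) p *\<^sub>R F p)) \<in> borel_measurable lebesgue"
      using \<Phi>(1) F2_int(2) unfolding set_borel_measurable_def set_integrable_def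
      by (intro borel_measurable_times) (auto dest: borel_measurable_integrable)
    moreover have "(indicator (Q T) p *\<^sub>R \<Phi> p) * (indicator (Q T) p *\<^sub>R F p) = indicator (Q T) p *\<^sub>R (\<Phi> p * F p)" for p
      by (simp add: indicator_def)
    ultimately show "(\<lambda>p. indicator (Q T) p *\<^sub>R (\<Phi> p * F p)) \<in> borel_measurable lebesgue"
      by (simp only:)
    show "AE p in lebesgue. norm (indicator (Q T) p *\<^sub>R (\<Phi> p * F p)) \<le>
        norm (indicator (Q T) p *\<^sub>R (\<Phi> p)\<^sup>2 + indicator (Q T) p *\<^sub>R (F p)\<^sup>2)"
    proof (rule AE_I2)
      fix p
      have "2 * \<bar>\<Phi> p\<bar> * \<bar>F p\<bar> \<le> \<bar>\<Phi> p\<bar>\<^sup>2 + \<bar>F p\<bar>\<^sup>2"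
        by (rule sum_squares_bound)
      moreover have "0 \<le> \<bar>\<Phi> p\<bar> * \<bar>F p\<bar>"
        by simp
      ultimately have "\<bar>\<Phi> p * F p\<bar> \<le> (\<Phi> p)\<^sup>2 + (F p)\<^sup>2"
        unfolding abs_mult power2_abs by linarith
      then show "norm (indicator (Q T) p *\<^sub>R (\<Phi> p * F p)) \<le>
          norm (indicator (Q T) p *\<^sub>R (\<Phi> p)\<^sup>2 + indicator (Q T) p *\<^sub>R (F p)\<^sup>2)"
        by (simp add: indicator_def)
    qed
  qed
  have supp: "AE p in lebesgue. p \<in> Q T \<longrightarrow> F p \<noteq> 0 \<longrightarrow> p \<in> ?q"
    using AE_snd_lebesgue[OF near]
  proof eventually_elim
    case (elim p)
    show ?case
    proof (intro impI)
      assume p: "p \<in> Q T" "F p \<noteq> 0"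
      then have "fst p \<in> {0..1}" "snd p \<in> {0..T}" "snd p \<in> {0<..<T}"
        by (auto simp: Q_def Omega_def)
      with p f(4) have "snd p \<le> 2" "\<bar>fst p - g (snd p)\<bar> \<le> r"
        unfolding F_def by blast+
      with elim \<open>snd p \<in> {0<..<T}\<close> have "\<bar>fst p - \<gamma> (snd p)\<bar> < \<delta>"
        by blast
      with p(1) show "p \<in> ?q"
        by (auto simp: q_def case_prod_beta)
    qed
  qed
  \<comment> \<open>Young's inequality for \<open>\<Phi> p\<close> and \<open>c * F p\<close> is
    applied only where \<open>F\<close> is nonzero, hence almost everywhere inside
    \<open>?q\<close>; this localises the norm of the solution.\<close>
  have "2 * c * X \<le> set_lebesgue_integral lebesgue ?q (\<lambda>p. (\<Phi> p)\<^sup>2) +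
      c\<^sup>2 * set_lebesgue_integral lebesgue (Q T) (\<lambda>p. (F p)\<^sup>2)" for c
  proof -
    have "2 * c * X = (LINT p|lebesgue. 2 * c * (indicator (Q T) p *\<^sub>R (\<Phi> p * F p)))"
      by (simp add: X_def set_lebesgue_integral_def)
    also have "\<dots> \<le> (LINT p|lebesgue. indicator ?q p *\<^sub>R (\<Phi> p)\<^sup>2 + c\<^sup>2 * (indicator (Q T) p *\<^sub>R (F p)\<^sup>2))"
    proof (rule integral_mono_AE)
      show "integrable lebesgue (\<lambda>p. 2 * c * (indicator (Q T) p *\<^sub>R (\<Phi> p * F p)))"
        using \<Phi>F by (simp add: set_integrable_def)
      show "integrable lebesgue (\<lambda>p. indicator ?q p *\<^sub>R (\<Phi> p)\<^sup>2 + c\<^sup>2 * (indicator (Q T) p *\<^sub>R (F p)\<^sup>2))"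
        using \<Phi>2q F2_int(1) by (simp add: set_integrable_def)
      show "AE p in lebesgue. 2 * c * (indicator (Q T) p *\<^sub>R (\<Phi> p * F p)) \<le>
          indicator ?q p *\<^sub>R (\<Phi> p)\<^sup>2 + c\<^sup>2 * (indicator (Q T) p *\<^sub>R (F p)\<^sup>2)"
        using supp
      proof eventually_elim
        case (elim p)
        show ?case
        proof (cases "p \<in> Q T \<and> F p \<noteq> 0")
          case True
          then show ?thesis
            using elim sum_squares_bound[of "\<Phi> p" "c * F p"] by (simp add: power_mult_distrib mult_ac)
        next
          case False
          then have "2 * c * (indicator (Q T) p *\<^sub>R (\<Phi> p * F p)) = 0"
            by (auto simp: indicator_def)
          moreover have "0 \<le> indicator ?q p *\<^sub>R (\<Phi> p)\<^sup>2 + c\<^sup>2 * (indicator (Q T) p *\<^sub>R (F p)\<^sup>2)"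
            by (intro add_nonneg_nonneg mult_nonneg_nonneg scaleR_nonneg_nonneg) auto
          ultimately show ?thesis
            by linarith
        qed
      qed
    qed
    also have "\<dots> = set_lebesgue_integral lebesgue ?q (\<lambda>p. (\<Phi> p)\<^sup>2) +
        c\<^sup>2 * set_lebesgue_integral lebesgue (Q T) (\<lambda>p. (F p)\<^sup>2)"
      using \<Phi>2q F2_int(1) by (simp add: set_integrable_def set_lebesgue_integral_def)
    finally show ?thesis .
  qed
  moreover have nn: "0 \<le> set_lebesgue_integral lebesgue S (\<lambda>p. (h p)\<^sup>2)" for S and h :: "real \<times> real \<Rightarrow> real"
    unfolding set_lebesgue_integral_def by (intro integral_nonneg_AE) auto
  ultimately have "X\<^sup>2 \<le> set_lebesgue_integral lebesgue ?q (\<lambda>p. (\<Phi> p)\<^sup>2) *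
      set_lebesgue_integral lebesgue (Q T) (\<lambda>p. (F p)\<^sup>2)"
    by (intro sq_le_mult_if_quadratic)
  also have "\<dots> \<le> set_lebesgue_integral lebesgue ?q (\<lambda>p. (\<Phi> p)\<^sup>2) * e"
    by (intro mult_left_mono F2_le nn)
  also have "set_lebesgue_integral lebesgue ?q (\<lambda>p. (\<Phi> p)\<^sup>2) = (L2_norm_on ?q (\<lambda>(x, t). \<phi> t x))\<^sup>2"
    by (simp add: L2_norm_on_sq set_lebesgue_integral_real \<Phi>_def case_prod_beta)
  also have "X = \<phi>1 v0 - set_lebesgue_integral lebesgue Omega (\<lambda>x. \<phi>0 x * v1 x)"
  proof -
    have "X = set_lebesgue_integral lebesgue (Q T) (\<lambda>(x, t). \<phi> t x * f t x)"
      by (simp add: X_def \<Phi>_def F_def case_prod_unfold)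
    also have "\<dots> = \<phi>1 (\<theta> 0) - set_lebesgue_integral lebesgue Omega (\<lambda>x. \<phi>0 x * \<theta>t 0 x)"
      using trans f(1) unfolding transposition_solution_def by blast
    also have "\<theta> 0 = v0"
      using f(2,3) v0 by (intro ext) metis
    also have "set_lebesgue_integral lebesgue Omega (\<lambda>x. \<phi>0 x * \<theta>t 0 x) =
        set_lebesgue_integral lebesgue Omega (\<lambda>x. \<phi>0 x * v1 x)"
      using f(2) by (intro set_lebesgue_integral_cong) (auto simp: Omega_def)
    finally show ?thesis .
  qed
  finally show ?thesis .
qed

section \<open>From admissible curves to smooth ones\<close>

lemma G_ad_lipschitz:
  assumes \<gamma>: "\<gamma> \<in> G_ad \<delta> M T" and "0 < T" and "0 \<le> M"
  obtains G where "\<And>x y. \<bar>G x - G y\<bar> \<le> (M + 1) * \<bar>x - y\<bar>"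
    "AE t in lebesgue. t \<in> {0<..<T} \<longrightarrow> \<gamma> t = G t \<and> \<delta> \<le> \<gamma> t \<and> \<gamma> t \<le> 1 - \<delta>"
proof -
  obtain g where "has_weak_deriv_on {0<..<T} \<gamma> g"
    using \<gamma> by (auto simp: G_ad_def W1inf_on_def)
  then have w: "has_weak_deriv_on {0<..<T} \<gamma> (weak_deriv_on {0<..<T} \<gamma>)"
    by (rule has_weak_deriv_weak_deriv_on)
  have "AE t in lebesgue_on {0<..<T}. ereal \<bar>weak_deriv_on {0<..<T} \<gamma> t\<bar> \<le> ereal M"
    using esssup_AE
  proof (rule AE_mp)
    show "AE t in lebesgue_on {0<..<T}. ereal \<bar>weak_deriv_on {0<..<T} \<gamma> t\<bar> \<le>
        esssup (lebesgue_on {0<..<T}) (\<lambda>t. ereal \<bar>weak_deriv_on {0<..<T} \<gamma> t\<bar>) \<longrightarrow>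
        ereal \<bar>weak_deriv_on {0<..<T} \<gamma> t\<bar> \<le> ereal M"
      using \<gamma> by (intro AE_I2) (auto simp: G_ad_def Linf_norm_on_def simp del: ereal_less_eq intro: order_trans)
  qed
  then have "AE t in lebesgue. t \<in> {0<..<T} \<longrightarrow> \<bar>weak_deriv_on {0<..<T} \<gamma> t\<bar> \<le> M"
    by (simp add: AE_restrict_space_iff)
  then obtain G where G: "\<And>x y. \<bar>G x - G y\<bar> \<le> (M + 1) * \<bar>x - y\<bar>"
    "AE t in lebesgue. t \<in> {0<..<T} \<longrightarrow> \<gamma> t = G t"
    using bounded_weak_deriv_lipschitz[OF w \<open>0 < T\<close> \<open>0 \<le> M\<close>] by blast
  have "AE t in lebesgue_on {0<..<T}. \<delta> \<le> \<gamma> t \<and> \<gamma> t \<le> 1 - \<delta>"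
    using \<gamma> by (simp only: G_ad_def mem_Collect_eq)
  then have "AE t in lebesgue. t \<in> {0<..<T} \<longrightarrow> \<delta> \<le> \<gamma> t \<and> \<gamma> t \<le> 1 - \<delta>"
    by (subst (asm) AE_restrict_space_iff) simp_all
  with G(2) have "AE t in lebesgue. t \<in> {0<..<T} \<longrightarrow> \<gamma> t = G t \<and> \<delta> \<le> \<gamma> t \<and> \<gamma> t \<le> 1 - \<delta>"
    by eventually_elim blast
  with G(1) show ?thesis
    by (rule that)
qed

lemma AE_interval_ex:
  assumes "AE t in lebesgue. t \<in> {0<..<T::real} \<longrightarrow> P t" "0 < T"
  shows "\<exists>t\<in>{0<..<T}. P t"
proof (rule ccontr)
  assume "\<not> ?thesis"
  with assms(1) have "AE t in lebesgue. t \<notin> {0<..<T}"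
    by (auto elim: eventually_mono)
  then have "{0<..<T} \<in> null_sets lebesgue"
    by (subst AE_iff_null_sets) auto
  with \<open>0 < T\<close> show False
    by (simp add: null_sets_def)
qed

text \<open>The averages of the Lipschitz representative of \<open>\<gamma>\<close> over windows of length proportional to
  \<open>\<delta> / M\<close> stay close to \<open>\<gamma>\<close> and have derivatives bounded in terms of \<open>\<delta>\<close> and \<open>M\<close> only.\<close>

lemma G_ad_C2_curve:
  assumes \<gamma>: "\<gamma> \<in> G_ad \<delta> M T" and "2 \<le> T" and "0 \<le> M" and "0 < \<delta>"
    and h: "h = \<delta> / (16 * (M + 1))"
  obtains g g' g'' where "C2_curve \<delta> (1 / h + 2 / h\<^sup>2) g g' g''" "q \<delta> T \<gamma> \<in> sets lebesgue"
    "AE t in lebesgue. t \<in> {0<..<T} \<longrightarrow> t \<le> 2 \<longrightarrow>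
      (\<forall>x. \<bar>x - g t\<bar> \<le> 5 / 8 * \<delta> \<longrightarrow> \<bar>x - \<gamma> t\<bar> < \<delta>)"
proof -
  have "0 < T"
    using \<open>2 \<le> T\<close> by simp
  obtain G where G: "\<And>x y. \<bar>G x - G y\<bar> \<le> (M + 1) * \<bar>x - y\<bar>"
    "AE t in lebesgue. t \<in> {0<..<T} \<longrightarrow> \<gamma> t = G t \<and> \<delta> \<le> \<gamma> t \<and> \<gamma> t \<le> 1 - \<delta>"
    using G_ad_lipschitz[OF \<gamma> \<open>0 < T\<close> \<open>0 \<le> M\<close>] by blast
  \<comment> \<open>The existence of an admissible curve forces
    \<open>\<delta> \<le> 1 - \<delta>\<close>, without which the clamping below would be
    inconsistent.\<close>
  obtain t0 where "\<delta> \<le> \<gamma> t0" "\<gamma> t0 \<le> 1 - \<delta>"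
    using AE_interval_ex[OF G(2) \<open>0 < T\<close>] by blast
  then have \<delta>: "\<delta> \<le> 1 - \<delta>"
    by linarith
  \<comment> \<open>Clamping in space and freezing outside [0, 2] before averaging hands the range
    and the constancy after time 2 on to \<open>g\<close>. On [0, 2] the result still agrees with
    \<gamma> almost everywhere.\<close>
  define c where "c x = max \<delta> (min (1 - \<delta>) (G (max 0 (min 2 x))))" for x
  have c_range: "\<delta> \<le> c x" "c x \<le> 1 - \<delta>" for x
    using \<delta> by (auto simp: c_def)
  have c_lip: "\<bar>c x - c y\<bar> \<le> (M + 1) * \<bar>x - y\<bar>" for x y
  proof -
    have "\<bar>c x - c y\<bar> \<le> \<bar>G (max 0 (min 2 x)) - G (max 0 (min 2 y))\<bar>"
      unfolding c_def by (simp add: max_def min_def abs_if)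
    also have "\<dots> \<le> (M + 1) * \<bar>max 0 (min 2 x) - max 0 (min 2 y)\<bar>"
      by (rule G)
    also have "\<dots> \<le> (M + 1) * \<bar>x - y\<bar>"
      using \<open>0 \<le> M\<close> by (intro mult_left_mono) auto
    finally show ?thesis .
  qed
  have c_const: "c x = c 2" if "2 \<le> x" for x
    using that by (simp add: c_def)
  have "0 < h"
    using assms by (simp add: h)
  have c01: "0 \<le> c x" "c x \<le> 1" for x
    using c_range[of x] \<open>0 < \<delta>\<close> by linarith+
  obtain g g' g'' where g:
    "\<And>t. (g has_real_derivative g' t) (at t)" "\<And>t. (g' has_real_derivative g'' t) (at t)"
    "continuous_on UNIV g''" "\<And>t. \<exists>r. t < r \<and> r < t + 2 * h \<and> g t = c r"
    "\<And>t. \<bar>g' t\<bar> \<le> 1 / h" "\<And>t. \<bar>g'' t\<bar> \<le> 2 / h\<^sup>2"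
    using ex_C2_approx[OF continuous_on_lipschitz[OF c_lip] c01 \<open>0 < h\<close>] by blast
  have g_const: "g t = c 2" if "2 \<le> t" for t
  proof -
    obtain r where "t < r" "g t = c r"
      using g(4)[of t] by blast
    with that c_const[of r] show ?thesis
      by simp
  qed
  \<comment> \<open>\<open>h\<close> is chosen so that the Lipschitz constant times the window
    length \<open>2 * h\<close> is \<open>\<delta> / 8\<close>. With the radius
    \<open>5 / 8 * \<delta>\<close> of the control this adds up to \<open>3 / 4 * \<delta>\<close>,
    strictly inside the strip.\<close>
  have g_near: "\<bar>g t - c t\<bar> \<le> \<delta> / 8" for t
  proof -
    obtain r where r: "t < r" "r < t + 2 * h" "g t = c r"
      using g(4)[of t] by blast
    have "\<bar>g t - c t\<bar> \<le> (M + 1) * \<bar>r - t\<bar>"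
      unfolding r(3) by (rule c_lip)
    also have "\<dots> \<le> (M + 1) * (2 * h)"
      using r \<open>0 \<le> M\<close> by (intro mult_left_mono) auto
    also have "\<dots> = \<delta> / 8"
      using \<open>0 \<le> M\<close> by (simp add: h field_simps)
    finally show ?thesis .
  qed
  show ?thesis
  proof (rule that)
    have "\<delta> \<le> g t \<and> g t \<le> 1 - \<delta>" for t
      using g(4)[of t] c_range by metis
    moreover have "\<bar>g' t\<bar> \<le> 1 / h + 2 / h\<^sup>2" "\<bar>g'' t\<bar> \<le> 1 / h + 2 / h\<^sup>2" for t
      using g(5,6)[of t] \<open>0 < h\<close> by (auto intro: order_trans)
    moreover have "\<forall>t\<ge>2. g t = g 2"
      using g_const by (metis order_refl)
    ultimately show "C2_curve \<delta> (1 / h + 2 / h\<^sup>2) g g' g''"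
      unfolding C2_curve_def using g(1-3) by blast
    show "q \<delta> T \<gamma> \<in> sets lebesgue"
      by (rule q_measurable[OF continuous_on_lipschitz[OF G(1)]])
        (use G(2) in \<open>eventually_elim, blast\<close>)
    show "AE t in lebesgue. t \<in> {0<..<T} \<longrightarrow> t \<le> 2 \<longrightarrow>
      (\<forall>x. \<bar>x - g t\<bar> \<le> 5 / 8 * \<delta> \<longrightarrow> \<bar>x - \<gamma> t\<bar> < \<delta>)"
      using G(2)
    proof eventually_elim
      case (elim t)
      show ?case
      proof (intro impI allI)
        fix x
        assume t: "t \<in> {0<..<T}" "t \<le> 2" and x: "\<bar>x - g t\<bar> \<le> 5 / 8 * \<delta>"
        then have "c t = \<gamma> t"
          using elim by (auto simp: c_def)
        then show "\<bar>x - \<gamma> t\<bar> < \<delta>"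
          using g_near[of t] x \<open>0 < \<delta>\<close> by linarith
      qed
    qed
  qed
qed

lemma L2_norm_test_function:
  assumes "\<eta> \<in> test_functions S"
  shows "(L2_norm_on Omega \<eta>)\<^sup>2 = integral {0..1} (\<lambda>x. (\<eta> x)\<^sup>2)"
proof -
  have "continuous_on UNIV (\<lambda>x. (\<eta> x)\<^sup>2)"
    using assms by (intro continuous_on_power smooth_continuous) (simp add: test_functions_iff)
  from set_lebesgue_integral_continuous[OF this, of 0 1] show ?thesis
    by (simp add: L2_norm_on_sq set_lebesgue_integral_real Omega_def)
qed

text \<open>Data of the two kinds isolate the two components in \<open>duality_bound\<close>: the
  term with \<phi>0 drops out for (\<eta>, 0), the one with \<phi>1 for (0, \<eta>). Letting \<eta>
  range over the test functions then recovers each norm.\<close>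

theorem corollary1:
  fixes T \<delta>0 M :: real
  assumes "T \<ge> 2" and "\<delta>0 > 0" and "M > 0"
  shows "\<exists>C_obs>0. \<forall>\<gamma>\<in>G_ad \<delta>0 M T. \<forall>\<phi>0\<in>L2_on Omega. \<forall>\<phi>1\<in>Hm1. \<forall>\<phi>.
           wave_solution T \<phi>0 \<phi>1 \<phi> \<longrightarrow>
           (W_norm \<phi>0 \<phi>1)\<^sup>2 \<le> C_obs * (L2_norm_on (q \<delta>0 T \<gamma>) (\<lambda>(x, t). \<phi> t x))\<^sup>2"
proof -
  define h where "h = \<delta>0 / (16 * (M + 1))"
  have "0 < h"
    using assms by (simp add: h_def)
  then have "0 \<le> 1 / h + 2 / h\<^sup>2"
    by simp
  then obtain C where C: "control_cost \<delta>0 (1 / h + 2 / h\<^sup>2) (\<lambda>g. True) C"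
    using ex_control[OF assms(2)] by blast
  then have "0 \<le> C"
    by (simp add: control_cost_def)
  \<comment> \<open>\<open>2 * C\<close> pays for \<phi>1, including the factor 2 of
    \<open>Hm1_norm_sq_le\<close>, and \<open>C\<close> for \<phi>0; the summand 1 makes the
    constant positive.\<close>
  have "(W_norm \<phi>0 \<phi>1)\<^sup>2 \<le> (3 * C + 1) * (L2_norm_on (q \<delta>0 T \<gamma>) (\<lambda>(x, t). \<phi> t x))\<^sup>2"
    if \<gamma>: "\<gamma> \<in> G_ad \<delta>0 M T" and \<phi>0: "\<phi>0 \<in> L2_on Omega" and \<phi>1: "\<phi>1 \<in> Hm1"
      and sol: "wave_solution T \<phi>0 \<phi>1 \<phi>" for \<gamma> \<phi>0 \<phi>1 \<phi>
  proof -
    define P where "P = (L2_norm_on (q \<delta>0 T \<gamma>) (\<lambda>(x, t). \<phi> t x))\<^sup>2"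
    have "0 \<le> P"
      by (simp add: P_def)
    obtain g g' g'' where g: "C2_curve \<delta>0 (1 / h + 2 / h\<^sup>2) g g' g''" "q \<delta>0 T \<gamma> \<in> sets lebesgue"
      "AE t in lebesgue. t \<in> {0<..<T} \<longrightarrow> t \<le> 2 \<longrightarrow>
        (\<forall>x. \<bar>x - g t\<bar> \<le> 5 / 8 * \<delta>0 \<longrightarrow> \<bar>x - \<gamma> t\<bar> < \<delta>0)"
      using G_ad_C2_curve[OF \<gamma> assms(1) less_imp_le[OF assms(3)] assms(2) h_def] by blast
    have trans: "transposition_solution T \<phi>0 \<phi>1 \<phi>"
      using sol by (simp add: wave_solution_def)
    note bound = duality_bound[OF trans _ _ g(2,3), folded P_def]
    have "(\<phi>1 \<eta>)\<^sup>2 \<le> (C * P) * (L2_norm_on Omega (deriv \<eta>))\<^sup>2" if \<eta>: "\<eta> \<in> test_functions Omega" for \<eta>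
    proof -
      have "smooth \<eta>"
        using \<eta> by (simp add: test_functions_iff)
      \<comment> \<open>The case \<open>\<tau> = - 1\<close> with \<open>U = \<eta>\<close>: compact
        support of \<eta> gives \<open>U 1 = 0\<close>, as the odd extension requires.\<close>
      have "controlled T g (5 / 8 * \<delta>0) (\<lambda>x. (1 - - 1) / 2 * \<eta> x) (\<lambda>x. (1 + - 1) / 2 * deriv \<eta> x)
          (C * integral {0..1} (\<lambda>x. (deriv \<eta> x)\<^sup>2))"
        using test_function_at_boundary[OF \<eta>] smooth_DERIV[OF \<open>smooth \<eta>\<close>]
        by (intro control_costD[OF C assms(1) g(1)] test_functions_deriv[OF \<eta>]) auto
      then have "controlled T g (5 / 8 * \<delta>0) \<eta> (\<lambda>x. 0) (C * integral {0..1} (\<lambda>x. (deriv \<eta> x)\<^sup>2))"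
        by simp
      from bound[OF this] have "(\<phi>1 \<eta>)\<^sup>2 \<le> P * (C * integral {0..1} (\<lambda>x. (deriv \<eta> x)\<^sup>2))"
        using test_function_at_boundary[OF \<eta>] by (force simp: set_lebesgue_integral_def)
      then show ?thesis
        by (simp add: L2_norm_test_function[OF test_functions_deriv[OF \<eta>]] mult_ac)
    qed
    then have 1: "(Hm1_norm \<phi>1)\<^sup>2 \<le> 2 * (C * P)"
      using \<open>0 \<le> C\<close> \<open>0 \<le> P\<close> by (intro Hm1_norm_sq_le \<phi>1) auto
    have "(set_lebesgue_integral lebesgue Omega (\<lambda>x. \<phi>0 x * \<eta> x))\<^sup>2 \<le> (C * P) * (L2_norm_on Omega \<eta>)\<^sup>2"
      if \<eta>: "\<eta> \<in> test_functions Omega" for \<eta>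
    proof -
      have "smooth \<eta>"
        using \<eta> by (simp add: test_functions_iff)
      obtain F where F: "\<And>x. (F has_real_derivative \<eta> x) (at x)"
        using ex_antiderivative[OF smooth_continuous[OF \<open>smooth \<eta>\<close>]] by blast
      define U where "U x = F x - F 0" for x
      have dU: "(U has_real_derivative \<eta> x) (at x)" for x
        using DERIV_diff[OF F[of x] DERIV_const[of "F 0"]] by (simp add: U_def[abs_def])
      have U0: "U x = 0" if x0: "x \<le> 0" for x
      proof (cases "x = 0")
        case False
        then obtain z where "z < 0" "U 0 - U x = (0 - x) * \<eta> z"
          using MVT2[of x 0 U \<eta>] dU x0 by auto
        then show ?thesis
          using test_function_at_boundary[OF \<eta>, of z] by (simp add: U_def)
      qed (simp add: U_def)
      \<comment> \<open>The case \<open>\<tau> = 1\<close>: the even extension puts no condition on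
        \<open>U 1\<close>, so \<eta> may have any mean.\<close>
      have "controlled T g (5 / 8 * \<delta>0) (\<lambda>x. (1 - 1) / 2 * U x) (\<lambda>x. (1 + 1) / 2 * \<eta> x)
          (C * integral {0..1} (\<lambda>x. (\<eta> x)\<^sup>2))"
        using dU U0 by (intro control_costD[OF C assms(1) g(1)] \<eta>) auto
      then have "controlled T g (5 / 8 * \<delta>0) (\<lambda>x. 0) \<eta> (C * integral {0..1} (\<lambda>x. (\<eta> x)\<^sup>2))"
        by simp
      from bound[OF this] have "(set_lebesgue_integral lebesgue Omega (\<lambda>x. \<phi>0 x * \<eta> x))\<^sup>2 \<le>
          P * (C * integral {0..1} (\<lambda>x. (\<eta> x)\<^sup>2))"
        using Hm1_zero[OF \<phi>1] by simp
      then show ?thesis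
        by (simp add: L2_norm_test_function[OF \<eta>] mult_ac)
    qed
    then have 2: "(L2_norm_on Omega \<phi>0)\<^sup>2 \<le> C * P"
      using \<open>0 \<le> C\<close> \<open>0 \<le> P\<close> \<phi>0 unfolding Omega_def by (intro L2_norm_sq_le) auto
    have "(W_norm \<phi>0 \<phi>1)\<^sup>2 = (L2_norm_on Omega \<phi>0)\<^sup>2 + (Hm1_norm \<phi>1)\<^sup>2"
      by (simp add: W_norm_def)
    also have "\<dots> \<le> (3 * C + 1) * P"
      using 1 2 \<open>0 \<le> P\<close> by (simp add: distrib_right)
    finally show ?thesis
      by (simp add: P_def)
  qed
  then show ?thesis
    using \<open>0 \<le> C\<close> by (intro exI[of _ "3 * C + 1"]) auto
qed

end
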